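(* Let $\alpha\ge0$, and consider cooperative branching with rate $\alpha$ and deaths with rate $1$ on $S=\{0,1\}$, with $z_{\rm low},z_{\rm mid},z_{\rm upp}$, the fixed points $\nu_{\rm low},\nu_{\rm mid},\nu_{\rm upp}\in\mathcal P(\{0,1\})$ of the mean-field equation, the higher-level map $\check T$, the higher-level mean-field equation and the measures $\underline\nu,\overline\nu\in\mathcal P(\mathcal P(\{0,1\}))$ as defined in the context. For $\alpha>4$ one has $$\underline\nu_{\rm low}=\overline\nu_{\rm low},\qquad \underline\nu_{\rm upp}=\overline\nu_{\rm upp},\qquad\text{but}\qquad\underline\nu_{\rm mid}\ne\overline\nu_{\rm mid}.$$ Moreover, for $\alpha>4$ the higher-level RDE $\check T(\rho)=\rho$ has exactly four solutions in $\mathcal P(\mathcal P(\{0,1\}))$, namely $$\overline\nu_{\rm low},\quad\underline\nu_{\rm mid},\quad\overline\nu_{\rm mid},\quad\overline\nu_{\rm upp},$$ and any solution $(\rho_t)_{t\ge0}$ to the higher-level mean-field equation converges (weakly) as $t\to\infty$ to one of these fixed points, the respective domains of attraction being $$\{\rho_0:\rho_0^{(1)}(\{1\})<z_{\rm mid}\},\quad\{\rho_0:\rho_0^{(1)}(\{1\})=z_{\rm mid},\ \rho_0\ne\overline\nu_{\rm mid}\},\quad\{\overline\nu_{\rm mid}\},\quad\{\rho_0:\rho_0^{(1)}(\{1\})>z_{\rm mid}\}.$$ For $\alpha=4$ there are two fixed points $\overline\nu_{\rm low}$ and $\overline\nu_{\rm upp}$, with respective domains of attraction $$\{\rho_0:\rho_0^{(1)}(\{1\})<z_{\rm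 mid}\}\quad\text{and}\quad\{\rho_0:\rho_0^{(1)}(\{1\})\ge z_{\rm mid}\},$$ while for $\alpha<4$ all solutions converge to $\overline\nu_{\rm low}$.
   Context: Let $\mathtt{cob}:\{0,1\}^3\to\{0,1\}$, $\mathtt{cob}(x_1,x_2,x_3):=x_1\vee(x_2\wedge x_3)$, and let $\mathtt{dth}:\{0,1\}^0\to\{0,1\}$ be the constant $0$. For $g:S^k\to S$, $T_g(\mu)$ is the law of $g(X_1,\ldots,X_k)$ with $X_i$ i.i.d. of law $\mu$. The mean-field equation is $\frac{\partial}{\partial t}\mu_t=\alpha\{T_{\mathtt{cob}}(\mu_t)-\mu_t\}+\{T_{\mathtt{dth}}(\mu_t)-\mu_t\}$ on $\mathcal P(\{0,1\})$; with $p_t=\mu_t(\{1\})$ it reads $\frac{\partial}{\partial t}p_t=\alpha p_t^2(1-p_t)-p_t$. Its fixed points are given by $z_{\rm low}:=0$ and, for $\alpha\ge4$, $z_{\rm mid}:=\frac12-\sqrt{\frac14-\frac1\alpha}$, $z_{\rm upp}:=\frac12+\sqrt{\frac14-\frac1\alpha}$; $\nu_{\ldots}$ denotes the probability measure on $\{0,1\}$ with $\nu_{\ldots}(\{1\})=z_{\ldots}$ ($\ldots=$ low, mid, upp). Higher level: for $g:S^k\to S$ let $\check g:\mathcal P(S)^k\to\mathcal P(S)$, $\check g(\mu_1,\ldots,\mu_k):=$ the law of $g(X_1,\ldots,X_k)$ with $X_1,\ldots,X_k$ independent with laws $\mu_1,\ldots,\mu_k$. For $\rho\in\mathcal P(\mathcal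 P(S))$, $T_{\check g}(\rho)$ is the law of $\check g(\xi_1,\ldots,\xi_k)$ with $\xi_i$ i.i.d. with law $\rho$, and $\check T(\rho):=\frac{\alpha}{\alpha+1}T_{\check{\mathtt{cob}}}(\rho)+\frac1{\alpha+1}T_{\check{\mathtt{dth}}}(\rho)$. The higher-level mean-field equation is $\frac{\partial}{\partial t}\rho_t=(\alpha+1)\{\check T(\rho_t)-\rho_t\}$, $t\ge0$, for $\rho_t\in\mathcal P(\mathcal P(\{0,1\}))$ (understood after integration against bounded measurable functions). $\mathcal P(S)$ carries the topology of weak convergence, and $\mathcal P(\mathcal P(S))$ the corresponding topology of weak convergence. Fixed points are solutions of $\check T(\rho)=\rho$. $\rho^{(1)}:=\int\rho(\mathrm d\mu)\,\mu\in\mathcal P(\{0,1\})$ is the mean of $\rho$. For a fixed point $\nu$ of the mean-field equation, $\overline\nu$ is the law of $\delta_X$ where $X$ has law $\nu$, and $\underline\nu$ is the weak limit as $t\to\infty$ (which exists) of the solution of the higher-level mean-field equation started in $\rho_0=\delta_\nu$. These are the maximal and minimal solutions, in the convex order, of $\check T(\rho)=\rho$ among those with $\rho^{(1)}=\nu$. *)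

theory Defs
  imports "HOL-Probability.Probability"
begin

text \<open>
  The set of probability measures on a measurable space \<open>M\<close> is the space of \<open>prob_algebra M\<close>,
  whose sigma-algebra is generated by the evaluations \<open>\<mu> \<mapsto> \<mu> A\<close>. For \<open>M = spin\<close> this is
  the Borel sigma-algebra of the topology of weak convergence.
\<close>

abbreviation spin :: "bool measure" where
  "spin \<equiv> count_space UNIV"

abbreviation P_spin :: "bool measure measure" where
  "P_spin \<equiv> prob_algebra spin"

abbreviation PP_spin :: "bool measure measure measure" where
  "PP_spin \<equiv> prob_algebra P_spin"

text \<open>
  The initial topology on the probability measures on \<open>M\<close> with respect to the integrals of
  bounded \<open>T\<close>-continuous functions, where \<open>T\<close> is a topology on \<open>space M\<close>.
\<close>

definition weak_topology :: "'a measure \<Rightarrow> 'a topology \<Rightarrow> 'a measure topology" where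
  "weak_topology M T = topology_generated_by
     {{\<mu> \<in> space (prob_algebra M). (\<integral>x. f x \<partial>\<mu>) \<in> U} | (f :: 'a \<Rightarrow> real) U.
        continuous_map T euclideanreal f \<and> bounded (f ` topspace T) \<and> open U}"

abbreviation P_top :: "bool measure topology" where
  "P_top \<equiv> weak_topology spin (discrete_topology UNIV)"

abbreviation PP_top :: "bool measure measure topology" where
  "PP_top \<equiv> weak_topology P_spin P_top"

text \<open>
  A map \<open>g : S\<^sup>k \<rightarrow> S\<close> is a function on families indexed by \<open>{..<k}\<close>. \<open>check_map M k g\<close> is the
  induced map on \<open>k\<close>-tuples of laws. The law \<open>T_map M k g \<mu>\<close> makes sense on every level: on the
  higher one, \<open>M\<close> is a space of probability measures and \<open>g\<close> is itself of the form \<open>check_map\<close>.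
\<close>

definition check_map ::
  "'a measure \<Rightarrow> nat \<Rightarrow> ((nat \<Rightarrow> 'a) \<Rightarrow> 'a) \<Rightarrow> (nat \<Rightarrow> 'a measure) \<Rightarrow> 'a measure" where
  "check_map M k g \<mu>s = distr (PiM {..<k} \<mu>s) M g"

definition T_map ::
  "'a measure \<Rightarrow> nat \<Rightarrow> ((nat \<Rightarrow> 'a) \<Rightarrow> 'a) \<Rightarrow> 'a measure \<Rightarrow> 'a measure" where
  "T_map M k g \<mu> = check_map M k g (\<lambda>_. \<mu>)"

definition cob :: "(nat \<Rightarrow> bool) \<Rightarrow> bool" where
  "cob x \<longleftrightarrow> x 0 \<or> (x 1 \<and> x 2)"

definition dth :: "(nat \<Rightarrow> bool) \<Rightarrow> bool" where
  "dth x \<longleftrightarrow> False"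

definition T_check :: "real \<Rightarrow> bool measure measure \<Rightarrow> bool measure measure" where
  "T_check \<alpha> \<rho> = measure_of (space P_spin) (sets P_spin)
     (\<lambda>A. ennreal (\<alpha> / (\<alpha> + 1)) * emeasure (T_map P_spin 3 (check_map spin 3 cob) \<rho>) A
        + ennreal (1 / (\<alpha> + 1)) * emeasure (T_map P_spin 0 (check_map spin 0 dth) \<rho>) A)"

definition higher_fixed_points :: "real \<Rightarrow> bool measure measure set" where
  "higher_fixed_points \<alpha> = {\<rho> \<in> space PP_spin. T_check \<alpha> \<rho> = \<rho>}"

text \<open>
  Only the values \<open>\<rho> t\<close> with \<open>t \<ge> 0\<close> matter; the derivative at \<open>t = 0\<close> is one-sided.
\<close>

definition higher_solution :: "real \<Rightarrow> (real \<Rightarrow> bool measure measure) \<Rightarrow> bool" where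
  "higher_solution \<alpha> \<rho> \<longleftrightarrow>
     (\<forall>t\<ge>0. \<rho> t \<in> space PP_spin) \<and>
     (\<forall>f :: bool measure \<Rightarrow> real.
        f \<in> borel_measurable P_spin \<longrightarrow> bounded (f ` space P_spin) \<longrightarrow>
        (\<forall>t\<ge>0. ((\<lambda>s. \<integral>\<mu>. f \<mu> \<partial>\<rho> s) has_real_derivative
           (\<alpha> + 1) * ((\<integral>\<mu>. f \<mu> \<partial>T_check \<alpha> (\<rho> t)) - (\<integral>\<mu>. f \<mu> \<partial>\<rho> t))) (at t within {0..})))"

text \<open>
  The initial value problem being well-posed, ``the solution started in \<open>\<rho>0\<close> converges
  to \<open>L\<close>'' is rendered as the existence of a solution together with the convergence of
  every solution, so that neither half can hold vacuously.
\<close>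

definition attracted_to ::
  "real \<Rightarrow> bool measure measure \<Rightarrow> bool measure measure \<Rightarrow> bool" where
  "attracted_to \<alpha> \<rho>0 L \<longleftrightarrow>
     (\<exists>\<rho>. higher_solution \<alpha> \<rho> \<and> \<rho> 0 = \<rho>0) \<and>
     (\<forall>\<rho>. higher_solution \<alpha> \<rho> \<and> \<rho> 0 = \<rho>0 \<longrightarrow> limitin PP_top \<rho> L at_top)"

definition attraction_domain :: "real \<Rightarrow> bool measure measure \<Rightarrow> bool measure measure set" where
  "attraction_domain \<alpha> L = {\<rho>0 \<in> space PP_spin. attracted_to \<alpha> \<rho>0 L}"

text \<open>The mean \<open>\<integral> \<rho>(d\<mu>) \<mu>\<close>.\<close>

definition mean_measure :: "bool measure measure \<Rightarrow> bool measure" where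
  "mean_measure \<rho> = \<rho> \<bind> (\<lambda>\<mu>. \<mu>)"

definition nu_over :: "bool measure \<Rightarrow> bool measure measure" where
  "nu_over \<nu> = distr \<nu> P_spin (return spin)"

text \<open>The limit is unique, as weak limits are.\<close>

definition nu_under :: "real \<Rightarrow> bool measure \<Rightarrow> bool measure measure" where
  "nu_under \<alpha> \<nu> = (THE L. attracted_to \<alpha> (return P_spin \<nu>) L)"

text \<open>
  These are the zeros of the drift \<open>\<alpha> p\<^sup>2 (1 - p) - p\<close> of \<open>p = \<mu> {True}\<close> under the mean-field
  equation; \<open>z_mid \<alpha>\<close> and \<open>z_upp \<alpha>\<close> are meaningful only for \<open>\<alpha> \<ge> 4\<close>.
\<close>

definition z_low :: real where
  "z_low = 0"

definition z_mid :: "real \<Rightarrow> real" where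
  "z_mid \<alpha> = 1 / 2 - sqrt (1 / 4 - 1 / \<alpha>)"

definition z_upp :: "real \<Rightarrow> real" where
  "z_upp \<alpha> = 1 / 2 + sqrt (1 / 4 - 1 / \<alpha>)"

definition nu_low :: "bool measure" where
  "nu_low = measure_pmf (bernoulli_pmf z_low)"

definition nu_mid :: "real \<Rightarrow> bool measure" where
  "nu_mid \<alpha> = measure_pmf (bernoulli_pmf (z_mid \<alpha>))"

definition nu_upp :: "real \<Rightarrow> bool measure" where
  "nu_upp \<alpha> = measure_pmf (bernoulli_pmf (z_upp \<alpha>))"

end

theory Submission
  imports Defs
begin

text \<open>
  Identify a probability measure on \<open>{False, True}\<close> with the mass \<open>p\<close> that it gives to \<open>True\<close>. The
  higher-level equation then describes a law on \<open>[0, 1]\<close> driven by the map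
  \<open>(x, y, z) \<mapsto> x + (1 - x) y z\<close>, and weak convergence is convergence of all moments. The mean \<open>m\<close>
  solves the mean-field equation, and the fluctuation \<open>v = \<integral> p (1 - p)\<close> solves
  \<open>v' = v (\<alpha> (2 m - 3 m\<^sup>2 - v (1 + m) + v\<^sup>2) - 1)\<close>. If \<open>m\<close> tends to \<open>z_low\<close> or \<open>z_upp\<close>, then \<open>v\<close>
  tends to 0, which forces convergence to the law of a Dirac measure at a random point.

  If \<open>m\<close> is constantly \<open>z_mid\<close> and \<open>v\<close> is not 0 initially, then \<open>v\<close> is eventually bounded from below by a
  constant so large that the flow contracts Zolotarev's distance of order 2 (test functions \<open>f\<close> with
  \<open>\<bar>f''\<bar> \<le> 1\<close>). All such solutions, in particular the time shifts of one of them, thus approach each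
  other exponentially fast, hence they share a limit, which compactness provides. Solutions exist by an
  explicit Wild sum over ternary trees.
\<close>

section \<open>Probability measures on the two-point space\<close>

text \<open>The choice of order 2 is forced. Cooperative branching is affine in each argument, with
  slopes \<open>1 - y * z\<close>, \<open>(1 - x) * z\<close> and \<open>(1 - x) * y\<close>.
  Lipschitz test functions would pick up the expected slopes, 1 - m^2 + 2 m (1 - m) in total, and at
  m = \<open>z_mid \<alpha>\<close> this times \<alpha> exceeds \<alpha> + 1: the estimate sees the
  instability of the mean. Fixing the mean makes affine functions cancel, and functions of bounded
  curvature pick up expected squared slopes. Multiplied by \<alpha>, these exceed \<alpha> + 1 by
  \<alpha> (Q - 2 (1 + m) v + 3 v^2) with Q = m (1 - 2 m), if both laws have fluctuation v. That is
  exactly the derivative in v of the drift of v. So the bound contracts near the positive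
  equilibrium of v but not near v = 0, as it must be, because
  \<open>nu_over (nu_mid \<alpha>)\<close> is a second fixed point with the same mean. The fixed
  points are read off from the limits: a fixed point is a constant solution and hence its own limit,
  and every limit is a fixed point.\<close>

abbreviation bern :: "real \<Rightarrow> bool measure" where
  "bern p \<equiv> measure_pmf (bernoulli_pmf p)"

abbreviation p1 :: "bool measure \<Rightarrow> real" where
  "p1 \<mu> \<equiv> measure \<mu> {True}"

abbreviation cob_poly :: "real \<Rightarrow> real \<Rightarrow> real \<Rightarrow> real" where
  "cob_poly x y z \<equiv> x + (1 - x) * y * z"

lemma cob_poly_bounds:
  assumes "x \<in> {0..1}" "y \<in> {0..1}" "z \<in> {0..1}"
  shows "cob_poly x y z \<in> {0..1::real}"
proof -
  have "0 \<le> y * z" "y * z \<le> 1" using assms by (auto intro: mult_le_one)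
  moreover have "(1 - x) * (y * z) \<le> (1 - x) * 1" using assms \<open>y * z \<le> 1\<close> by (intro mult_left_mono) auto
  moreover have "0 \<le> (1 - x) * (y * z)" using assms \<open>0 \<le> y * z\<close> by auto
  ultimately show ?thesis using assms by (auto simp: mult.assoc)
qed

lemma in_P_spin: "\<mu> \<in> space P_spin \<longleftrightarrow> sets \<mu> = UNIV \<and> prob_space \<mu>"
  by (auto simp: space_prob_algebra)

lemma in_PP_spin: "\<rho> \<in> space PP_spin \<longleftrightarrow> sets \<rho> = sets P_spin \<and> prob_space \<rho>"
  by (auto simp: space_prob_algebra)

lemma bern_in_P_spin [simp]: "bern p \<in> space P_spin"
  by (auto simp: in_P_spin intro: prob_space_measure_pmf)

text \<open>\<open>bernoulli_pmf\<close> clips its parameter to the unit interval, so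
  \<open>bern\<close> makes sense on all reals and functions on \<open>P_spin\<close> can be
  transported to functions on the real line.\<close>

lemma p1_bern: "p1 (bern p) = max 0 (min 1 p)"
proof -
  have "pmf (bernoulli_pmf p) True = max 0 (min 1 p)"
    by (simp add: bernoulli_pmf.rep_eq max_def min_def)
  then show ?thesis by (simp add: pmf.rep_eq)
qed

lemma p1_bern_eq [simp]: "p \<in> {0..1} \<Longrightarrow> p1 (bern p) = p"
  by (auto simp: p1_bern)

lemma p1_bounds: "\<mu> \<in> space P_spin \<Longrightarrow> p1 \<mu> \<in> {0..1}"
  by (auto simp: in_P_spin intro: prob_space.prob_le_1)

lemma P_spin_eqI:
  assumes "\<mu> \<in> space P_spin" "\<nu> \<in> space P_spin" "p1 \<mu> = p1 \<nu>"
  shows "\<mu> = \<nu>"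
proof -
  have sets: "sets \<mu> = UNIV" "sets \<nu> = UNIV" and sp: "space \<mu> = UNIV" "space \<nu> = UNIV"
    using assms(1,2) by (auto simp: in_P_spin dest: sets_eq_imp_space_eq[of _ spin, simplified])
  interpret \<mu>: prob_space \<mu> using assms(1) by (simp add: in_P_spin)
  interpret \<nu>: prob_space \<nu> using assms(2) by (simp add: in_P_spin)
  have F: "UNIV - {True} = {False}" by auto
  have "measure \<mu> {False} = measure \<nu> {False}"
    using \<mu>.prob_compl[of "{True}"] \<nu>.prob_compl[of "{True}"] assms(3) sets sp by (simp add: F)
  then have "emeasure \<mu> {a} = emeasure \<nu> {a}" for a
    using assms(3) by (cases a) (simp_all add: \<mu>.emeasure_eq_measure \<nu>.emeasure_eq_measure)
  then show ?thesis
    by (intro measure_eqI_countable[of _ UNIV]) (auto simp: sets)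
qed

lemma bern_p1 [simp]: "\<mu> \<in> space P_spin \<Longrightarrow> bern (p1 \<mu>) = \<mu>"
  using p1_bounds by (intro P_spin_eqI) auto

lemma measurable_p1 [measurable]: "p1 \<in> borel_measurable P_spin"
  by (rule measurable_measure_prob_algebra) simp

lemma measurable_bern [measurable]: "bern \<in> borel \<rightarrow>\<^sub>M P_spin"
\<comment> \<open>The empty set is included to make the generator stable under
  intersections.\<close>
proof (rule measurable_prob_algebra_generated[where G="{{True},{False},{}}" and \<Omega>=UNIV])
  show "sets spin = sigma_sets UNIV {{True}, {False}, {}}"
  proof -
    have "A \<in> sigma_sets UNIV {{True}, {False}, {}}" for A :: "bool set"
    proof -
      have "A \<in> {{True}, {False}, {}, UNIV}" by (cases "True \<in> A"; cases "False \<in> A") (auto, (metis (full_types))+)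
      then show ?thesis by (auto intro: sigma_sets.Basic sigma_sets_top)
    qed
    then show ?thesis by auto
  qed
  have T: "emeasure (bern a) {True} = ennreal (max 0 (min 1 a))" for a
    by (simp add: measure_pmf.emeasure_eq_measure p1_bern)
  have F: "emeasure (bern a) {False} = ennreal (1 - max 0 (min 1 a))" for a
  proof -
    have "UNIV - {True} = {False}" by auto
    then show ?thesis
      using measure_pmf.prob_compl[of "{True}" "bernoulli_pmf a"] p1_bern[of a]
      by (simp add: measure_pmf.emeasure_eq_measure)
  qed
  show "\<And>A. A \<in> {{True}, {False}, {}} \<Longrightarrow> (\<lambda>a. emeasure (bern a) A) \<in> borel_measurable borel"
    by (auto simp: T F)
qed (auto simp: Int_stable_def intro: prob_space_measure_pmf)

section \<open>Expectations of functions of the mass at \<open>True\<close>\<close>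

definition pexp :: "bool measure measure \<Rightarrow> (real \<Rightarrow> real) \<Rightarrow> real" where
  "pexp \<rho> h = (\<integral>\<mu>. h (p1 \<mu>) \<partial>\<rho>)"

text \<open>Measurable on the whole line but bounded only on the unit interval, where
  \<open>p1\<close> takes its values, so that polynomials qualify.\<close>

definition bdd_test :: "(real \<Rightarrow> real) \<Rightarrow> bool" where
  "bdd_test h \<longleftrightarrow> h \<in> borel_measurable borel \<and> bounded (h ` {0..1})"

lemma PP_spinD:
  assumes "\<rho> \<in> space PP_spin"
  shows "prob_space \<rho>" "sets \<rho> = sets P_spin" "space \<rho> = space P_spin"
  using assms by (auto simp: in_PP_spin dest: sets_eq_imp_space_eq)

lemma integrable_pexp:
  assumes "\<rho> \<in> space PP_spin" "bdd_test h"
  shows "integrable \<rho> (\<lambda>\<mu>. h (p1 \<mu>))"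
proof -
  interpret prob_space \<rho> using PP_spinD[OF assms(1)] by simp
  note [measurable_cong] = PP_spinD(2)[OF assms(1)]
  have [measurable]: "h \<in> borel_measurable borel" using assms(2) by (simp add: bdd_test_def)
  obtain B where B: "\<And>x. x \<in> {0..1} \<Longrightarrow> \<bar>h x\<bar> \<le> B"
    using assms(2) unfolding bdd_test_def bounded_iff by (metis imageI real_norm_def)
  show ?thesis
    using B p1_bounds PP_spinD(3)[OF assms(1)]
    by (intro integrable_const_bound[where B=B]) (auto intro!: AE_I2)
qed

lemma pexp_mono:
  assumes "\<rho> \<in> space PP_spin" "bdd_test h" "bdd_test k" "\<And>x. x \<in> {0..1} \<Longrightarrow> h x \<le> k x"
  shows "pexp \<rho> h \<le> pexp \<rho> k"
  unfolding pexp_def using integrable_pexp[OF assms(1)] assms p1_bounds PP_spinD(3)[OF assms(1)]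
  by (intro integral_mono) auto

lemma pexp_cong:
  assumes "\<rho> \<in> space PP_spin" "\<And>x. x \<in> {0..1} \<Longrightarrow> h x = k x"
  shows "pexp \<rho> h = pexp \<rho> k"
  unfolding pexp_def using assms p1_bounds PP_spinD(3)[OF assms(1)]
  by (intro Bochner_Integration.integral_cong) auto

lemma pexp_const [simp]: "\<rho> \<in> space PP_spin \<Longrightarrow> pexp \<rho> (\<lambda>x. c) = c"
  unfolding pexp_def using PP_spinD(1)[of \<rho>] by (simp add: prob_space.prob_space)

lemma pexp_add:
  assumes "\<rho> \<in> space PP_spin" "bdd_test h" "bdd_test k"
  shows "pexp \<rho> (\<lambda>x. h x + k x) = pexp \<rho> h + pexp \<rho> k"
  unfolding pexp_def using integrable_pexp[OF assms(1)] assms by (intro Bochner_Integration.integral_add) auto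

lemma pexp_diff:
  assumes "\<rho> \<in> space PP_spin" "bdd_test h" "bdd_test k"
  shows "pexp \<rho> (\<lambda>x. h x - k x) = pexp \<rho> h - pexp \<rho> k"
  unfolding pexp_def using integrable_pexp[OF assms(1)] assms by (intro Bochner_Integration.integral_diff) auto

lemma pexp_cmult [simp]: "pexp \<rho> (\<lambda>x. c * h x) = c * pexp \<rho> h"
  unfolding pexp_def by simp

lemma pexp_sum:
  assumes "\<rho> \<in> space PP_spin" "\<And>i. i \<in> I \<Longrightarrow> bdd_test (h i)"
  shows "pexp \<rho> (\<lambda>x. \<Sum>i\<in>I. h i x) = (\<Sum>i\<in>I. pexp \<rho> (h i))"
  unfolding pexp_def using integrable_pexp[OF assms(1)] assms by (intro Bochner_Integration.integral_sum) auto

lemma abs_pexp_le: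
  assumes "\<rho> \<in> space PP_spin" "bdd_test h" "\<And>x. x \<in> {0..1} \<Longrightarrow> \<bar>h x\<bar> \<le> B"
  shows "\<bar>pexp \<rho> h\<bar> \<le> B"
proof -
  have c: "bdd_test (\<lambda>x. B)" "bdd_test (\<lambda>x. - B)" by (auto simp: bdd_test_def bounded_iff)
  have 1: "pexp \<rho> h \<le> pexp \<rho> (\<lambda>x. B)" using assms by (intro pexp_mono c) (auto simp: abs_le_iff)
  have 2: "pexp \<rho> (\<lambda>x. - B) \<le> pexp \<rho> h"
    using assms(3) by (intro pexp_mono c assms) (force simp: abs_le_iff)
  show ?thesis using 1 2 pexp_const[OF assms(1), of B] pexp_const[OF assms(1), of "- B"] by linarith
qed

lemma bdd_test_continuous:
  assumes "h \<in> borel_measurable borel" "continuous_on {0..1} h"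
  shows "bdd_test h"
  unfolding bdd_test_def using assms compact_continuous_image[OF assms(2)]
  by (auto intro: compact_imp_bounded)

lemma bdd_test_continuous_UNIV: "continuous_on UNIV h \<Longrightarrow> bdd_test h"
  by (intro bdd_test_continuous borel_measurable_continuous_onI) (auto intro: continuous_on_subset)

lemma bdd_test_add: "bdd_test h \<Longrightarrow> bdd_test k \<Longrightarrow> bdd_test (\<lambda>x. h x + k x)"
  unfolding bdd_test_def using bounded_plus_comp[of h "{0..1}" k] by auto

lemma bdd_test_cmult: "bdd_test h \<Longrightarrow> bdd_test (\<lambda>x. c * h x)"
  unfolding bdd_test_def using bounded_scaling[of "h ` {0..1}" c] by (auto simp: image_image)

lemma bdd_test_comp:
  assumes "bdd_test h" "k \<in> borel_measurable borel" "\<And>x. x \<in> {0..1} \<Longrightarrow> k x \<in> {0..1}"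
  shows "bdd_test (\<lambda>x. h (k x))"
proof -
  have "(\<lambda>x. h (k x)) ` {0..1} \<subseteq> h ` {0..1}" using assms(3) by auto
  then show ?thesis using assms(1,2) unfolding bdd_test_def by (auto intro: bounded_subset)
qed

lemma bdd_test_polys [simp, intro]:
  "bdd_test (\<lambda>x. x)" "bdd_test (\<lambda>x. c)" "bdd_test (\<lambda>x. x ^ n)" "bdd_test (\<lambda>x. (1 - x) ^ n)"
  by (auto intro!: bdd_test_continuous_UNIV continuous_intros)

section \<open>Cooperative branching of independent arguments\<close>

definition cob_law ::
  "bool measure measure \<Rightarrow> bool measure measure \<Rightarrow> bool measure measure \<Rightarrow> bool measure measure" where
  "cob_law \<rho>1 \<rho>2 \<rho>3 = distr (\<rho>1 \<Otimes>\<^sub>M (\<rho>2 \<Otimes>\<^sub>M \<rho>3)) P_spin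
     (\<lambda>(\<mu>1, \<mu>2, \<mu>3). bern (cob_poly (p1 \<mu>1) (p1 \<mu>2) (p1 \<mu>3)))"

lemma measurable_cob_law_map:
  assumes "sets \<rho>1 = sets P_spin" "sets \<rho>2 = sets P_spin" "sets \<rho>3 = sets P_spin"
  shows "(\<lambda>(\<mu>1, \<mu>2, \<mu>3). bern (cob_poly (p1 \<mu>1) (p1 \<mu>2) (p1 \<mu>3)))
    \<in> \<rho>1 \<Otimes>\<^sub>M (\<rho>2 \<Otimes>\<^sub>M \<rho>3) \<rightarrow>\<^sub>M P_spin"
proof -
  note [measurable_cong] = assms
  show ?thesis by measurable
qed

lemma cob_law_in_PP_spin:
  assumes "\<rho>1 \<in> space PP_spin" "\<rho>2 \<in> space PP_spin" "\<rho>3 \<in> space PP_spin"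
  shows "cob_law \<rho>1 \<rho>2 \<rho>3 \<in> space PP_spin"
  using assms measurable_cob_law_map[of \<rho>1 \<rho>2 \<rho>3] unfolding cob_law_def
  by (auto simp: in_PP_spin intro!: prob_space.prob_space_distr prob_space_pair)

text \<open>Fubini on the nested product. Three different laws are allowed because the subtrees of a
  Wild tree differ in size and because two laws are later compared by exchanging one argument at a
  time.\<close>

lemma pexp_cob_law:
  assumes \<rho>: "\<rho>1 \<in> space PP_spin" "\<rho>2 \<in> space PP_spin" "\<rho>3 \<in> space PP_spin" and h: "bdd_test h"
  shows "pexp (cob_law \<rho>1 \<rho>2 \<rho>3) h = pexp \<rho>1 (\<lambda>x. pexp \<rho>2 (\<lambda>y. pexp \<rho>3 (\<lambda>z. h (cob_poly x y z))))"
proof -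
  interpret r1: prob_space \<rho>1 using PP_spinD[OF \<rho>(1)] by simp
  interpret r2: prob_space \<rho>2 using PP_spinD[OF \<rho>(2)] by simp
  interpret r3: prob_space \<rho>3 using PP_spinD[OF \<rho>(3)] by simp
  interpret r23: prob_space "\<rho>2 \<Otimes>\<^sub>M \<rho>3" by (intro prob_space_pair r2.prob_space_axioms r3.prob_space_axioms)
  interpret r123: prob_space "\<rho>1 \<Otimes>\<^sub>M (\<rho>2 \<Otimes>\<^sub>M \<rho>3)"
    by (intro prob_space_pair r1.prob_space_axioms r23.prob_space_axioms)
  interpret p23: pair_sigma_finite \<rho>2 \<rho>3 ..
  interpret p123: pair_sigma_finite \<rho>1 "\<rho>2 \<Otimes>\<^sub>M \<rho>3" ..
  note [measurable_cong] = PP_spinD(2)[OF \<rho>(1)] PP_spinD(2)[OF \<rho>(2)] PP_spinD(2)[OF \<rho>(3)]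
  have [measurable]: "h \<in> borel_measurable borel" using h by (simp add: bdd_test_def)
  obtain B where B: "\<And>x. x \<in> {0..1} \<Longrightarrow> \<bar>h x\<bar> \<le> B"
    using h unfolding bdd_test_def bounded_iff by (metis imageI real_norm_def)
  note sp = PP_spinD(3)[OF \<rho>(1)] PP_spinD(3)[OF \<rho>(2)] PP_spinD(3)[OF \<rho>(3)]
  let ?F = "\<lambda>(\<mu>1, \<mu>2, \<mu>3). h (cob_poly (p1 \<mu>1) (p1 \<mu>2) (p1 \<mu>3))"
  have bnd: "\<bar>?F (\<mu>1, \<mu>2, \<mu>3)\<bar> \<le> B" if "\<mu>1 \<in> space P_spin" "\<mu>2 \<in> space P_spin" "\<mu>3 \<in> space P_spin" for \<mu>1 \<mu>2 \<mu>3
    using that by (auto intro!: B cob_poly_bounds p1_bounds)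
  have int: "integrable (\<rho>1 \<Otimes>\<^sub>M (\<rho>2 \<Otimes>\<^sub>M \<rho>3)) ?F"
    by (rule r123.integrable_const_bound[where B=B])
       (use bnd in \<open>auto intro!: AE_I2 simp: space_pair_measure sp\<close>)
  have int2: "integrable (\<rho>2 \<Otimes>\<^sub>M \<rho>3) (\<lambda>(\<mu>2,\<mu>3). ?F (\<mu>1, \<mu>2, \<mu>3))" if "\<mu>1 \<in> space \<rho>1" for \<mu>1
    by (rule r23.integrable_const_bound[where B=B])
       (use bnd[of \<mu>1] that in \<open>auto intro!: AE_I2 simp: space_pair_measure sp\<close>)
  have "pexp (cob_law \<rho>1 \<rho>2 \<rho>3) h
      = (\<integral>\<omega>. h (p1 (case \<omega> of (\<mu>1, \<mu>2, \<mu>3) \<Rightarrow> bern (cob_poly (p1 \<mu>1) (p1 \<mu>2) (p1 \<mu>3)))) \<partial>(\<rho>1 \<Otimes>\<^sub>M (\<rho>2 \<Otimes>\<^sub>M \<rho>3)))"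
    unfolding pexp_def cob_law_def
    by (rule integral_distr[OF measurable_cob_law_map]) (use PP_spinD(2)[OF \<rho>(1)] PP_spinD(2)[OF \<rho>(2)] PP_spinD(2)[OF \<rho>(3)] in auto)
  also have "\<dots> = (\<integral>\<omega>. ?F \<omega> \<partial>(\<rho>1 \<Otimes>\<^sub>M (\<rho>2 \<Otimes>\<^sub>M \<rho>3)))"
    by (intro Bochner_Integration.integral_cong refl)
       (use p1_bern_eq[OF cob_poly_bounds[OF p1_bounds p1_bounds p1_bounds]] in \<open>auto simp: space_pair_measure sp\<close>)
  also have "\<dots> = (\<integral>\<mu>1. (\<integral>\<omega>. ?F (\<mu>1, \<omega>) \<partial>(\<rho>2 \<Otimes>\<^sub>M \<rho>3)) \<partial>\<rho>1)"
    by (rule p123.integral_fst'[OF int, symmetric])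
  also have "\<dots> = (\<integral>\<mu>1. (\<integral>\<mu>2. (\<integral>\<mu>3. ?F (\<mu>1, \<mu>2, \<mu>3) \<partial>\<rho>3) \<partial>\<rho>2) \<partial>\<rho>1)"
  proof (intro Bochner_Integration.integral_cong refl)
    fix \<mu>1 assume "\<mu>1 \<in> space \<rho>1"
    from p23.integral_fst'[OF int2[OF this]]
    show "(\<integral>\<omega>. ?F (\<mu>1, \<omega>) \<partial>(\<rho>2 \<Otimes>\<^sub>M \<rho>3)) = (\<integral>\<mu>2. (\<integral>\<mu>3. ?F (\<mu>1, \<mu>2, \<mu>3) \<partial>\<rho>3) \<partial>\<rho>2)"
      by (simp add: case_prod_beta')
  qed
  finally show ?thesis by (simp add: pexp_def)
qed

text \<open>The maps act on families indexed by \<open>{..<3}\<close>, while Fubini is applied to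
  nested pairs. The transfer map returns \<open>undefined\<close> outside the index set, as the
  extensional functions that make up \<open>PiM\<close> demand.\<close>

lemma PiM_lessThan_3:
  fixes M :: "nat \<Rightarrow> 'a measure"
  assumes M: "\<And>i. i < 3 \<Longrightarrow> prob_space (M i)"
  defines "t \<equiv> (\<lambda>(x, y, z). \<lambda>i. if i = 0 then x else if i = 1 then y else if i = 2 then z else undefined)"
  shows "PiM {..<3} M = distr (M 0 \<Otimes>\<^sub>M (M 1 \<Otimes>\<^sub>M M 2)) (PiM {..<3} M) t"
    and "t \<in> M 0 \<Otimes>\<^sub>M (M 1 \<Otimes>\<^sub>M M 2) \<rightarrow>\<^sub>M PiM {..<3} M"
proof -
  \<comment> \<open>\<open>product_prob_space\<close> asks for a probability measure at every index,
    so \<open>M\<close> is continued by \<open>M 0\<close>.\<close>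
  let ?N = "\<lambda>i. if i < 3 then M i else M 0"
  have N: "prob_space (?N i)" for i using M by auto
  interpret product_prob_space ?N "{..<3}"
    by (simp add: N product_prob_spaceI)
  interpret m1: prob_space "M 1" using M by simp
  interpret m2: prob_space "M 2" using M by simp
  interpret m12: prob_space "M 1 \<Otimes>\<^sub>M M 2" by (intro prob_space_pair m1.prob_space_axioms m2.prob_space_axioms)
  have PN: "PiM {..<3} M = PiM {..<3} ?N" by (rule PiM_cong) auto
  have lt3: "{..<3::nat} = {0, 1, 2}" by auto
  have i3: "i < 3 \<longleftrightarrow> i = 0 \<or> i = 1 \<or> i = 2" for i :: nat by auto
  show t: "t \<in> M 0 \<Otimes>\<^sub>M (M 1 \<Otimes>\<^sub>M M 2) \<rightarrow>\<^sub>M PiM {..<3} M"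
  proof (rule measurable_PiM_single')
    fix i :: nat assume "i \<in> {..<3}"
    then have i: "i = 0 \<or> i = 1 \<or> i = 2" by (simp add: i3)
    have "(\<lambda>\<omega>. t \<omega> 0) = fst" "(\<lambda>\<omega>. t \<omega> 1) = (\<lambda>\<omega>. fst (snd \<omega>))" "(\<lambda>\<omega>. t \<omega> 2) = (\<lambda>\<omega>. snd (snd \<omega>))"
      by (auto simp: t_def)
    moreover have "fst \<in> M 0 \<Otimes>\<^sub>M (M 1 \<Otimes>\<^sub>M M 2) \<rightarrow>\<^sub>M M 0" by (rule measurable_fst)
    moreover have "(\<lambda>\<omega>. fst (snd \<omega>)) \<in> M 0 \<Otimes>\<^sub>M (M 1 \<Otimes>\<^sub>M M 2) \<rightarrow>\<^sub>M M 1"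
      by (rule measurable_compose[OF measurable_snd measurable_fst])
    moreover have "(\<lambda>\<omega>. snd (snd \<omega>)) \<in> M 0 \<Otimes>\<^sub>M (M 1 \<Otimes>\<^sub>M M 2) \<rightarrow>\<^sub>M M 2"
      by (rule measurable_compose[OF measurable_snd measurable_snd])
    ultimately show "(\<lambda>\<omega>. t \<omega> i) \<in> M 0 \<Otimes>\<^sub>M (M 1 \<Otimes>\<^sub>M M 2) \<rightarrow>\<^sub>M M i"
      using i by (elim disjE) simp_all
  next
    show "t \<in> space (M 0 \<Otimes>\<^sub>M (M 1 \<Otimes>\<^sub>M M 2)) \<rightarrow> (\<Pi>\<^sub>E i\<in>{..<3}. space (M i))"
    proof (rule Pi_I)
      fix \<omega> assume "\<omega> \<in> space (M 0 \<Otimes>\<^sub>M (M 1 \<Otimes>\<^sub>M M 2))"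
      then obtain x y z where "\<omega> = (x, y, z)" "x \<in> space (M 0)" "y \<in> space (M 1)" "z \<in> space (M 2)"
        unfolding space_pair_measure by blast
      then show "t \<omega> \<in> (\<Pi>\<^sub>E i\<in>{..<3}. space (M i))"
        by (intro PiE_I) (auto simp: t_def i3)
    qed
  qed
  have "distr (M 0 \<Otimes>\<^sub>M (M 1 \<Otimes>\<^sub>M M 2)) (PiM {..<3} M) t = PiM {..<3} ?N"
  proof (rule PiM_eqI)
    fix A assume A: "\<And>i. i \<in> {..<3} \<Longrightarrow> A i \<in> sets (?N i)"
    then have A': "A 0 \<in> sets (M 0)" "A 1 \<in> sets (M 1)" "A 2 \<in> sets (M 2)" 
      using A[of 0] A[of 1] A[of 2] by auto
    have "t -` Pi\<^sub>E {..<3} A \<inter> space (M 0 \<Otimes>\<^sub>M (M 1 \<Otimes>\<^sub>M M 2)) = A 0 \<times> (A 1 \<times> A 2)"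
      using A'[THEN sets.sets_into_space]
    proof -
      have "t (x, y, z) \<in> Pi\<^sub>E {..<3} A \<longleftrightarrow> x \<in> A 0 \<and> y \<in> A 1 \<and> z \<in> A 2" for x y z
        unfolding PiE_iff extensional_def lt3 by (auto simp: t_def)
      then show ?thesis
        using A'[THEN sets.sets_into_space] unfolding space_pair_measure vimage_def Int_def by fast
    qed
    moreover have "Pi\<^sub>E {..<3} A \<in> sets (PiM {..<3} M)"
      unfolding PN using A by (intro sets_PiM_I_finite) auto
    ultimately have "emeasure (distr (M 0 \<Otimes>\<^sub>M (M 1 \<Otimes>\<^sub>M M 2)) (PiM {..<3} M) t) (Pi\<^sub>E {..<3} A)
       = emeasure (M 0 \<Otimes>\<^sub>M (M 1 \<Otimes>\<^sub>M M 2)) (A 0 \<times> (A 1 \<times> A 2))"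
      by (simp only: emeasure_distr[OF t])
    also have "\<dots> = emeasure (M 0) (A 0) * emeasure (M 1 \<Otimes>\<^sub>M M 2) (A 1 \<times> A 2)"
      by (rule m12.emeasure_pair_measure_Times[OF A'(1) pair_measureI[OF A'(2,3)]])
    also have "emeasure (M 1 \<Otimes>\<^sub>M M 2) (A 1 \<times> A 2) = emeasure (M 1) (A 1) * emeasure (M 2) (A 2)"
      by (rule m2.emeasure_pair_measure_Times[OF A'(2,3)])
    finally have "emeasure (distr (M 0 \<Otimes>\<^sub>M (M 1 \<Otimes>\<^sub>M M 2)) (PiM {..<3} M) t) (Pi\<^sub>E {..<3} A)
       = emeasure (M 0) (A 0) * (emeasure (M 1) (A 1) * emeasure (M 2) (A 2))" .
    moreover have "{..<3::nat} = {0, 1, 2}" by auto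
    ultimately show "emeasure (distr (M 0 \<Otimes>\<^sub>M (M 1 \<Otimes>\<^sub>M M 2)) (PiM {..<3} M) t) (Pi\<^sub>E {..<3} A)
       = (\<Prod>i\<in>{..<3}. emeasure (?N i) (A i))"
      by simp
  qed (auto simp: PN)
  then show "PiM {..<3} M = distr (M 0 \<Otimes>\<^sub>M (M 1 \<Otimes>\<^sub>M M 2)) (PiM {..<3} M) t" by (simp add: PN)
qed

text \<open>Splitting on the value of the first coordinate gives two disjoint boxes, with masses x
  and (1 - x) y z.\<close>

lemma check_map_cob:
  assumes \<mu>: "\<And>i. i < 3 \<Longrightarrow> \<mu> i \<in> space P_spin"
  shows "check_map spin 3 cob \<mu> = bern (cob_poly (p1 (\<mu> 0)) (p1 (\<mu> 1)) (p1 (\<mu> 2)))"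
proof -
  let ?t = "(\<lambda>(x, y, z). \<lambda>i. if i = (0::nat) then x else if i = 1 then y else if i = 2 then z else undefined)"
  let ?P = "\<mu> 0 \<Otimes>\<^sub>M (\<mu> 1 \<Otimes>\<^sub>M \<mu> 2)"
  have pr: "\<And>i. i < 3 \<Longrightarrow> prob_space (\<mu> i)" and st: "\<And>i. i < 3 \<Longrightarrow> sets (\<mu> i) = UNIV"
    using \<mu> by (auto simp: in_P_spin)
  have sp: "space (\<mu> i) = UNIV" if "i < 3" for i
    using st[OF that] sets_eq_imp_space_eq[of "\<mu> i" spin] by simp
  note [measurable_cong] = st[of 0] st[of 1] st[of 2]
  interpret m0: prob_space "\<mu> 0" using pr by simp
  interpret m1: prob_space "\<mu> 1" using pr by simp
  interpret m2: prob_space "\<mu> 2" using pr by simp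
  interpret m12: prob_space "\<mu> 1 \<Otimes>\<^sub>M \<mu> 2" by (intro prob_space_pair m1.prob_space_axioms m2.prob_space_axioms)
  interpret P: prob_space ?P by (intro prob_space_pair m0.prob_space_axioms m12.prob_space_axioms)
  have sPiM: "sets (PiM {..<3} \<mu>) = sets (PiM {..<3} (\<lambda>_. spin))"
    by (rule sets_PiM_cong) (auto simp: st)
  have "cob \<in> PiM {..<3} (\<lambda>_. spin) \<rightarrow>\<^sub>M spin" unfolding cob_def by measurable
  then have cobm: "cob \<in> PiM {..<3} \<mu> \<rightarrow>\<^sub>M spin" using sPiM measurable_cong_sets by blast
  have *: "check_map spin 3 cob \<mu> = distr ?P spin (cob \<circ> ?t)"
    unfolding check_map_def
    by (subst PiM_lessThan_3(1)[OF pr], simp) (rule distr_distr[OF cobm PiM_lessThan_3(2)[OF pr]])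
  have m: "cob \<circ> ?t \<in> ?P \<rightarrow>\<^sub>M spin"
    using measurable_comp[OF PiM_lessThan_3(2)[OF pr] cobm] by simp
  have "check_map spin 3 cob \<mu> \<in> space P_spin"
    unfolding * in_P_spin using P.prob_space_distr[OF m] by simp
  moreover have "p1 (check_map spin 3 cob \<mu>) = cob_poly (p1 (\<mu> 0)) (p1 (\<mu> 1)) (p1 (\<mu> 2))"
  proof -
    have F: "measure (\<mu> 0) {False} = 1 - p1 (\<mu> 0)"
    proof -
      have "UNIV - {True} = {False}" by auto
      then show ?thesis using m0.prob_compl[of "{True}"] st[of 0] sp[of 0] by simp
    qed
    have S: "A \<times> (B \<times> C) \<in> sets ?P" for A B C
      by (intro pair_measureI) (simp_all add: st)
    have times: "P.prob (A \<times> (B \<times> C)) = m0.prob A * (m1.prob B * m2.prob C)" for A B C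
    proof -
      have "B \<times> C \<in> sets (\<mu> 1 \<Otimes>\<^sub>M \<mu> 2)" by (intro pair_measureI) (simp_all add: st)
      then have "emeasure ?P (A \<times> (B \<times> C)) = emeasure (\<mu> 0) A * (emeasure (\<mu> 1) B * emeasure (\<mu> 2) C)"
        by (subst m12.emeasure_pair_measure_Times; (subst m2.emeasure_pair_measure_Times)?; simp add: st)
      then show ?thesis
        by (simp add: measure_def enn2real_mult)
    qed
    have one: "m1.prob UNIV = 1" "m2.prob UNIV = 1" using m1.prob_space m2.prob_space sp[of 1] sp[of 2] by auto
    have "space (\<mu> 0) = UNIV" "space (\<mu> 1) = UNIV" "space (\<mu> 2) = UNIV" by (rule sp, simp)+
    then have spP: "space ?P = UNIV" by (simp only: space_pair_measure UNIV_Times_UNIV)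
    have V: "(cob \<circ> ?t) -` {True} \<inter> space ?P = {True} \<times> (UNIV \<times> UNIV) \<union> {False} \<times> ({True} \<times> {True})"
    proof (rule set_eqI)
      fix x :: "bool \<times> bool \<times> bool"
      obtain a b c where x: "x = (a, b, c)" by (cases x)
      have "cob (?t x) \<longleftrightarrow> a \<or> (b \<and> c)" by (simp add: x cob_def)
      then show "x \<in> (cob \<circ> ?t) -` {True} \<inter> space ?P \<longleftrightarrow> x \<in> {True} \<times> (UNIV \<times> UNIV) \<union> {False} \<times> ({True} \<times> {True})"
        unfolding spP vimage_def o_def Int_UNIV_right mem_Collect_eq by (simp only: x) (cases a; simp)
    qed
    have "p1 (check_map spin 3 cob \<mu>) = P.prob ((cob \<circ> ?t) -` {True} \<inter> space ?P)"
      unfolding * by (rule measure_distr[OF m]) simp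
    also have "\<dots> = P.prob ({True} \<times> (UNIV \<times> UNIV) \<union> {False} \<times> ({True} \<times> {True}))"
      by (simp only: V)
    also have "\<dots> = P.prob ({True} \<times> (UNIV \<times> UNIV)) + P.prob ({False} \<times> ({True} \<times> {True}))"
      by (rule P.finite_measure_Union[OF S S]) auto
    also have "P.prob ({True} \<times> (UNIV \<times> UNIV)) = p1 (\<mu> 0)"
      using one by (simp only: times mult_1_right)
    also have "P.prob ({False} \<times> ({True} \<times> {True})) = (1 - p1 (\<mu> 0)) * p1 (\<mu> 1) * p1 (\<mu> 2)"
      by (simp only: times F mult.assoc)
    finally show ?thesis .
  qed
  ultimately show ?thesis
    using p1_bern_eq[OF cob_poly_bounds[OF p1_bounds p1_bounds p1_bounds]] \<mu>
    by (intro P_spin_eqI) auto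
qed

section \<open>Scalar differential inequalities\<close>

text \<open>The derivative is a function of time, not a vector field in \<open>x\<close>, so one
  predicate serves coupled quantities and expectations of arbitrary test functions. At
  \<open>t0\<close> it is one-sided.\<close>

definition ode_on :: "real \<Rightarrow> (real \<Rightarrow> real) \<Rightarrow> (real \<Rightarrow> real) \<Rightarrow> bool" where
  "ode_on t0 x D \<longleftrightarrow> (\<forall>t\<ge>t0. (x has_real_derivative D t) (at t within {t0..}))"

lemma ode_on_mono: "ode_on t0 x D \<Longrightarrow> t0 \<le> t1 \<Longrightarrow> ode_on t1 x D"
  unfolding ode_on_def by (meson DERIV_subset atLeast_subset_iff order_trans)

lemma ode_on_cong: "ode_on t0 x D \<Longrightarrow> (\<And>t. t \<ge> t0 \<Longrightarrow> D t = E t) \<Longrightarrow> ode_on t0 x E"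
  unfolding ode_on_def by auto

lemma ode_on_uminus: "ode_on t0 x D \<Longrightarrow> ode_on t0 (\<lambda>t. - x t) (\<lambda>t. - D t)"
  unfolding ode_on_def by (auto intro!: derivative_eq_intros)

lemma ode_on_diff: "ode_on t0 x D \<Longrightarrow> ode_on t0 y E \<Longrightarrow> ode_on t0 (\<lambda>t. x t - y t) (\<lambda>t. D t - E t)"
  unfolding ode_on_def by (auto intro!: derivative_eq_intros)

lemma ode_on_continuous: "ode_on t0 x D \<Longrightarrow> continuous_on {t0..} x"
  unfolding ode_on_def by (auto simp: continuous_on_eq_continuous_within intro: DERIV_continuous)

lemma ode_on_mvt:
  assumes x: "ode_on t0 x D" and st: "t0 \<le> s" "s < t"
  shows "\<exists>r. s < r \<and> r < t \<and> x t - x s = (t - s) * D r"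
proof -
  have c: "continuous_on {s..t} x"
    using ode_on_continuous[OF x] st by (auto intro: continuous_on_subset)
  have d: "(x has_real_derivative D r) (at r)" if "s < r" for r
  proof -
    have "r \<in> interior {t0..}" using that st by simp
    then show ?thesis using x that st at_within_interior[of r "{t0..}"] unfolding ode_on_def by (metis order_less_imp_le order_trans)
  qed
  show ?thesis using MVT[OF st(2) c] d
    by (metis DERIV_unique real_differentiable_def)
qed

lemma ode_on_le_linear:
  assumes x: "ode_on t0 x D" and st: "t0 \<le> s" "s \<le> t" and D: "\<And>r. s < r \<Longrightarrow> r < t \<Longrightarrow> D r \<le> K"
  shows "x t \<le> x s + K * (t - s)"
proof (cases "s = t")
  case False
  then obtain r where "s < r" "r < t" "x t - x s = (t - s) * D r"
    using ode_on_mvt[OF x, of s t] st by auto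
  moreover have "(t - s) * D r \<le> (t - s) * K"
    using D[of r] calculation st by (intro mult_left_mono) auto
  ultimately show ?thesis by (simp add: algebra_simps)
qed auto

text \<open>\<open>s\<close> is the supremum of the times at which \<open>x\<close> is at most
  \<open>b\<close>. This set is closed, and the intermediate value theorem excludes
  \<open>x s < b\<close>.\<close>

lemma last_crossing:
  assumes c: "continuous_on {t1..t2} (x :: real \<Rightarrow> real)" and "t1 \<le> t2" "x t1 \<le> b" "x t2 > b"
  obtains s where "t1 \<le> s" "s < t2" "x s = b" "\<And>r. s < r \<Longrightarrow> r \<le> t2 \<Longrightarrow> x r > b"
proof -
  let ?S = "{t \<in> {t1..t2}. x t \<le> b}"
  have cl: "closed ?S"
    using continuous_closed_preimage[OF c closed_real_atLeastAtMost closed_atMost[of b]]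
    by (simp add: vimage_def Int_def)
  have ne: "?S \<noteq> {}" and bd: "bdd_above ?S" using assms by auto
  define s where "s = Sup ?S"
  have sS: "s \<in> ?S" unfolding s_def by (rule closed_contains_Sup[OF ne bd cl])
  have after: "x r > b" if "s < r" "r \<le> t2" for r
    using that sS cSup_upper[OF _ bd, of r] unfolding s_def[symmetric] by force
  have "s < t2" using sS assms by (cases "s = t2") auto
  have "x s = b"
  proof (rule ccontr)
    assume "x s \<noteq> b"
    then have "x s < b" using sS by auto
    obtain r where r: "s \<le> r" "r \<le> t2" "x r = b"
      using IVT'[of x s b t2] \<open>x s < b\<close> assms \<open>s < t2\<close> sS continuous_on_subset[OF c, of "{s..t2}"] by auto
    then show False using after[of r] \<open>x s < b\<close> by (cases "r = s") auto
  qed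
  then show ?thesis using that sS \<open>s < t2\<close> after by auto
qed

text \<open>Just after the last crossing of \<open>b\<close> the solution is still in the strip of
  width \<epsilon>, where it cannot increase. Asking for the sign of the drift in a strip only is
  what makes the barrier usable when another equilibrium lies above.\<close>

lemma barrier_above:
  assumes x: "ode_on t0 x D" and b: "x t0 \<le> b" and \<epsilon>: "\<epsilon> > 0"
    and D: "\<And>t. t \<ge> t0 \<Longrightarrow> b < x t \<Longrightarrow> x t < b + \<epsilon> \<Longrightarrow> D t \<le> 0"
    and t: "t \<ge> t0"
  shows "x t \<le> b"
proof (rule ccontr)
  assume "\<not> x t \<le> b"
  then have xt: "x t > b" by simp
  have c: "continuous_on {t0..t} x" using ode_on_continuous[OF x] by (rule continuous_on_subset) auto
  obtain s where s: "t0 \<le> s" "s < t" "x s = b" "\<And>r. s < r \<Longrightarrow> r \<le> t \<Longrightarrow> x r > b"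
    using last_crossing[OF c t b xt] by blast
  have "\<exists>d>0. \<forall>r\<in>{t0..t}. dist r s < d \<longrightarrow> dist (x r) (x s) < \<epsilon>"
    using c s \<epsilon> unfolding continuous_on_iff by (metis atLeastAtMost_iff less_eq_real_def)
  then obtain d where d: "d > 0" "\<And>r. r \<in> {t0..t} \<Longrightarrow> dist r s < d \<Longrightarrow> dist (x r) (x s) < \<epsilon>" by blast
  define r where "r = min t (s + d / 2)"
  have r: "s < r" "r \<le> t" using s d by (auto simp: r_def)
  have near: "x q < b + \<epsilon>" if "s < q" "q < r" for q
    using d(2)[of q] that s r by (auto simp: dist_real_def r_def)
  have "x r \<le> x s + 0 * (r - s)"
    using s r near by (intro ode_on_le_linear[OF x] D) auto
  then show False using s(3) s(4)[OF r] by simp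
qed

lemma barrier_below:
  assumes x: "ode_on t0 x D" and b: "x t0 \<ge> b" and \<epsilon>: "\<epsilon> > 0"
    and D: "\<And>t. t \<ge> t0 \<Longrightarrow> x t < b \<Longrightarrow> x t > b - \<epsilon> \<Longrightarrow> D t \<ge> 0"
    and t: "t \<ge> t0"
  shows "x t \<ge> b"
  using barrier_above[OF ode_on_uminus[OF x], of "- b" \<epsilon> t] assms by auto

text \<open>As long as \<open>x\<close> exceeds \<open>b\<close> it falls at speed at least
  \<kappa>, which the lower bound \<open>B\<close> cannot permit forever. Once \<open>x\<close> has
  reached \<open>b\<close>, the barrier keeps it there.\<close>

lemma eventually_le_of_drift:
  assumes x: "ode_on t0 x D" and lb: "\<And>t. t \<ge> t0 \<Longrightarrow> x t \<ge> B" and \<kappa>: "\<kappa> > 0"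
    and D: "\<And>t. t \<ge> t0 \<Longrightarrow> x t \<ge> b \<Longrightarrow> D t \<le> - \<kappa>"
  shows "\<exists>t1\<ge>t0. \<forall>t\<ge>t1. x t \<le> b"
proof -
  have "\<exists>t1\<ge>t0. x t1 \<le> b"
  proof (rule ccontr)
    assume "\<not> ?thesis"
    then have gt: "\<And>t. t \<ge> t0 \<Longrightarrow> x t > b" by force
    \<comment> \<open>Falling at speed \<kappa> until this time would bring \<open>x\<close> below
      \<open>B\<close> by at least 1.\<close>
    define T where "T = t0 + (\<bar>x t0 - B\<bar> + 1) / \<kappa>"
    have T: "T \<ge> t0" using \<kappa> by (auto simp: T_def)
    have "x T \<le> x t0 + (- \<kappa>) * (T - t0)"
      using gt T by (intro ode_on_le_linear[OF x] D) (auto simp: less_imp_le)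
    also have "\<dots> = x t0 - (\<bar>x t0 - B\<bar> + 1)" using \<kappa> by (simp add: T_def)
    finally show False using lb[OF T] by linarith
  qed
  then obtain t1 where t1: "t1 \<ge> t0" "x t1 \<le> b" by auto
  have "x t \<le> b" if "t \<ge> t1" for t
  proof (rule barrier_above[OF ode_on_mono[OF x t1(1)] t1(2) zero_less_one _ that])
    fix s assume "s \<ge> t1" "b < x s"
    then have "D s \<le> - \<kappa>" using t1 by (intro D) auto
    then show "D s \<le> 0" using \<kappa> by linarith
  qed
  then show ?thesis using t1 by auto
qed

lemma eventually_ge_of_drift:
  assumes x: "ode_on t0 x D" and lb: "\<And>t. t \<ge> t0 \<Longrightarrow> x t \<le> B" and \<kappa>: "\<kappa> > 0"
    and D: "\<And>t. t \<ge> t0 \<Longrightarrow> x t \<le> b \<Longrightarrow> D t \<ge> \<kappa>"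
  shows "\<exists>t1\<ge>t0. \<forall>t\<ge>t1. x t \<ge> b"
  using eventually_le_of_drift[OF ode_on_uminus[OF x], of "- B" \<kappa> "- b"] assms by force

text \<open>While \<open>x\<close> is at least \<open>b\<close> and \<epsilon> is below
  \<open>a * b / 2\<close>, the drift is at most \<open>- (a * b\<^sup>2 / 2)\<close>, so
  \<open>x\<close> eventually stays below every level \<open>b\<close>. The perturbation \<epsilon>
  accommodates coefficients that are nonpositive only in the limit.\<close>

lemma tendsto_zero_of_riccati:
  assumes x: "ode_on t0 x D" and nn: "\<And>t. t \<ge> t0 \<Longrightarrow> x t \<ge> 0" and a: "a > 0"
    and D: "\<And>t. t \<ge> t0 \<Longrightarrow> D t \<le> x t * (\<epsilon> t - a * x t)"
    and \<epsilon>: "\<And>e. e > 0 \<Longrightarrow> eventually (\<lambda>t. \<epsilon> t < e) at_top"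
  shows "(x \<longlongrightarrow> 0) at_top"
proof (rule tendstoI)
  fix d :: real assume d: "d > 0"
  define b where "b = d / 2"
  have b: "b > 0" using d by (simp add: b_def)
  obtain t1 where t1: "\<And>t. t \<ge> t1 \<Longrightarrow> \<epsilon> t < a * b / 2"
    using \<epsilon>[of "a * b / 2"] a b unfolding eventually_at_top_linorder by auto
  let ?t = "max t0 t1"
  have "\<exists>t2\<ge>?t. \<forall>t\<ge>t2. x t \<le> b"
  proof (rule eventually_le_of_drift[OF ode_on_mono[OF x]])
    show "\<And>t. t \<ge> ?t \<Longrightarrow> x t \<ge> 0" using nn by auto
    show "0 < b * (a * b / 2)" using a b by simp
    fix t assume t: "t \<ge> ?t" "x t \<ge> b"
    have "a * b \<le> a * x t" using t a by simp
    then have "\<epsilon> t - a * x t \<le> - (a * b / 2)" using t1[of t] t by auto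
    then have "x t * (\<epsilon> t - a * x t) \<le> x t * - (a * b / 2)" using nn[of t] t by (intro mult_left_mono) auto
    also have "\<dots> \<le> b * - (a * b / 2)" using t a b by (intro mult_right_mono_neg) auto
    finally show "D t \<le> - (b * (a * b / 2))" using D[of t] t by auto
  qed auto
  then obtain t2 where t2: "t2 \<ge> ?t" "\<And>t. t \<ge> t2 \<Longrightarrow> x t \<le> b" by blast
  have "dist (x t) 0 < d" if "t \<ge> t2" for t
    using t2(2)[OF that] nn[of t] that t2(1) d by (simp add: b_def dist_real_def)
  then show "eventually (\<lambda>t. dist (x t) 0 < d) at_top"
    unfolding eventually_at_top_linorder by blast
qed

text \<open>Gronwall: \<open>x\<^sup>2 * exp (- 2 * K * t)\<close> is nonincreasing. Squaring avoids
  differentiating the absolute value. The lemma serves as uniqueness at an equilibrium.\<close>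

lemma ode_on_zero:
  assumes x: "ode_on t0 x D" and x0: "x t0 = 0"
    and D: "\<And>t. t \<ge> t0 \<Longrightarrow> \<bar>D t\<bar> \<le> K * \<bar>x t\<bar>" and t: "t \<ge> t0"
  shows "x t = 0"
proof -
  let ?y = "\<lambda>t. x t * x t * exp (- (2 * K * t))"
  let ?E = "\<lambda>t. (2 * x t * D t - 2 * K * (x t * x t)) * exp (- (2 * K * t))"
  have y: "ode_on t0 ?y ?E"
    unfolding ode_on_def
  proof safe
    fix t assume "t0 \<le> t"
    then have [derivative_intros]: "(x has_real_derivative D t) (at t within {t0..})" using x by (auto simp: ode_on_def)
    show "(?y has_real_derivative ?E t) (at t within {t0..})"
      by (auto intro!: derivative_eq_intros simp: algebra_simps)
  qed
  have "?y t \<le> ?y t0 + 0 * (t - t0)"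
  proof (rule ode_on_le_linear[OF y _ t])
    fix r assume "t0 < r"
    then have "\<bar>x r\<bar> * \<bar>D r\<bar> \<le> \<bar>x r\<bar> * (K * \<bar>x r\<bar>)" using D[of r] by (intro mult_left_mono) auto
    moreover have "x r * D r \<le> \<bar>x r\<bar> * \<bar>D r\<bar>" by (metis abs_ge_self abs_mult)
    ultimately have "2 * x r * D r - 2 * K * (x r * x r) \<le> 0" by (simp add: mult.left_commute)
    then show "?E r \<le> 0" by (intro mult_nonpos_nonneg) auto
  qed simp
  then have "x t * x t * exp (- (2 * K * t)) \<le> 0" using x0 by simp
  then have "x t * x t \<le> 0" by (simp add: mult_le_0_iff)
  then show ?thesis by (simp add: mult_le_0_iff) (metis antisym)
qed

text \<open>A solution that becomes negative must pass through zero, where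
  \<open>ode_on_zero\<close> freezes it.\<close>

lemma ode_on_nonneg:
  assumes x: "ode_on t0 x D" and x0: "x t0 \<ge> 0"
    and D: "\<And>t. t \<ge> t0 \<Longrightarrow> \<bar>D t\<bar> \<le> K * \<bar>x t\<bar>" and t: "t \<ge> t0"
  shows "x t \<ge> 0"
proof (rule ccontr)
  assume neg: "\<not> x t \<ge> 0"
  have "continuous_on {t0..t} x" using ode_on_continuous[OF x] by (rule continuous_on_subset) auto
  then obtain s where s: "t0 \<le> s" "s \<le> t" "x s = 0"
    using IVT2'[of x t 0 t0] x0 neg t by auto
  have "x t = 0"
    by (rule ode_on_zero[OF ode_on_mono[OF x s(1)] s(3) D s(2)]) (use s in auto)
  then show False using neg by simp
qed

text \<open>The integrating factor \<open>exp (c * t)\<close> makes the distance of \<open>x\<close>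
  from \<open>b\<close> nonincreasing in the signed sense.\<close>

lemma ode_on_linear_bound:
  assumes x: "ode_on t0 x D" and c: "c > 0"
    and D: "\<And>t. t \<ge> t0 \<Longrightarrow> D t \<le> c * (b - x t)" and t: "t \<ge> t0"
  shows "x t \<le> b + exp (- c * (t - t0)) * (x t0 - b)"
proof -
  let ?y = "\<lambda>t. exp (c * t) * (x t - b)"
  let ?E = "\<lambda>t. exp (c * t) * (D t - c * (b - x t))"
  have y: "ode_on t0 ?y ?E"
    unfolding ode_on_def
  proof safe
    fix t assume "t0 \<le> t"
    then have [derivative_intros]: "(x has_real_derivative D t) (at t within {t0..})" using x by (auto simp: ode_on_def)
    show "(?y has_real_derivative ?E t) (at t within {t0..})"
      by (auto intro!: derivative_eq_intros simp: algebra_simps)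
  qed
  have "?y t \<le> ?y t0 + 0 * (t - t0)"
    by (rule ode_on_le_linear[OF y _ t]) (use D in \<open>auto intro!: mult_nonneg_nonpos\<close>)
  then have "exp (- (c * t)) * ?y t \<le> exp (- (c * t)) * ?y t0" by (intro mult_left_mono) auto
  then have "x t - b \<le> exp (- (c * t)) * exp (c * t0) * (x t0 - b)"
    by (simp add: mult.assoc[symmetric] exp_minus)
  also have "exp (- (c * t)) * exp (c * t0) = exp (- c * (t - t0))"
    by (simp add: exp_add[symmetric] algebra_simps)
  finally show ?thesis by simp
qed

text \<open>By the mean value theorem the increments over unit time intervals would tend to
  \<open>d\<close>, whereas convergence of \<open>x\<close> makes them tend to 0.\<close>

lemma ode_on_limit_derivative:
  assumes x: "ode_on t0 x D" and "(x \<longlongrightarrow> l) at_top" "(D \<longlongrightarrow> d) at_top"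
  shows "d = 0"
proof (rule ccontr)
  assume "d \<noteq> 0"
  then have e: "\<bar>d\<bar> / 3 > 0" by simp
  obtain T1 where T1: "\<And>t. t \<ge> T1 \<Longrightarrow> \<bar>x t - l\<bar> < \<bar>d\<bar> / 3"
    using tendstoD[OF assms(2) e] by (auto simp: eventually_at_top_linorder dist_real_def)
  obtain T2 where T2: "\<And>t. t \<ge> T2 \<Longrightarrow> \<bar>D t - d\<bar> < \<bar>d\<bar> / 3"
    using tendstoD[OF assms(3) e] by (auto simp: eventually_at_top_linorder dist_real_def)
  define t where "t = max t0 (max T1 T2)"
  obtain r where r: "t < r" "x (t + 1) - x t = (t + 1 - t) * D r"
    using ode_on_mvt[OF x, of t "t + 1"] by (auto simp: t_def)
  have "\<bar>D r - d\<bar> < \<bar>d\<bar> / 3" using r by (intro T2) (auto simp: t_def)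
  moreover have "\<bar>x (t + 1) - l\<bar> < \<bar>d\<bar> / 3" "\<bar>x t - l\<bar> < \<bar>d\<bar> / 3"
    using T1[of t] T1[of "t + 1"] by (auto simp: t_def)
  moreover have "x (t + 1) - x t = D r" using r(2) by simp
  ultimately show False by linarith
qed

section \<open>Coefficients of the Wild sum\<close>

text \<open>The central binomial coefficient divided by 4^n. In the rising factorial form,
  Vandermonde's identity evaluates its convolutions.\<close>

definition wcoeff :: "nat \<Rightarrow> real" where
  "wcoeff n = pochhammer (1/2 :: real) n / fact n"

lemma wcoeff_0 [simp]: "wcoeff 0 = 1"
  by (simp add: wcoeff_def)

lemma wcoeff_pos: "wcoeff n > 0"
  by (simp add: wcoeff_def pochhammer_pos)

text \<open>Vandermonde's identity, the coefficient form of multiplying (1 - s)^(-a) by (1 -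
  s)^(-b).\<close>

lemma pochhammer_convolution:
  fixes a b :: real
  shows "(\<Sum>k\<le>n. (pochhammer a k / fact k) * (pochhammer b (n - k) / fact (n - k))) = pochhammer (a + b) n / fact n"
  unfolding pochhammer_binomial_sum sum_divide_distrib
  by (rule sum.cong) (auto simp: binomial_fact)

lemma wcoeff_convolution: "(\<Sum>k\<le>n. wcoeff k * wcoeff (n - k)) = 1"
  using pochhammer_convolution[of "1/2" "1/2" n] by (simp add: wcoeff_def pochhammer_fact[symmetric])

text \<open>Partial sums are a convolution with the constant sequence 1, hence the coefficients of
  (1 - s)^(-3/2). This function is both the cube of (1 - s)^(-1/2) and twice its derivative, which
  is why three subtrees match one differentiation.\<close>

lemma sum_wcoeff: "(\<Sum>k\<le>n. wcoeff k) = 2 * (real n + 1) * wcoeff (Suc n)"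
proof -
  have "(\<Sum>k\<le>n. wcoeff k) = pochhammer (3/2) n / fact n"
    using pochhammer_convolution[of "1/2" 1 n] by (simp add: wcoeff_def pochhammer_fact[symmetric])
  also have "\<dots> = 2 * (real n + 1) * wcoeff (Suc n)"
  proof -
    have "real n + 1 \<noteq> 0" by linarith
    then show ?thesis by (simp add: wcoeff_def pochhammer_rec divide_simps)
  qed
  finally show ?thesis .
qed

lemma wcoeff_le_1: "wcoeff n \<le> 1"
proof -
  have "wcoeff 0 * wcoeff (n - 0) \<le> (\<Sum>k\<le>n. wcoeff k * wcoeff (n - k))"
    by (rule member_le_sum) (auto intro!: mult_nonneg_nonneg less_imp_le[OF wcoeff_pos])
  then show ?thesis by (simp add: wcoeff_convolution)
qed

text \<open>By \<open>wcoeff_convolution\<close> the Cauchy square of the series is the geometric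
  series, and the sum is the nonnegative root.\<close>

lemma wcoeff_sums:
  assumes s: "0 \<le> s" "s < 1"
  shows "(\<lambda>n. wcoeff n * s ^ n) sums (1 / sqrt (1 - s))"
proof -
  have sm: "summable (\<lambda>n. wcoeff n * s ^ n)"
    by (rule summable_comparison_test'[OF summable_geometric[of s]])
       (use s wcoeff_le_1 wcoeff_pos[THEN less_imp_le] in \<open>auto intro!: mult_left_le_one_le\<close>)
  have nn: "\<And>n. wcoeff n * s ^ n \<ge> 0" using s wcoeff_pos[THEN less_imp_le] by auto
  have "(\<lambda>n. \<Sum>k\<le>n. (wcoeff k * s ^ k) * (wcoeff (n - k) * s ^ (n - k))) sums
      ((\<Sum>n. wcoeff n * s ^ n) * (\<Sum>n. wcoeff n * s ^ n))"
    using sm nn by (intro Cauchy_product_sums) auto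
  also have "(\<lambda>n. \<Sum>k\<le>n. (wcoeff k * s ^ k) * (wcoeff (n - k) * s ^ (n - k))) = (\<lambda>n. s ^ n)"
  proof
    fix n
    have "(\<Sum>k\<le>n. (wcoeff k * s ^ k) * (wcoeff (n - k) * s ^ (n - k))) = (\<Sum>k\<le>n. (wcoeff k * wcoeff (n - k)) * s ^ n)"
      by (intro sum.cong) (auto simp: power_add[symmetric] mult_ac)
    then show "(\<Sum>k\<le>n. (wcoeff k * s ^ k) * (wcoeff (n - k) * s ^ (n - k))) = s ^ n"
      by (simp add: sum_distrib_right[symmetric] wcoeff_convolution)
  qed
  finally have "(\<Sum>n. wcoeff n * s ^ n) * (\<Sum>n. wcoeff n * s ^ n) = 1 / (1 - s)"
    using geometric_sums[of s] s by (intro sums_unique2) auto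
  then have "(\<Sum>n. wcoeff n * s ^ n) ^ 2 = (1 / sqrt (1 - s)) ^ 2"
    using s by (simp add: power2_eq_square real_sqrt_mult_self)
  moreover have "(\<Sum>n. wcoeff n * s ^ n) \<ge> 0" by (intro suminf_nonneg sm nn)
  ultimately have "(\<Sum>n. wcoeff n * s ^ n) = 1 / sqrt (1 - s)"
    using s power2_eq_imp_eq[of "\<Sum>n. wcoeff n * s ^ n"] by auto
  then show ?thesis using sm by (metis summable_sums)
qed

text \<open>For \<open>u = exp (- (\<alpha> + 1) * t)\<close> this is the law at time \<open>t\<close> of the number of branching points of
  a tree in which every leaf splits into three at rate \<open>\<alpha> + 1\<close>. It is normalised because \<open>wcoeff\<close> has
  the generating function \<open>1 / sqrt (1 - s)\<close>. Conditionally on \<open>n + 1\<close> branching points, \<open>split_pmf n\<close> is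
  the joint law of their numbers in the three subtrees at the root.\<close>

definition wild_pmf :: "real \<Rightarrow> nat pmf" where
  "wild_pmf u = embed_pmf (\<lambda>n. u * (wcoeff n * (1 - u\<^sup>2) ^ n))"

lemma pmf_wild:
  assumes u: "0 < u" "u \<le> 1"
  shows "pmf (wild_pmf u) n = u * (wcoeff n * (1 - u\<^sup>2) ^ n)"
  unfolding wild_pmf_def
proof (rule pmf_embed_pmf)
  have s: "0 \<le> 1 - u\<^sup>2" "1 - u\<^sup>2 < 1" using u by (auto simp: power_le_one)
  show nn: "0 \<le> u * (wcoeff n * (1 - u\<^sup>2) ^ n)" for n using u s wcoeff_pos[of n] by simp
  have "(\<lambda>n. u * (wcoeff n * (1 - u\<^sup>2) ^ n)) sums (u * (1 / sqrt (1 - (1 - u\<^sup>2))))"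
    by (intro sums_mult wcoeff_sums s)
  then have *: "(\<lambda>n. u * (wcoeff n * (1 - u\<^sup>2) ^ n)) sums 1" using u by simp
  show "(\<integral>\<^sup>+n. ennreal (u * (wcoeff n * (1 - u\<^sup>2) ^ n)) \<partial>count_space UNIV) = 1"
    using nn * by (simp only: nn_integral_count_space_nat suminf_ennreal_eq ennreal_1)
qed

definition triples :: "nat \<Rightarrow> (nat \<times> nat \<times> nat) set" where
  "triples n = {(i, j, k). i + j + k = n}"

lemma triples_eq: "triples n = (\<lambda>(i, j). (i, j, n - i - j)) ` (SIGMA i:{..n}. {..n - i})"
  by (force simp: triples_def)

lemma finite_triples [simp]: "finite (triples n)"
  unfolding triples_eq by auto

definition split_pmf :: "nat \<Rightarrow> (nat \<times> nat \<times> nat) pmf" where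
  "split_pmf n = embed_pmf (\<lambda>(i, j, k). if (i, j, k) \<in> triples n
      then wcoeff i * wcoeff j * wcoeff k / (2 * (real n + 1) * wcoeff (Suc n)) else 0)"

text \<open>With the first size fixed, the convolution over the other two is 1, and a partial sum of
  \<open>wcoeff\<close> remains.\<close>

lemma sum_triples: "(\<Sum>(i, j, k)\<in>triples n. wcoeff i * wcoeff j * wcoeff k) = 2 * (real n + 1) * wcoeff (Suc n)"
proof -
  have "(\<Sum>(i, j, k)\<in>triples n. wcoeff i * wcoeff j * wcoeff k)
      = (\<Sum>(i, j)\<in>(SIGMA i:{..n}. {..n - i}). wcoeff i * wcoeff j * wcoeff (n - i - j))"
    unfolding triples_eq by (subst sum.reindex) (auto simp: inj_on_def case_prod_beta)
  also have "\<dots> = (\<Sum>i\<le>n. \<Sum>j\<le>n - i. wcoeff i * wcoeff j * wcoeff (n - i - j))"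
    by (subst sum.Sigma) auto
  also have "\<dots> = (\<Sum>i\<le>n. wcoeff i * (\<Sum>j\<le>n - i. wcoeff j * wcoeff (n - i - j)))"
    by (simp add: sum_distrib_left mult.assoc)
  finally show ?thesis by (simp only: wcoeff_convolution sum_wcoeff mult_1_right)
qed

lemma pmf_split:
  "pmf (split_pmf n) (i, j, k) = (if i + j + k = n
      then wcoeff i * wcoeff j * wcoeff k / (2 * (real n + 1) * wcoeff (Suc n)) else 0)"
proof -
  let ?f = "\<lambda>(i, j, k). if (i, j, k) \<in> triples n
      then wcoeff i * wcoeff j * wcoeff k / (2 * (real n + 1) * wcoeff (Suc n)) else 0"
  have w: "2 * (real n + 1) * wcoeff (Suc n) > 0" using wcoeff_pos[of "Suc n"] by simp
  have nn: "0 \<le> ?f x" for x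
    using w wcoeff_pos by (cases x) (auto intro!: divide_nonneg_pos mult_nonneg_nonneg less_imp_le[OF wcoeff_pos])
  have "(\<integral>\<^sup>+x. ennreal (?f x) \<partial>count_space UNIV) = (\<Sum>x\<in>triples n. ennreal (?f x))"
    by (rule nn_integral_count_space') auto
  also have "\<dots> = ennreal (\<Sum>x\<in>triples n. ?f x)" using nn by (intro sum_ennreal) auto
  also have "(\<Sum>x\<in>triples n. ?f x) = (\<Sum>(i, j, k)\<in>triples n. wcoeff i * wcoeff j * wcoeff k / (2 * (real n + 1) * wcoeff (Suc n)))"
    by (intro sum.cong) auto
  also have "\<dots> = (\<Sum>(i, j, k)\<in>triples n. wcoeff i * wcoeff j * wcoeff k) / (2 * (real n + 1) * wcoeff (Suc n))"
    by (simp add: sum_divide_distrib case_prod_beta)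
  also have "\<dots> = 1" using w unfolding sum_triples by (metis divide_self less_irrefl)
  finally have "pmf (split_pmf n) (i, j, k) = ?f (i, j, k)"
    unfolding split_pmf_def using nn by (intro pmf_embed_pmf) auto
  then show ?thesis by (simp add: triples_def)
qed

lemma set_split_pmf: "set_pmf (split_pmf n) \<subseteq> triples n"
  by (auto simp: set_pmf_iff pmf_split triples_def split: if_splits)

text \<open>Three independent tree sizes are grouped by their total \<open>n\<close>. The total has
  the weight in front, and given the total the triple has law \<open>split_pmf n\<close>. Read
  backwards, this turns the derivative of the Wild series into the cubic term of the
  equation.\<close>

lemma expectation_wild_split:
  fixes G :: "nat \<times> nat \<times> nat \<Rightarrow> real"
  assumes u: "0 < u" "u \<le> 1" and G: "\<And>x. \<bar>G x\<bar> \<le> B"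
  defines "W \<equiv> wild_pmf u"
  shows "(\<lambda>n. u ^ 3 * (2 * (real n + 1) * wcoeff (Suc n) * (1 - u\<^sup>2) ^ n) * measure_pmf.expectation (split_pmf n) G)
     sums measure_pmf.expectation (pair_pmf W (pair_pmf W W)) G"
proof -
  let ?P = "pair_pmf W (pair_pmf W W)"
  let ?N = "map_pmf (\<lambda>(i, j, k). i + j + k) ?P"
  let ?s = "1 - u\<^sup>2"
  let ?c = "\<lambda>n. u ^ 3 * (2 * (real n + 1) * wcoeff (Suc n) * ?s ^ n)"
  have P: "pmf ?P (i, j, k) = u ^ 3 * (wcoeff i * wcoeff j * wcoeff k) * ?s ^ (i + j + k)" for i j k
    by (simp add: pmf_pair W_def pmf_wild[OF u] power_add power3_eq_cube)
  have PQ: "pmf ?P (i, j, k) = ?c (i + j + k) * pmf (split_pmf (i + j + k)) (i, j, k)" for i j k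
    using wcoeff_pos[of "Suc (i + j + k)"] by (simp add: P pmf_split)
  have I: "integrable (measure_pmf ?P) G"
    using G by (intro measure_pmf.integrable_const_bound[where B=B]) auto
  have part: "(\<integral>x. indicator (triples n) x * G x \<partial>measure_pmf ?P) = ?c n * measure_pmf.expectation (split_pmf n) G" for n
  proof -
    have "(\<integral>x. indicator (triples n) x * G x \<partial>measure_pmf ?P) = (\<Sum>x\<in>triples n. G x * pmf ?P x)"
      by (subst integral_measure_pmf_real[of "triples n"]) (auto simp: indicator_def split: if_splits intro!: sum.cong)
    also have "\<dots> = (\<Sum>x\<in>triples n. ?c n * (G x * pmf (split_pmf n) x))"
      by (intro sum.cong refl) (auto simp: PQ triples_def)
    also have "\<dots> = ?c n * (\<Sum>x\<in>triples n. G x * pmf (split_pmf n) x)"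
      by (simp only: sum_distrib_left)
    also have "(\<Sum>x\<in>triples n. G x * pmf (split_pmf n) x) = measure_pmf.expectation (split_pmf n) G"
      using set_split_pmf[of n] by (subst integral_measure_pmf_real[of "triples n"]) auto
    finally show ?thesis .
  qed
  \<comment> \<open>Truncation at total size \<open>N\<close>, with the constant \<open>B\<close> as
    dominating function, produces the partial sums of the series.\<close>
  have "(\<lambda>N. \<integral>x. (if fst x + fst (snd x) + snd (snd x) < N then G x else 0) \<partial>measure_pmf ?P)
      \<longlonglongrightarrow> (\<integral>x. G x \<partial>measure_pmf ?P)"
  proof (rule integral_dominated_convergence[where w="\<lambda>_. B"])
    show "AE x in measure_pmf ?P. (\<lambda>N. if fst x + fst (snd x) + snd (snd x) < N then G x else 0) \<longlonglongrightarrow> G x"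
    proof (intro AE_I2 tendsto_eventually)
      fix x :: "nat \<times> nat \<times> nat"
      show "\<forall>\<^sub>F N in sequentially. (if fst x + fst (snd x) + snd (snd x) < N then G x else 0) = G x"
        using eventually_gt_at_top[of "fst x + fst (snd x) + snd (snd x)"] by eventually_elim simp
    qed
    have "0 \<le> B" using G[of undefined] by linarith
    then show "AE x in measure_pmf ?P. norm (if fst x + fst (snd x) + snd (snd x) < N then G x else 0) \<le> B" for N
      using G by auto
  qed auto
  also have "(\<lambda>N. \<integral>x. (if fst x + fst (snd x) + snd (snd x) < N then G x else 0) \<partial>measure_pmf ?P)
      = (\<lambda>N. \<Sum>n<N. ?c n * measure_pmf.expectation (split_pmf n) G)"
  proof
    fix N
    have "(if fst x + fst (snd x) + snd (snd x) < N then G x else 0) = (\<Sum>n<N. indicator (triples n) x * G x)" for x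
    proof -
      have "(\<Sum>n<N. indicator (triples n) x * G x) = (\<Sum>n<N. if fst x + fst (snd x) + snd (snd x) = n then G x else 0)"
        by (intro sum.cong) (auto simp: triples_def indicator_def)
      then show ?thesis by simp
    qed
    then have "(\<integral>x. (if fst x + fst (snd x) + snd (snd x) < N then G x else 0) \<partial>measure_pmf ?P)
        = (\<integral>x. (\<Sum>n<N. indicator (triples n) x * G x) \<partial>measure_pmf ?P)" by simp
    also have "\<dots> = (\<Sum>n<N. \<integral>x. indicator (triples n) x * G x \<partial>measure_pmf ?P)"
      using I by (intro Bochner_Integration.integral_sum) (auto intro!: integrable_real_mult_indicator simp: mult.commute)
    finally show "(\<integral>x. (if fst x + fst (snd x) + snd (snd x) < N then G x else 0) \<partial>measure_pmf ?P)
        = (\<Sum>n<N. ?c n * measure_pmf.expectation (split_pmf n) G)" by (simp only: part)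
  qed
  finally show ?thesis by (simp only: sums_def)
qed

section \<open>The higher-level map in terms of expectations\<close>

lemma measurable_pexp:
  assumes "\<rho> \<in> space PP_spin" and k: "(\<lambda>(w, z). k w z) \<in> borel_measurable (N \<Otimes>\<^sub>M borel)"
  shows "(\<lambda>w. pexp \<rho> (k w)) \<in> borel_measurable N"
proof -
  interpret prob_space \<rho> using PP_spinD[OF assms(1)] by simp
  note [measurable_cong] = PP_spinD(2)[OF assms(1)]
  have [measurable]: "(\<lambda>p. k (fst p) (snd p)) \<in> borel_measurable (N \<Otimes>\<^sub>M borel)"
    using k by (simp add: case_prod_beta')
  have "(\<lambda>p. k (fst p) (p1 (snd p))) \<in> borel_measurable (N \<Otimes>\<^sub>M \<rho>)"
  proof -
    have "(\<lambda>p. (fst p, p1 (snd p))) \<in> N \<Otimes>\<^sub>M \<rho> \<rightarrow>\<^sub>M N \<Otimes>\<^sub>M borel" by measurable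
    from measurable_compose[OF this \<open>(\<lambda>p. k (fst p) (snd p)) \<in> _\<close>] show ?thesis by simp
  qed
  then show ?thesis
    unfolding pexp_def by (intro borel_measurable_lebesgue_integral) (simp add: case_prod_beta')
qed

definition bdd_test2 :: "(real \<Rightarrow> real \<Rightarrow> real) \<Rightarrow> bool" where
  "bdd_test2 k \<longleftrightarrow> (\<lambda>(x, y). k x y) \<in> borel_measurable (borel \<Otimes>\<^sub>M borel) \<and>
     (\<exists>B. \<forall>x\<in>{0..1}. \<forall>y\<in>{0..1}. \<bar>k x y\<bar> \<le> B)"

lemma bdd_test2_slice:
  assumes "bdd_test2 k" "x \<in> {0..1}"
  shows "bdd_test (k x)"
proof -
  have m: "(\<lambda>(x, y). k x y) \<in> borel_measurable (borel \<Otimes>\<^sub>M borel)" using assms by (auto simp: bdd_test2_def)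
  have "(\<lambda>y. (x, y)) \<in> borel \<rightarrow>\<^sub>M borel \<Otimes>\<^sub>M borel" by measurable
  from measurable_compose[OF this m] have "k x \<in> borel_measurable borel" by simp
  then show ?thesis using assms unfolding bdd_test_def bdd_test2_def bounded_iff by (metis imageE real_norm_def)
qed

lemma bdd_test_pexp:
  assumes "\<rho> \<in> space PP_spin" "bdd_test2 k"
  shows "bdd_test (\<lambda>x. pexp \<rho> (k x))"
proof -
  obtain B where B: "\<And>x y. x \<in> {0..1} \<Longrightarrow> y \<in> {0..1} \<Longrightarrow> \<bar>k x y\<bar> \<le> B" using assms(2) unfolding bdd_test2_def by blast
  have "\<bar>pexp \<rho> (k x)\<bar> \<le> B" if "x \<in> {0..1}" for x
    by (rule abs_pexp_le[OF assms(1) bdd_test2_slice[OF assms(2) that] B[OF that]])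
  moreover have "(\<lambda>x. pexp \<rho> (k x)) \<in> borel_measurable borel"
    using assms by (intro measurable_pexp) (auto simp: bdd_test2_def)
  ultimately show ?thesis unfolding bdd_test_def bounded_iff by (auto intro!: exI[of _ B])
qed

lemma pexp_swap:
  assumes "\<rho> \<in> space PP_spin" "\<sigma> \<in> space PP_spin" "bdd_test2 k"
  shows "pexp \<rho> (\<lambda>x. pexp \<sigma> (\<lambda>y. k x y)) = pexp \<sigma> (\<lambda>y. pexp \<rho> (\<lambda>x. k x y))"
proof -
  interpret r: prob_space \<rho> using PP_spinD[OF assms(1)] by simp
  interpret s: prob_space \<sigma> using PP_spinD[OF assms(2)] by simp
  interpret rs: prob_space "\<rho> \<Otimes>\<^sub>M \<sigma>" by (intro prob_space_pair r.prob_space_axioms s.prob_space_axioms)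
  interpret pair_sigma_finite \<rho> \<sigma> ..
  note [measurable_cong] = PP_spinD(2)[OF assms(1)] PP_spinD(2)[OF assms(2)]
  obtain B where B: "\<And>x y. x \<in> {0..1} \<Longrightarrow> y \<in> {0..1} \<Longrightarrow> \<bar>k x y\<bar> \<le> B" using assms(3) unfolding bdd_test2_def by blast
  have m: "(\<lambda>(x, y). k x y) \<in> borel_measurable (borel \<Otimes>\<^sub>M borel)" using assms by (auto simp: bdd_test2_def)
  have "(\<lambda>p. (p1 (fst p), p1 (snd p))) \<in> \<rho> \<Otimes>\<^sub>M \<sigma> \<rightarrow>\<^sub>M borel \<Otimes>\<^sub>M borel" by measurable
  from measurable_compose[OF this m]
  have m': "(\<lambda>p. k (p1 (fst p)) (p1 (snd p))) \<in> borel_measurable (\<rho> \<Otimes>\<^sub>M \<sigma>)" by simp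
  have "integrable (\<rho> \<Otimes>\<^sub>M \<sigma>) (\<lambda>p. k (p1 (fst p)) (p1 (snd p)))"
    using PP_spinD(3)[OF assms(1)] PP_spinD(3)[OF assms(2)]
    by (intro rs.integrable_const_bound[where B=B] m') (auto intro!: AE_I2 B p1_bounds simp: space_pair_measure)
  then show ?thesis
    unfolding pexp_def using Fubini_integral[of "\<lambda>\<mu> \<nu>. k (p1 \<mu>) (p1 \<nu>)"] by (simp add: case_prod_beta')
qed

lemma bdd_test_obtain:
  assumes "bdd_test h"
  obtains B where "B \<ge> 0" "\<And>x. x \<in> {0..1} \<Longrightarrow> \<bar>h x\<bar> \<le> B"
proof -
  obtain B where B: "\<And>x. x \<in> {0..1} \<Longrightarrow> \<bar>h x\<bar> \<le> B"
    using assms unfolding bdd_test_def bounded_iff by (metis imageI real_norm_def)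
  have "\<bar>h 0\<bar> \<le> B" by (rule B) simp
  then have "0 \<le> B" by linarith
  then show ?thesis using B by (rule that)
qed

lemma bdd_test2_cob_poly:
  assumes "bdd_test h" "x \<in> {0..1}"
  shows "bdd_test2 (\<lambda>y z. h (cob_poly x y z))" "bdd_test2 (\<lambda>y z. h (cob_poly y x z))" "bdd_test2 (\<lambda>y z. h (cob_poly y z x))"
proof -
  have [measurable]: "h \<in> borel_measurable borel" using assms(1) by (simp add: bdd_test_def)
  obtain B where B: "B \<ge> 0" "\<And>x. x \<in> {0..1} \<Longrightarrow> \<bar>h x\<bar> \<le> B" using bdd_test_obtain[OF assms(1)] by blast
  show "bdd_test2 (\<lambda>y z. h (cob_poly x y z))" "bdd_test2 (\<lambda>y z. h (cob_poly y x z))" "bdd_test2 (\<lambda>y z. h (cob_poly y z x))"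
    unfolding bdd_test2_def case_prod_beta'
    by (intro conjI exI[of _ B] ballI B cob_poly_bounds assms; simp)+
qed

lemma bdd_test2_pexp_cob_poly:
  assumes "bdd_test h" "\<rho> \<in> space PP_spin"
  shows "bdd_test2 (\<lambda>y z. pexp \<rho> (\<lambda>x. h (cob_poly x y z)))" "bdd_test2 (\<lambda>y z. pexp \<rho> (\<lambda>x. h (cob_poly y x z)))"
    "bdd_test2 (\<lambda>y z. pexp \<rho> (\<lambda>x. h (cob_poly y z x)))"
proof -
  have [measurable]: "h \<in> borel_measurable borel" using assms(1) by (simp add: bdd_test_def)
  obtain B where B: "B \<ge> 0" "\<And>x. x \<in> {0..1} \<Longrightarrow> \<bar>h x\<bar> \<le> B" using bdd_test_obtain[OF assms(1)] by blast
  have bd: "\<bar>pexp \<rho> (\<lambda>x. h (cob_poly x y z))\<bar> \<le> B \<and> \<bar>pexp \<rho> (\<lambda>x. h (cob_poly y x z))\<bar> \<le> B \<and> \<bar>pexp \<rho> (\<lambda>x. h (cob_poly y z x))\<bar> \<le> B"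
    if "y \<in> {0..1}" "z \<in> {0..1}" for y z
    using that assms bdd_test2_cob_poly[OF assms(1)] 
    by (intro conjI abs_pexp_le B cob_poly_bounds bdd_test_comp[OF assms(1)]) auto
  have m: "(\<lambda>p. pexp \<rho> (\<lambda>x. h (cob_poly x (fst p) (snd p)))) \<in> borel_measurable (borel \<Otimes>\<^sub>M borel)"
    "(\<lambda>p. pexp \<rho> (\<lambda>x. h (cob_poly (fst p) x (snd p)))) \<in> borel_measurable (borel \<Otimes>\<^sub>M borel)"
    "(\<lambda>p. pexp \<rho> (\<lambda>x. h (cob_poly (fst p) (snd p) x))) \<in> borel_measurable (borel \<Otimes>\<^sub>M borel)"
    by (rule measurable_pexp[OF assms(2)], measurable)+
  show "bdd_test2 (\<lambda>y z. pexp \<rho> (\<lambda>x. h (cob_poly x y z)))" "bdd_test2 (\<lambda>y z. pexp \<rho> (\<lambda>x. h (cob_poly y x z)))"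
    "bdd_test2 (\<lambda>y z. pexp \<rho> (\<lambda>x. h (cob_poly y z x)))"
    using bd m unfolding bdd_test2_def case_prod_beta' by blast+
qed

definition cobE :: "bool measure measure \<Rightarrow> bool measure measure \<Rightarrow> bool measure measure \<Rightarrow> (real \<Rightarrow> real) \<Rightarrow> real" where
  "cobE \<rho>1 \<rho>2 \<rho>3 h = pexp \<rho>1 (\<lambda>x. pexp \<rho>2 (\<lambda>y. pexp \<rho>3 (\<lambda>z. h (cob_poly x y z))))"

text \<open>Any argument can be made the outermost one, so that a mixture in that argument can be
  pulled out.\<close>

lemma cobE_outer:
  assumes "\<rho>1 \<in> space PP_spin" "\<rho>2 \<in> space PP_spin" "\<rho>3 \<in> space PP_spin" "bdd_test h"
  shows "cobE \<rho>1 \<rho>2 \<rho>3 h = pexp \<rho>2 (\<lambda>y. pexp \<rho>1 (\<lambda>x. pexp \<rho>3 (\<lambda>z. h (cob_poly x y z))))"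
    and "cobE \<rho>1 \<rho>2 \<rho>3 h = pexp \<rho>3 (\<lambda>z. pexp \<rho>1 (\<lambda>x. pexp \<rho>2 (\<lambda>y. h (cob_poly x y z))))"
proof -
  show "cobE \<rho>1 \<rho>2 \<rho>3 h = pexp \<rho>2 (\<lambda>y. pexp \<rho>1 (\<lambda>x. pexp \<rho>3 (\<lambda>z. h (cob_poly x y z))))"
    unfolding cobE_def by (rule pexp_swap) (use assms bdd_test2_pexp_cob_poly in auto)
  have "cobE \<rho>1 \<rho>2 \<rho>3 h = pexp \<rho>1 (\<lambda>x. pexp \<rho>3 (\<lambda>z. pexp \<rho>2 (\<lambda>y. h (cob_poly x y z))))"
    unfolding cobE_def by (rule pexp_cong[OF assms(1)], rule pexp_swap) (use assms bdd_test2_cob_poly in auto)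
  also have "\<dots> = pexp \<rho>3 (\<lambda>z. pexp \<rho>1 (\<lambda>x. pexp \<rho>2 (\<lambda>y. h (cob_poly x y z))))"
    by (rule pexp_swap) (use assms bdd_test2_pexp_cob_poly in auto)
  finally show "cobE \<rho>1 \<rho>2 \<rho>3 h = pexp \<rho>3 (\<lambda>z. pexp \<rho>1 (\<lambda>x. pexp \<rho>2 (\<lambda>y. h (cob_poly x y z))))" .
qed

lemma bdd_test_cobE_slices:
  assumes "\<rho> \<in> space PP_spin" "\<sigma> \<in> space PP_spin" "bdd_test h"
  shows "bdd_test (\<lambda>x. pexp \<rho> (\<lambda>y. pexp \<sigma> (\<lambda>z. h (cob_poly x y z))))"
    "bdd_test (\<lambda>y. pexp \<rho> (\<lambda>x. pexp \<sigma> (\<lambda>z. h (cob_poly x y z))))"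
    "bdd_test (\<lambda>z. pexp \<rho> (\<lambda>x. pexp \<sigma> (\<lambda>y. h (cob_poly x y z))))"
proof -
  have sw: "bdd_test2 (\<lambda>x y. k y x)" if "bdd_test2 k" for k
  proof -
    have "(\<lambda>(x, y). k x y) \<in> borel_measurable (borel \<Otimes>\<^sub>M borel)" using that by (simp add: bdd_test2_def)
    from measurable_compose[OF measurable_pair_swap' this] show ?thesis
      using that unfolding bdd_test2_def by (auto simp: case_prod_beta')
  qed
  show "bdd_test (\<lambda>x. pexp \<rho> (\<lambda>y. pexp \<sigma> (\<lambda>z. h (cob_poly x y z))))"
    by (rule bdd_test_pexp[OF assms(1) bdd_test2_pexp_cob_poly(3)[OF assms(3,2)]])
  show "bdd_test (\<lambda>y. pexp \<rho> (\<lambda>x. pexp \<sigma> (\<lambda>z. h (cob_poly x y z))))"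
    by (rule bdd_test_pexp[OF assms(1) sw[OF bdd_test2_pexp_cob_poly(3)[OF assms(3,2)]]])
  show "bdd_test (\<lambda>z. pexp \<rho> (\<lambda>x. pexp \<sigma> (\<lambda>y. h (cob_poly x y z))))"
    by (rule bdd_test_pexp[OF assms(1) sw[OF bdd_test2_pexp_cob_poly(2)[OF assms(3,2)]]])
qed

lemma abs_cobE_le:
  assumes "\<rho>1 \<in> space PP_spin" "\<rho>2 \<in> space PP_spin" "\<rho>3 \<in> space PP_spin" "bdd_test h"
    "\<And>x. x \<in> {0..1} \<Longrightarrow> \<bar>h x\<bar> \<le> B"
  shows "\<bar>cobE \<rho>1 \<rho>2 \<rho>3 h\<bar> \<le> B"
  using abs_pexp_le[OF cob_law_in_PP_spin[OF assms(1-3)] assms(4,5)] pexp_cob_law[OF assms(1-4)]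
  by (simp add: cobE_def)

section \<open>Mixtures\<close>

lemma mixture_in_PP_spin:
  assumes "\<And>i. R i \<in> space PP_spin"
  shows "measure_pmf p \<bind> R \<in> space PP_spin"
  using prob_space_bind'[of "measure_pmf p" "count_space UNIV" R P_spin]
    sets_bind'[of "measure_pmf p" "count_space UNIV" R P_spin] assms prob_space_measure_pmf[of p]
  by (auto simp: in_PP_spin[of "_ \<bind> _"]) (auto simp: space_prob_algebra)

lemma pexp_mixture:
  assumes "\<And>i. R i \<in> space PP_spin" "bdd_test h"
  shows "pexp (measure_pmf p \<bind> R) h = (\<integral>i. pexp (R i) h \<partial>measure_pmf p)"
proof -
  obtain B where B: "B \<ge> 0" "\<And>x. x \<in> {0..1} \<Longrightarrow> \<bar>h x\<bar> \<le> B" using bdd_test_obtain[OF assms(2)] by blast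
  have [measurable]: "h \<in> borel_measurable borel" using assms(2) by (simp add: bdd_test_def)
  have R: "R \<in> measure_pmf p \<rightarrow>\<^sub>M prob_algebra P_spin" using assms(1) by auto
  show ?thesis unfolding pexp_def
  proof (rule integral_bind[where K=P_spin and B=B and B'=1])
    show "R \<in> measure_pmf p \<rightarrow>\<^sub>M subprob_algebra P_spin" by (rule measurable_prob_algebraD[OF R])
    show "AE x in measure_pmf p. emeasure (R x) (space (R x)) \<le> ennreal 1"
      using assms(1) PP_spinD(1) by (auto simp: prob_space.emeasure_space_1)
  qed (use B p1_bounds in \<open>auto intro: measure_pmf.finite_measure_axioms\<close>)
qed

text \<open>A death is treated as a branching point whose value ignores its three subtrees. All
  trees are therefore ternary, and all events occur at the single rate
  \<open>\<alpha> + 1\<close>.\<close>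

definition branch :: "real \<Rightarrow> bool measure measure \<Rightarrow> bool measure measure \<Rightarrow> bool measure measure \<Rightarrow> bool measure measure" where
  "branch \<alpha> \<rho>1 \<rho>2 \<rho>3 = measure_pmf (bernoulli_pmf (\<alpha> / (\<alpha> + 1))) \<bind>
     (\<lambda>b. if b then cob_law \<rho>1 \<rho>2 \<rho>3 else return P_spin (bern 0))"

lemma return_in_PP_spin [simp]: "\<mu> \<in> space P_spin \<Longrightarrow> return P_spin \<mu> \<in> space PP_spin"
  by (auto simp: in_PP_spin intro: prob_space_return)

lemma pexp_return: "\<mu> \<in> space P_spin \<Longrightarrow> bdd_test h \<Longrightarrow> pexp (return P_spin \<mu>) h = h (p1 \<mu>)"
  unfolding pexp_def bdd_test_def by (subst integral_return) auto

lemma branch_in_PP_spin: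
  assumes "\<rho>1 \<in> space PP_spin" "\<rho>2 \<in> space PP_spin" "\<rho>3 \<in> space PP_spin"
  shows "branch \<alpha> \<rho>1 \<rho>2 \<rho>3 \<in> space PP_spin"
  unfolding branch_def using assms by (intro mixture_in_PP_spin) (simp add: cob_law_in_PP_spin)

lemma pexp_branch:
  assumes "\<rho>1 \<in> space PP_spin" "\<rho>2 \<in> space PP_spin" "\<rho>3 \<in> space PP_spin" "bdd_test h" and \<alpha>: "\<alpha> \<ge> 0"
  shows "pexp (branch \<alpha> \<rho>1 \<rho>2 \<rho>3) h = (\<alpha> * cobE \<rho>1 \<rho>2 \<rho>3 h + h 0) / (\<alpha> + 1)"
proof -
  have p: "0 \<le> \<alpha> / (\<alpha> + 1)" "\<alpha> / (\<alpha> + 1) \<le> 1" "1 - \<alpha> / (\<alpha> + 1) = 1 / (\<alpha> + 1)" using \<alpha> by (auto simp: field_simps)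
  have "pexp (branch \<alpha> \<rho>1 \<rho>2 \<rho>3) h = pexp (cob_law \<rho>1 \<rho>2 \<rho>3) h * (\<alpha> / (\<alpha> + 1)) + pexp (return P_spin (bern 0)) h * (1 - \<alpha> / (\<alpha> + 1))"
    unfolding branch_def using p assms
    by (subst pexp_mixture) (auto simp: cob_law_in_PP_spin)
  then show ?thesis
    using assms p(3) by (simp add: pexp_cob_law pexp_return cobE_def p1_bern add_divide_distrib)
qed

lemma T_map_cob:
  assumes \<rho>: "\<rho> \<in> space PP_spin"
  shows "T_map P_spin 3 (check_map spin 3 cob) \<rho> = cob_law \<rho> \<rho> \<rho>"
proof -
  let ?t = "(\<lambda>(x, y, z). \<lambda>i. if i = (0::nat) then x else if i = 1 then y else if i = 2 then z else undefined)
      :: _ \<Rightarrow> nat \<Rightarrow> bool measure"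
  note [measurable_cong] = PP_spinD(2)[OF \<rho>]
  note sp = PP_spinD(3)[OF \<rho>]
  have m: "check_map spin 3 cob \<in> PiM {..<3} (\<lambda>_. \<rho>) \<rightarrow>\<^sub>M P_spin"
  proof (subst measurable_cong)
    fix \<mu> :: "nat \<Rightarrow> bool measure" assume "\<mu> \<in> space (PiM {..<3} (\<lambda>_. \<rho>))"
    then have "\<mu> i \<in> space P_spin" if "i < 3" for i using that by (auto simp: space_PiM sp PiE_iff)
    then show "check_map spin 3 cob \<mu> = bern (cob_poly (p1 (\<mu> 0)) (p1 (\<mu> 1)) (p1 (\<mu> 2)))"
      by (rule check_map_cob)
  qed measurable
  have "T_map P_spin 3 (check_map spin 3 cob) \<rho> = distr (\<rho> \<Otimes>\<^sub>M (\<rho> \<Otimes>\<^sub>M \<rho>)) P_spin (check_map spin 3 cob \<circ> ?t)"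
    unfolding T_map_def check_map_def[of P_spin]
    by (subst PiM_lessThan_3(1)) (use PP_spinD(1)[OF \<rho>] in \<open>auto intro!: distr_distr m PiM_lessThan_3(2)[of "\<lambda>_. \<rho>"]\<close>)
  also have "\<dots> = cob_law \<rho> \<rho> \<rho>"
    unfolding cob_law_def
  proof (rule distr_cong)
    fix \<omega> assume "\<omega> \<in> space (\<rho> \<Otimes>\<^sub>M (\<rho> \<Otimes>\<^sub>M \<rho>))"
    then obtain x y z where "\<omega> = (x, y, z)" "x \<in> space P_spin" "y \<in> space P_spin" "z \<in> space P_spin"
      unfolding space_pair_measure sp by blast
    moreover from this have "?t \<omega> i \<in> space P_spin" if "i < 3" for i
    proof -
      have "i = 0 \<or> i = 1 \<or> i = 2" using that by auto
      then show ?thesis using calculation by auto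
    qed
    from check_map_cob[OF this]
    have "check_map spin 3 cob (?t \<omega>) = bern (cob_poly (p1 (?t \<omega> 0)) (p1 (?t \<omega> 1)) (p1 (?t \<omega> 2)))" .
    ultimately show "(check_map spin 3 cob \<circ> ?t) \<omega> = (case \<omega> of (\<mu>1, \<mu>2, \<mu>3) \<Rightarrow> bern (cob_poly (p1 \<mu>1) (p1 \<mu>2) (p1 \<mu>3)))"
      by simp
  qed auto
  finally show ?thesis .
qed

lemma prob_space_PiM_lessThan_0: "prob_space (PiM {..<0::nat} M)"
  by (rule prob_spaceI) (simp add: PiM_empty)

lemma bern_0: "bern 0 = return spin False"
proof -
  have "bernoulli_pmf 0 = return_pmf False" by (rule pmf_eqI) (auto simp: bernoulli_pmf.rep_eq split: split_indicator)
  then show ?thesis by (simp add: return_pmf.rep_eq)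
qed

lemma T_map_dth: "T_map P_spin 0 (check_map spin 0 dth) \<rho> = return P_spin (bern 0)"
proof -
  have "check_map spin 0 dth = (\<lambda>_. bern 0)"
    unfolding check_map_def dth_def[abs_def] bern_0
    by (intro ext prob_space.distr_const prob_space_PiM_lessThan_0) simp
  then show ?thesis unfolding T_map_def check_map_def[of P_spin]
    by (simp only:) (intro prob_space.distr_const prob_space_PiM_lessThan_0, simp)
qed

text \<open>\<open>T_check\<close> passes a weighted sum of set functions to
  \<open>measure_of\<close>, which has the intended meaning only if that sum is a measure.
  Exhibiting the sum as a mixture supplies this.\<close>

lemma T_check_eq_branch:
  assumes \<rho>: "\<rho> \<in> space PP_spin" and \<alpha>: "\<alpha> \<ge> 0"
  shows "T_check \<alpha> \<rho> = branch \<alpha> \<rho> \<rho> \<rho>"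
proof -
  let ?B = "branch \<alpha> \<rho> \<rho> \<rho>"
  have p: "0 \<le> \<alpha> / (\<alpha> + 1)" "\<alpha> / (\<alpha> + 1) \<le> 1" "1 - \<alpha> / (\<alpha> + 1) = 1 / (\<alpha> + 1)" using \<alpha> by (auto simp: field_simps)
  have "?B = measure_of (space P_spin) (sets P_spin) (emeasure ?B)"
    using measure_of_of_measure[of ?B] PP_spinD(2,3)[OF branch_in_PP_spin[OF \<rho> \<rho> \<rho>, of \<alpha>]] by simp
  also have "\<dots> = T_check \<alpha> \<rho>"
    unfolding T_check_def
  proof (rule measure_of_eq)
    show "sets P_spin \<subseteq> Pow (space P_spin)" by (rule sets.space_closed)
    fix A assume "A \<in> sigma_sets (space P_spin) (sets P_spin)"
    then have A: "A \<in> sets P_spin" by (simp add: sets.sigma_sets_eq)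
    have "emeasure ?B A = (\<integral>\<^sup>+b. emeasure (if b then cob_law \<rho> \<rho> \<rho> else return P_spin (bern 0)) A \<partial>bernoulli_pmf (\<alpha> / (\<alpha> + 1)))"
      unfolding branch_def
      by (rule emeasure_bind_prob_algebra[OF _ _ A, where N="count_space UNIV"])
        (use cob_law_in_PP_spin[OF \<rho> \<rho> \<rho>] in \<open>auto simp: space_prob_algebra[of "count_space UNIV"] prob_space_measure_pmf\<close>)
    also have "\<dots> = emeasure (cob_law \<rho> \<rho> \<rho>) A * ennreal (\<alpha> / (\<alpha> + 1)) + emeasure (return P_spin (bern 0)) A * ennreal (1 / (\<alpha> + 1))"
      using p by (subst nn_integral_bernoulli_pmf) auto
    finally show "emeasure ?B A = ennreal (\<alpha> / (\<alpha> + 1)) * emeasure (T_map P_spin 3 (check_map spin 3 cob) \<rho>) A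
        + ennreal (1 / (\<alpha> + 1)) * emeasure (T_map P_spin 0 (check_map spin 0 dth) \<rho>) A"
      by (simp add: T_map_cob[OF \<rho>] T_map_dth mult.commute)
  qed
  finally show ?thesis by simp
qed

lemma T_check_in_PP_spin: "\<rho> \<in> space PP_spin \<Longrightarrow> \<alpha> \<ge> 0 \<Longrightarrow> T_check \<alpha> \<rho> \<in> space PP_spin"
  by (simp add: T_check_eq_branch branch_in_PP_spin)

lemma pexp_T_check:
  "\<rho> \<in> space PP_spin \<Longrightarrow> bdd_test h \<Longrightarrow> \<alpha> \<ge> 0 \<Longrightarrow> pexp (T_check \<alpha> \<rho>) h = (\<alpha> * cobE \<rho> \<rho> \<rho> h + h 0) / (\<alpha> + 1)"
  by (simp add: T_check_eq_branch pexp_branch)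

lemma integral_eq_pexp:
  assumes "\<rho> \<in> space PP_spin"
  shows "(\<integral>\<mu>. f \<mu> \<partial>\<rho>) = pexp \<rho> (\<lambda>x. f (bern x))"
  unfolding pexp_def using PP_spinD(3)[OF assms] by (intro Bochner_Integration.integral_cong) auto

text \<open>Composition with \<open>bern\<close> and with \<open>p1\<close> translates between test
  functions on \<open>P_spin\<close> and on the unit interval. The factor
  \<open>\<alpha> + 1\<close> cancels the denominators in \<open>T_check\<close>.\<close>

lemma higher_solution_iff:
  assumes \<alpha>: "\<alpha> \<ge> 0"
  shows "higher_solution \<alpha> \<rho> \<longleftrightarrow> (\<forall>t\<ge>0. \<rho> t \<in> space PP_spin) \<and>
    (\<forall>h. bdd_test h \<longrightarrow> ode_on 0 (\<lambda>t. pexp (\<rho> t) h)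
       (\<lambda>t. \<alpha> * cobE (\<rho> t) (\<rho> t) (\<rho> t) h + h 0 - (\<alpha> + 1) * pexp (\<rho> t) h))" (is "?L \<longleftrightarrow> ?P \<and> ?O")
proof -
  have rhs: "(\<alpha> + 1) * (pexp (T_check \<alpha> (\<rho> t)) h - pexp (\<rho> t) h) = \<alpha> * cobE (\<rho> t) (\<rho> t) (\<rho> t) h + h 0 - (\<alpha> + 1) * pexp (\<rho> t) h"
    if "\<rho> t \<in> space PP_spin" "bdd_test h" for t h
    using that \<alpha> by (simp add: pexp_T_check field_simps)
  show ?thesis
  proof (intro iffI conjI)
    assume L: ?L
    then show P: ?P by (simp add: higher_solution_def)
    show ?O unfolding ode_on_def
    proof safe
      fix h :: "real \<Rightarrow> real" and t :: real assume h: "bdd_test h" and t: "0 \<le> t"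
      have [measurable]: "h \<in> borel_measurable borel" using h by (simp add: bdd_test_def)
      have "bounded ((\<lambda>\<mu>. h (p1 \<mu>)) ` space P_spin)"
      proof -
        have "(\<lambda>\<mu>. h (p1 \<mu>)) ` space P_spin \<subseteq> h ` {0..1}" using p1_bounds by blast
        then show ?thesis using h bounded_subset by (auto simp: bdd_test_def)
      qed
      moreover have "(\<lambda>\<mu>. h (p1 \<mu>)) \<in> borel_measurable P_spin" by measurable
      ultimately have "((\<lambda>s. pexp (\<rho> s) h) has_real_derivative (\<alpha> + 1) * (pexp (T_check \<alpha> (\<rho> t)) h - pexp (\<rho> t) h)) (at t within {0..})"
        using L t unfolding higher_solution_def pexp_def by blast
      then show "((\<lambda>t. pexp (\<rho> t) h) has_real_derivative \<alpha> * cobE (\<rho> t) (\<rho> t) (\<rho> t) h + h 0 - (\<alpha> + 1) * pexp (\<rho> t) h) (at t within {0..})"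
        using rhs P h t by simp
    qed
  next
    assume PO: "?P \<and> ?O"
    show ?L unfolding higher_solution_def
    proof (intro conjI allI impI)
      fix f :: "bool measure \<Rightarrow> real" and t :: real
      assume f[measurable]: "f \<in> borel_measurable P_spin" and b: "bounded (f ` space P_spin)" and t: "0 \<le> t"
      let ?h = "\<lambda>x. f (bern x)"
      have h: "bdd_test ?h"
        unfolding bdd_test_def by (intro conjI bounded_subset[OF b]) auto
      have "ode_on 0 (\<lambda>t. pexp (\<rho> t) ?h) (\<lambda>t. \<alpha> * cobE (\<rho> t) (\<rho> t) (\<rho> t) ?h + ?h 0 - (\<alpha> + 1) * pexp (\<rho> t) ?h)"
        using PO h by blast
      then have "((\<lambda>t. pexp (\<rho> t) ?h) has_real_derivative (\<alpha> + 1) * (pexp (T_check \<alpha> (\<rho> t)) ?h - pexp (\<rho> t) ?h)) (at t within {0..})"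
        using rhs[OF _ h, of t] PO t unfolding ode_on_def by simp
      also have "pexp (T_check \<alpha> (\<rho> t)) ?h = (\<integral>\<mu>. f \<mu> \<partial>T_check \<alpha> (\<rho> t))"
        using PO t \<alpha> by (intro integral_eq_pexp[symmetric] T_check_in_PP_spin) auto
      also have "pexp (\<rho> t) ?h = (\<integral>\<mu>. f \<mu> \<partial>\<rho> t)"
        using PO t by (intro integral_eq_pexp[symmetric]) auto
      finally show "((\<lambda>s. \<integral>\<mu>. f \<mu> \<partial>\<rho> s) has_real_derivative
           (\<alpha> + 1) * ((\<integral>\<mu>. f \<mu> \<partial>T_check \<alpha> (\<rho> t)) - (\<integral>\<mu>. f \<mu> \<partial>\<rho> t))) (at t within {0..})"
        by (rule has_field_derivative_transform_within[OF _ zero_less_one]) (use PO t integral_eq_pexp[of _ f] in auto)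
    qed (use PO in simp)
  qed
qed

section \<open>Existence of solutions: the Wild sum\<close>

text \<open>The law at the root of a random ternary tree with \<open>n\<close> branching points,
  whose subtree sizes are drawn from \<open>split_pmf\<close> and whose leaves carry
  \<open>\<rho>\<close>. The guard holds on the support of \<open>split_pmf n\<close> and makes the
  recursion visibly terminating.\<close>

fun wild :: "real \<Rightarrow> bool measure measure \<Rightarrow> nat \<Rightarrow> bool measure measure" where
  "wild \<alpha> \<rho> 0 = \<rho>"
| "wild \<alpha> \<rho> (Suc n) = measure_pmf (split_pmf n) \<bind>
     (\<lambda>x. if fst x \<le> n \<and> fst (snd x) \<le> n \<and> snd (snd x) \<le> n
        then branch \<alpha> (wild \<alpha> \<rho> (fst x)) (wild \<alpha> \<rho> (fst (snd x))) (wild \<alpha> \<rho> (snd (snd x))) else \<rho>)"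

lemma wild_in_PP_spin:
  assumes "\<rho> \<in> space PP_spin"
  shows "wild \<alpha> \<rho> n \<in> space PP_spin"
proof (induction n rule: less_induct)
  case (less n)
  then show ?case
    by (cases n) (auto simp: assms intro!: mixture_in_PP_spin branch_in_PP_spin)
qed

text \<open>The guard in \<open>wild\<close> holds almost surely under \<open>split_pmf n\<close>,
  so it disappears from the expectation.\<close>

lemma pexp_wild_Suc:
  assumes \<rho>: "\<rho> \<in> space PP_spin" and h: "bdd_test h"
  shows "pexp (wild \<alpha> \<rho> (Suc n)) h = measure_pmf.expectation (split_pmf n)
    (\<lambda>(i, j, k). pexp (branch \<alpha> (wild \<alpha> \<rho> i) (wild \<alpha> \<rho> j) (wild \<alpha> \<rho> k)) h)"
  unfolding wild.simps
proof (subst pexp_mixture)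
  show "measure_pmf.expectation (split_pmf n) (\<lambda>x. pexp (if fst x \<le> n \<and> fst (snd x) \<le> n \<and> snd (snd x) \<le> n
        then branch \<alpha> (wild \<alpha> \<rho> (fst x)) (wild \<alpha> \<rho> (fst (snd x))) (wild \<alpha> \<rho> (snd (snd x))) else \<rho>) h)
    = measure_pmf.expectation (split_pmf n) (\<lambda>(i, j, k). pexp (branch \<alpha> (wild \<alpha> \<rho> i) (wild \<alpha> \<rho> j) (wild \<alpha> \<rho> k)) h)"
    using set_split_pmf[of n]
    by (intro integral_cong_AE) (auto simp: AE_measure_pmf_iff triples_def)
qed (auto intro!: branch_in_PP_spin wild_in_PP_spin \<rho> h)

text \<open>The parameter of \<open>wild_pmf\<close> is the probability that the root has not yet
  split at time \<open>t\<close>.\<close>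

definition wild_sum :: "real \<Rightarrow> bool measure measure \<Rightarrow> real \<Rightarrow> bool measure measure" where
  "wild_sum \<alpha> \<rho> t = measure_pmf (wild_pmf (exp (- (\<alpha> + 1) * t))) \<bind> wild \<alpha> \<rho>"

lemma wild_sum_in_PP_spin: "\<rho> \<in> space PP_spin \<Longrightarrow> wild_sum \<alpha> \<rho> t \<in> space PP_spin"
  unfolding wild_sum_def by (intro mixture_in_PP_spin wild_in_PP_spin)

lemma expectation_bind_pmf:
  fixes f :: "'b \<Rightarrow> real"
  assumes "\<And>x. \<bar>f x\<bar> \<le> B"
  shows "measure_pmf.expectation (bind_pmf p q) f = measure_pmf.expectation p (\<lambda>x. measure_pmf.expectation (q x) f)"
  unfolding measure_pmf_bind
  by (rule integral_bind[where K="count_space UNIV" and B=B and B'=1])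
    (auto simp: assms measure_pmf.emeasure_space_1[simplified] space_subprob_algebra
      intro: measure_pmf.finite_measure_axioms measure_pmf.subprob_space_axioms)

lemma expectation_pair_pmf3:
  fixes G :: "'a \<times> 'b \<times> 'c \<Rightarrow> real"
  assumes "\<And>x. \<bar>G x\<bar> \<le> B"
  shows "measure_pmf.expectation (pair_pmf p (pair_pmf q r)) G =
    (\<integral>i. (\<integral>j. (\<integral>k. G (i, j, k) \<partial>measure_pmf r) \<partial>measure_pmf q) \<partial>measure_pmf p)"
proof -
  have e: "\<bar>measure_pmf.expectation q f\<bar> \<le> B" if "\<And>x. \<bar>f x\<bar> \<le> B" for f :: "'d \<Rightarrow> real" and q
  proof -
    have "\<bar>measure_pmf.expectation q f\<bar> \<le> measure_pmf.expectation q (\<lambda>x. \<bar>f x\<bar>)" by (rule integral_abs_bound)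
    also have "\<dots> \<le> measure_pmf.expectation q (\<lambda>x. B)"
      using that by (intro integral_mono measure_pmf.integrable_const_bound[where B=B]) (auto intro!: AE_I2 order_trans[OF abs_ge_zero that])
    finally show ?thesis by simp
  qed
  show ?thesis
    unfolding pair_pmf_def using assms
    by (simp add: expectation_bind_pmf[where B=B] bind_return_pmf)
qed

text \<open>\<open>cobE\<close> is linear in each argument. Pulling the mixture out of the three
  arguments in turn makes the three indices independent.\<close>

lemma cobE_mixture:
  fixes p :: "'i pmf"
  assumes R: "\<And>i. R i \<in> space PP_spin" and h: "bdd_test h"
  defines "M \<equiv> measure_pmf p \<bind> R"
  shows "cobE M M M h = measure_pmf.expectation (pair_pmf p (pair_pmf p p)) (\<lambda>(i, j, k). cobE (R i) (R j) (R k) h)"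
proof -
  have M: "M \<in> space PP_spin" unfolding M_def by (rule mixture_in_PP_spin[OF R])
  have pexpM: "bdd_test k \<Longrightarrow> pexp M k = (\<integral>i. pexp (R i) k \<partial>measure_pmf p)" for k
    unfolding M_def by (rule pexp_mixture[OF R])
  obtain B where B: "B \<ge> 0" "\<And>x. x \<in> {0..1} \<Longrightarrow> \<bar>h x\<bar> \<le> B" using bdd_test_obtain[OF h] by blast
  have bd: "\<bar>(\<lambda>(i, j, k). cobE (R i) (R j) (R k) h) x\<bar> \<le> B" for x
    by (cases x) (auto intro!: abs_cobE_le R h B)
  have 3: "cobE (R i) (R j) M h = (\<integral>k. cobE (R i) (R j) (R k) h \<partial>measure_pmf p)" for i j
    unfolding cobE_outer(2)[OF R R M h] cobE_outer(2)[OF R R R h]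
    by (rule pexpM[OF bdd_test_cobE_slices(3)[OF R R h]])
  have 2: "cobE (R i) M M h = (\<integral>j. cobE (R i) (R j) M h \<partial>measure_pmf p)" for i
    unfolding cobE_outer(1)[OF R M M h] cobE_outer(1)[OF R R M h]
    by (rule pexpM[OF bdd_test_cobE_slices(2)[OF R M h]])
  have 1: "cobE M M M h = (\<integral>i. cobE (R i) M M h \<partial>measure_pmf p)"
    unfolding cobE_def by (rule pexpM[OF bdd_test_cobE_slices(1)[OF M M h]])
  show ?thesis
    unfolding 1 2 3 by (subst expectation_pair_pmf3[OF bd]) simp
qed

lemma expectation_nat_pmf_sums:
  fixes f :: "nat \<Rightarrow> real"
  assumes "\<And>n. \<bar>f n\<bar> \<le> B"
  shows "(\<lambda>n. pmf p n * f n) sums measure_pmf.expectation p f"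
proof -
  have "integrable (measure_pmf p) f"
    using assms by (intro measure_pmf.integrable_const_bound[where B=B]) auto
  then have "integrable (count_space UNIV) (\<lambda>n. pmf p n * f n)"
    unfolding measure_pmf_eq_density by (subst (asm) integrable_density) auto
  then have "(\<lambda>n. pmf p n * f n) sums (\<integral>n. pmf p n * f n \<partial>count_space UNIV)"
    by (rule sums_integral_count_space_nat)
  also have "(\<integral>n. pmf p n * f n \<partial>count_space UNIV) = measure_pmf.expectation p f"
    unfolding measure_pmf_eq_density by (subst integral_density) auto
  finally show ?thesis .
qed

text \<open>With u = exp (- (\<alpha> + 1) t) and s = 1 - u^2, an expectation under the Wild sum is
  u H(s) for a power series H. As s' = 2 (\<alpha> + 1) u^2, its derivative is - (\<alpha> + 1) u
  H(s) plus (\<alpha> + 1) times 2 u^3 H'(s), and 2 u^3 H'(s) is the expectation after one more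
  branching, by \<open>expectation_wild_split\<close>.\<close>

lemma wild_sum_solution:
  assumes \<alpha>: "\<alpha> \<ge> 0" and \<rho>: "\<rho> \<in> space PP_spin"
  shows "higher_solution \<alpha> (wild_sum \<alpha> \<rho>)" "wild_sum \<alpha> \<rho> 0 = \<rho>"
proof -
  let ?R = "wild \<alpha> \<rho>"
  let ?u = "\<lambda>t. exp (- (\<alpha> + 1) * t)"
  let ?s = "\<lambda>t. 1 - (?u t)\<^sup>2"
  have R: "\<And>n. ?R n \<in> space PP_spin" by (rule wild_in_PP_spin[OF \<rho>])
  have u: "0 < ?u t" "?u t \<le> 1" if "t \<ge> 0" for t using that \<alpha> by (auto intro: mult_nonpos_nonneg)
  have W: "wild_sum \<alpha> \<rho> t \<in> space PP_spin" for t by (rule wild_sum_in_PP_spin[OF \<rho>])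
  have s: "0 \<le> ?s t" "?s t < 1" if "t \<ge> 0" for t using u[OF that] by (auto simp: power_le_one simp del: mult_minus_left)
  show "higher_solution \<alpha> (wild_sum \<alpha> \<rho>)"
    unfolding higher_solution_iff[OF \<alpha>]
  proof (intro conjI allI impI)
    fix t :: real assume "t \<ge> 0" then show "wild_sum \<alpha> \<rho> t \<in> space PP_spin" by (simp add: wild_sum_in_PP_spin \<rho>)
  next
    fix h :: "real \<Rightarrow> real" assume h: "bdd_test h"
    obtain B where B: "B \<ge> 0" "\<And>x. x \<in> {0..1} \<Longrightarrow> \<bar>h x\<bar> \<le> B" using bdd_test_obtain[OF h] by blast
    define F where "F n = pexp (?R n) h" for n
    define G where "G = (\<lambda>(i, j, k). pexp (branch \<alpha> (?R i) (?R j) (?R k)) h)"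
    have FB: "\<bar>F n\<bar> \<le> B" for n unfolding F_def by (rule abs_pexp_le[OF R h B(2)])
    have GB: "\<bar>G x\<bar> \<le> B" for x
      unfolding G_def by (cases x) (auto intro!: abs_pexp_le branch_in_PP_spin R h B)
    define H where "H s = (\<Sum>n. wcoeff n * F n * s ^ n)" for s
    define H' where "H' s = (\<Sum>n. diffs (\<lambda>n. wcoeff n * F n) n * s ^ n)" for s
    have pexp_eq: "pexp (wild_sum \<alpha> \<rho> t) h = ?u t * H (?s t)" if "t \<ge> 0" for t
    proof -
      have "(\<lambda>n. pmf (wild_pmf (?u t)) n * F n) sums pexp (wild_sum \<alpha> \<rho> t) h"
        unfolding wild_sum_def pexp_mixture[OF R h] F_def[symmetric] by (rule expectation_nat_pmf_sums[OF FB])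
      then have "(\<lambda>n. ?u t * (wcoeff n * F n * ?s t ^ n)) sums pexp (wild_sum \<alpha> \<rho> t) h"
        by (simp only: pmf_wild[OF u[OF that]]) (simp add: mult_ac)
      moreover from this have "summable (\<lambda>n. wcoeff n * F n * ?s t ^ n)"
        using u(1)[OF that] by (subst (asm) sums_iff, subst (asm) summable_cmult_iff) auto
      ultimately show ?thesis unfolding H_def by (metis sums_unique suminf_mult)
    qed
    have DH: "(H has_real_derivative H' s) (at s)" if "0 \<le> s" "s < 1" for s
    proof -
      \<comment> \<open>Termwise differentiation at \<open>s\<close> asks for convergence at a point
        of larger modulus; the midpoint of \<open>s\<close> and 1 is one.\<close>
      have "summable (\<lambda>n. wcoeff n * F n * ((1 + s) / 2) ^ n)"
      proof (rule summable_comparison_test'[OF summable_mult[OF summable_geometric]])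
        show "norm ((1 + s) / 2) < 1" using that by simp
        fix n :: nat
        have "\<bar>wcoeff n * F n\<bar> \<le> 1 * B"
          unfolding abs_mult using wcoeff_le_1[of n] wcoeff_pos[of n] FB[of n] by (intro mult_mono) auto
        then show "norm (wcoeff n * F n * ((1 + s) / 2) ^ n) \<le> B * ((1 + s) / 2) ^ n"
          using that by (simp add: abs_mult mult_right_mono)
      qed
      then show ?thesis
        unfolding H_def[abs_def] H'_def by (rule termdiffs_strong) (use that in auto)
    qed
    have H'_eq: "2 * (?u t) ^ 3 * H' (?s t) = pexp (branch \<alpha> (wild_sum \<alpha> \<rho> t) (wild_sum \<alpha> \<rho> t) (wild_sum \<alpha> \<rho> t)) h"
      if t: "t \<ge> 0" for t
    proof -
      let ?W = "wild_pmf (?u t)"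
      have "(\<lambda>n. (?u t) ^ 3 * (2 * (real n + 1) * wcoeff (Suc n) * ?s t ^ n) * measure_pmf.expectation (split_pmf n) G)
        sums measure_pmf.expectation (pair_pmf ?W (pair_pmf ?W ?W)) G"
        by (rule expectation_wild_split[OF u[OF t] GB])
      also have "(\<lambda>n. (?u t) ^ 3 * (2 * (real n + 1) * wcoeff (Suc n) * ?s t ^ n) * measure_pmf.expectation (split_pmf n) G)
        = (\<lambda>n. (2 * (?u t) ^ 3) * (diffs (\<lambda>n. wcoeff n * F n) n * ?s t ^ n))"
        unfolding diffs_def F_def pexp_wild_Suc[OF \<rho> h] G_def[symmetric] by (auto simp: fun_eq_iff)
      finally have S: "(\<lambda>n. (2 * (?u t) ^ 3) * (diffs (\<lambda>n. wcoeff n * F n) n * ?s t ^ n))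
         sums measure_pmf.expectation (pair_pmf ?W (pair_pmf ?W ?W)) G" .
      then have "summable (\<lambda>n. diffs (\<lambda>n. wcoeff n * F n) n * ?s t ^ n)"
        using u(1)[OF t] by (subst (asm) sums_iff, subst (asm) summable_cmult_iff) auto
      then have "2 * (?u t) ^ 3 * H' (?s t) = measure_pmf.expectation (pair_pmf ?W (pair_pmf ?W ?W)) G"
        using suminf_mult[of _ "2 * (?u t) ^ 3"] sums_unique[OF S] unfolding H'_def by (simp only:)
      also have "\<dots> = measure_pmf.expectation (pair_pmf ?W (pair_pmf ?W ?W))
         (\<lambda>x. (\<alpha> * (\<lambda>(i, j, k). cobE (?R i) (?R j) (?R k) h) x + h 0) / (\<alpha> + 1))"
        by (intro Bochner_Integration.integral_cong refl) (simp only: G_def pexp_branch[OF R R R h \<alpha>] split_paired_all prod.case)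
      also have "\<dots> = (\<alpha> * measure_pmf.expectation (pair_pmf ?W (pair_pmf ?W ?W)) (\<lambda>(i, j, k). cobE (?R i) (?R j) (?R k) h) + h 0) / (\<alpha> + 1)"
      proof -
        have "integrable (measure_pmf (pair_pmf ?W (pair_pmf ?W ?W))) (\<lambda>(i, j, k). cobE (?R i) (?R j) (?R k) h)"
          by (intro measure_pmf.integrable_const_bound[where B=B]) (auto intro!: AE_I2 abs_cobE_le R h B)
        then show ?thesis by simp
      qed
      also have "\<dots> = pexp (branch \<alpha> (wild_sum \<alpha> \<rho> t) (wild_sum \<alpha> \<rho> t) (wild_sum \<alpha> \<rho> t)) h"
        by (subst pexp_branch[OF W W W h \<alpha>]) (simp only: wild_sum_def cobE_mixture[OF R h])
      finally show ?thesis .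
    qed
    show "ode_on 0 (\<lambda>t. pexp (wild_sum \<alpha> \<rho> t) h)
       (\<lambda>t. \<alpha> * cobE (wild_sum \<alpha> \<rho> t) (wild_sum \<alpha> \<rho> t) (wild_sum \<alpha> \<rho> t) h + h 0 - (\<alpha> + 1) * pexp (wild_sum \<alpha> \<rho> t) h)"
      unfolding ode_on_def
    proof (intro allI impI)
      fix t :: real assume t: "0 \<le> t"
      let ?r = "wild_sum \<alpha> \<rho> t"
      have "((\<lambda>t. ?u t * H (?s t)) has_real_derivative
          (- (\<alpha> + 1) * ?u t) * H (?s t) + ?u t * (H' (?s t) * (2 * (\<alpha> + 1) * (?u t)\<^sup>2))) (at t within {0..})"
      proof (rule derivative_eq_intros)
        show "((\<lambda>t. H (?s t)) has_real_derivative H' (?s t) * (2 * (\<alpha> + 1) * (?u t)\<^sup>2)) (at t within {0..})"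
          by (rule DERIV_chain2[where f=H and g="\<lambda>t. 1 - (exp (- (\<alpha> + 1) * t))\<^sup>2", OF DH[OF s[OF t]]])
            (auto intro!: derivative_eq_intros simp: power2_eq_square algebra_simps)
        show "(?u has_real_derivative - (\<alpha> + 1) * ?u t) (at t within {0..})"
          by (auto intro!: derivative_eq_intros)
      qed (simp add: algebra_simps)
      moreover have "(- (\<alpha> + 1) * ?u t) * H (?s t) + ?u t * (H' (?s t) * (2 * (\<alpha> + 1) * (?u t)\<^sup>2))
        = \<alpha> * cobE ?r ?r ?r h + h 0 - (\<alpha> + 1) * pexp ?r h"
      proof -
        have "?u t * (H' (?s t) * (2 * (\<alpha> + 1) * (?u t)\<^sup>2)) = (\<alpha> + 1) * (2 * (?u t) ^ 3 * H' (?s t))"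
          by (simp add: power2_eq_square power3_eq_cube)
        also have "\<dots> = \<alpha> * cobE ?r ?r ?r h + h 0"
          using \<alpha> by (simp only: H'_eq[OF t] pexp_branch[OF W W W h \<alpha>]) simp
        finally show ?thesis unfolding pexp_eq[OF t] by (simp add: algebra_simps)
      qed
      ultimately have "((\<lambda>t. ?u t * H (?s t)) has_real_derivative \<alpha> * cobE ?r ?r ?r h + h 0 - (\<alpha> + 1) * pexp ?r h) (at t within {0..})"
        by (simp only:)
      then show "((\<lambda>t. pexp (wild_sum \<alpha> \<rho> t) h) has_real_derivative \<alpha> * cobE ?r ?r ?r h + h 0 - (\<alpha> + 1) * pexp ?r h) (at t within {0..})"
        by (rule has_field_derivative_transform_within[OF _ zero_less_one]) (use t pexp_eq in auto)
    qed
  qed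
  \<comment> \<open>At time 0 the tree is a single leaf.\<close>
  have "wild_pmf 1 = return_pmf 0"
    by (rule pmf_eqI) (auto simp: pmf_wild power_0_left split: split_indicator)
  then show "wild_sum \<alpha> \<rho> 0 = \<rho>"
    using R by (simp add: wild_sum_def return_pmf.rep_eq bind_return[where N=P_spin] space_prob_algebra prob_space_imp_subprob_space space_subprob_algebra)
qed

section \<open>Weak convergence and moments\<close>

text \<open>The whole space is itself a subbasic set, obtained from the zero function and
  \<open>U = UNIV\<close>.\<close>

lemma topspace_weak_topology: "topspace (weak_topology M T) = space (prob_algebra M)"
proof -
  let ?S = "{{\<mu> \<in> space (prob_algebra M). (\<integral>x. f x \<partial>\<mu>) \<in> U} | (f :: 'a \<Rightarrow> real) U.
        continuous_map T euclideanreal f \<and> bounded (f ` topspace T) \<and> open U}"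
  have "bounded ((\<lambda>_. 0 :: real) ` topspace T)" by (auto simp: bounded_iff)
  then have "space (prob_algebra M) \<in> ?S"
    by (intro CollectI exI[of _ "\<lambda>_. 0 :: real"] exI[of _ UNIV]) auto
  then have "\<Union>?S = space (prob_algebra M)" by blast
  then show ?thesis unfolding weak_topology_def by simp
qed

text \<open>Subbasic sets give convergence of the integrals; the converse is an induction on the
  generation of the open sets.\<close>

lemma limitin_weak_topology_iff:
  fixes T :: "'a topology"
  assumes F: "\<forall>\<^sub>F t in F. \<mu> t \<in> space (prob_algebra M)"
  shows "limitin (weak_topology M T) \<mu> L F \<longleftrightarrow> L \<in> space (prob_algebra M) \<and>
    (\<forall>f :: 'a \<Rightarrow> real. continuous_map T euclideanreal f \<and> bounded (f ` topspace T) \<longrightarrow> ((\<lambda>t. \<integral>x. f x \<partial>\<mu> t) \<longlongrightarrow> (\<integral>x. f x \<partial>L)) F)"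
    (is "?l \<longleftrightarrow> ?L \<and> ?r")
proof (intro iffI conjI)
  assume l: ?l
  then show L: ?L using topspace_weak_topology by (metis limitin_topspace)
  show ?r
  proof (intro allI impI topological_tendstoI)
    fix f :: "'a \<Rightarrow> real" and U :: "real set"
    assume f: "continuous_map T euclideanreal f \<and> bounded (f ` topspace T)" and U: "open U" "(\<integral>x. f x \<partial>L) \<in> U"
    have "openin (weak_topology M T) {\<mu> \<in> space (prob_algebra M). (\<integral>x. f x \<partial>\<mu>) \<in> U}"
      unfolding weak_topology_def by (rule topology_generated_by_Basis) (use f U in blast)
    then have "\<forall>\<^sub>F t in F. \<mu> t \<in> {\<mu> \<in> space (prob_algebra M). (\<integral>x. f x \<partial>\<mu>) \<in> U}"
      using l L U unfolding limitin_def by blast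
    then show "\<forall>\<^sub>F t in F. (\<integral>x. f x \<partial>\<mu> t) \<in> U" by eventually_elim auto
  qed
next
  assume Lr: "?L \<and> ?r"
  show ?l unfolding limitin_def topspace_weak_topology
  proof (intro conjI allI impI)
    show "L \<in> space (prob_algebra M)" using Lr by blast
    fix U assume U: "openin (weak_topology M T) U \<and> L \<in> U"
    have "L \<in> U \<longrightarrow> (\<forall>\<^sub>F t in F. \<mu> t \<in> U)"
      using openin_topology_generated_by[OF U[THEN conjunct1, unfolded weak_topology_def]]
    proof (induction rule: generate_topology_on.induct)
      case (Int a b) then show ?case by (auto intro: eventually_conj)
    next
      case (UN K)
      show ?case
      proof
        assume "L \<in> \<Union>K"
        then obtain X where X: "X \<in> K" "L \<in> X" by blast
        then have "\<forall>\<^sub>F t in F. \<mu> t \<in> X" using UN by blast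
        then show "\<forall>\<^sub>F t in F. \<mu> t \<in> \<Union>K" by eventually_elim (use X in blast)
      qed
    next
      case (Basis s)
      then obtain f V where s: "s = {\<mu> \<in> space (prob_algebra M). (\<integral>x. f x \<partial>\<mu>) \<in> V}"
        and f: "continuous_map T euclideanreal f" "bounded (f ` topspace T)" and V: "open V" by blast
      show ?case
      proof
        assume "L \<in> s"
        then have "\<forall>\<^sub>F t in F. (\<integral>x. f x \<partial>\<mu> t) \<in> V"
          using Lr f V s by (auto dest: topological_tendstoD)
        then show "\<forall>\<^sub>F t in F. \<mu> t \<in> s" using F by eventually_elim (simp add: s)
      qed
    qed simp
    then show "\<forall>\<^sub>F t in F. \<mu> t \<in> U" using U by blast
  qed
qed

text \<open>The integral of a function on two points is affine in the clipped parameter.\<close>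

lemma continuous_map_bern: "continuous_map euclideanreal P_top bern"
  unfolding weak_topology_def
proof (rule continuous_on_generated_topo)
  fix A assume "A \<in> {{\<mu> \<in> space P_spin. (\<integral>x. f x \<partial>\<mu>) \<in> U} | (f :: bool \<Rightarrow> real) U.
     continuous_map (discrete_topology UNIV) euclideanreal f \<and> bounded (f ` topspace (discrete_topology UNIV)) \<and> open U}"
  then obtain f :: "bool \<Rightarrow> real" and U where A: "A = {\<mu> \<in> space P_spin. (\<integral>x. f x \<partial>\<mu>) \<in> U}" and U: "open U" by blast
  have "(\<integral>x. f x \<partial>bern p) = f True * max 0 (min 1 p) + f False * (1 - max 0 (min 1 p))" for p
  proof -
    have "bernoulli_pmf p = bernoulli_pmf (max 0 (min 1 p))"
      by (rule pmf_eqI) (simp add: bernoulli_pmf.rep_eq max_def min_def)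
    then show ?thesis by simp
  qed
  then have "bern -` A \<inter> topspace euclideanreal = (\<lambda>p. f True * max 0 (min 1 p) + f False * (1 - max 0 (min 1 p))) -` U"
    by (auto simp: A)
  then show "openin euclideanreal (bern -` A \<inter> topspace euclideanreal)"
    using U by (auto intro!: open_vimage continuous_intros)
next
  show "bern ` topspace euclideanreal \<subseteq> \<Union> {{\<mu> \<in> space P_spin. (\<integral>x. f x \<partial>\<mu>) \<in> U} | (f :: bool \<Rightarrow> real) U.
     continuous_map (discrete_topology UNIV) euclideanreal f \<and> bounded (f ` topspace (discrete_topology UNIV)) \<and> open U}"
    unfolding topspace_weak_topology[of spin "discrete_topology UNIV", unfolded weak_topology_def topology_generated_by_topspace]
    by (rule image_subsetI) (rule bern_in_P_spin)
qed

lemma continuous_map_p1: "continuous_map P_top euclideanreal p1"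
proof -
  have eq: "p1 \<mu> = (\<integral>x. indicator {True} x \<partial>\<mu>)" if "\<mu> \<in> space P_spin" for \<mu>
    using that sets_eq_imp_space_eq[of \<mu> spin] by (simp add: in_P_spin)
  show ?thesis
    unfolding continuous_map_alt
  proof (intro conjI allI impI)
    show "p1 \<in> topspace P_top \<rightarrow> topspace euclideanreal" by (rule Pi_I) (simp only: topspace_euclidean UNIV_I)
    fix U :: "real set" assume "openin euclideanreal U"
    then have U: "open U" by simp
    have "p1 -` U \<inter> topspace P_top = {\<mu> \<in> space P_spin. (\<integral>x. indicator {True} x \<partial>\<mu>) \<in> U}"
      unfolding topspace_weak_topology using eq by auto
    moreover have "openin P_top {\<mu> \<in> space P_spin. (\<integral>x. (indicator {True} x :: real) \<partial>\<mu>) \<in> U}"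
      unfolding weak_topology_def
    proof (rule topology_generated_by_Basis, intro CollectI exI conjI)
      show "bounded ((indicator {True} :: bool \<Rightarrow> real) ` topspace (discrete_topology UNIV))"
        by (rule finite_imp_bounded) simp
    qed (use U in auto)
    ultimately show "openin P_top (p1 -` U \<inter> topspace P_top)" by (simp only:)
  qed
qed

text \<open>By Weierstrass, a polynomial within \<open>e / 3\<close> of \<open>h\<close> on the unit
  interval reduces the claim to finitely many moments.\<close>

lemma tendsto_pexp_of_moments:
  assumes \<rho>: "\<forall>\<^sub>F t in F. \<rho> t \<in> space PP_spin" and L: "L \<in> space PP_spin"
    and m: "\<And>n. ((\<lambda>t. pexp (\<rho> t) (\<lambda>x. x ^ n)) \<longlongrightarrow> pexp L (\<lambda>x. x ^ n)) F"
    and h: "continuous_on UNIV h"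
  shows "((\<lambda>t. pexp (\<rho> t) h) \<longlongrightarrow> pexp L h) F"
proof (rule tendstoI)
  fix e :: real assume e: "e > 0"
  have hb: "bdd_test h" by (rule bdd_test_continuous_UNIV[OF h])
  have "continuous_on {0..1} h" using h continuous_on_subset by blast
  then obtain g where g: "real_polynomial_function g" "\<And>x. x \<in> {0..1} \<Longrightarrow> \<bar>h x - g x\<bar> < e / 3"
    using Stone_Weierstrass_real_polynomial_function[of "{0..1::real}" h "e / 3"] e by auto
  then obtain a n where ga: "g = (\<lambda>x. \<Sum>i\<le>n. a i * x ^ i)" unfolding real_polynomial_function_iff_sum by blast
  have gb: "bdd_test g" unfolding ga by (intro bdd_test_continuous_UNIV continuous_intros)
  have Eg: "pexp \<sigma> g = (\<Sum>i\<le>n. a i * pexp \<sigma> (\<lambda>x. x ^ i))" if "\<sigma> \<in> space PP_spin" for \<sigma>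
    unfolding ga by (subst pexp_sum[OF that]) (auto intro!: bdd_test_cmult)
  have near: "\<bar>pexp \<sigma> h - pexp \<sigma> g\<bar> \<le> e / 3" if "\<sigma> \<in> space PP_spin" for \<sigma>
    unfolding pexp_diff[OF that hb gb, symmetric]
  proof (rule abs_pexp_le[OF that])
    show "bdd_test (\<lambda>x. h x - g x)" using bdd_test_add[OF hb bdd_test_cmult[OF gb, of "-1"]] by simp
  qed (use g(2) in \<open>auto intro: less_imp_le\<close>)
  have "((\<lambda>t. \<Sum>i\<le>n. a i * pexp (\<rho> t) (\<lambda>x. x ^ i)) \<longlongrightarrow> (\<Sum>i\<le>n. a i * pexp L (\<lambda>x. x ^ i))) F"
    by (intro tendsto_intros m)
  then have "\<forall>\<^sub>F t in F. dist (\<Sum>i\<le>n. a i * pexp (\<rho> t) (\<lambda>x. x ^ i)) (\<Sum>i\<le>n. a i * pexp L (\<lambda>x. x ^ i)) < e / 3"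
    using e by (intro tendstoD) auto
  with \<rho> show "\<forall>\<^sub>F t in F. dist (pexp (\<rho> t) h) (pexp L h) < e"
  proof eventually_elim
    case (elim t)
    then have "\<bar>pexp (\<rho> t) g - pexp L g\<bar> < e / 3" by (simp only: Eg L dist_real_def)
    then show ?case using near[OF elim(1)] near[OF L] unfolding dist_real_def by linarith
  qed
qed

text \<open>Powers of \<open>p1\<close> are bounded continuous test functions. Conversely,
  \<open>bern\<close> turns a continuous test function on \<open>P_top\<close> into a continuous
  function on the real line, which the moments control.\<close>

lemma limitin_PP_top_moments:
  assumes \<rho>: "\<forall>\<^sub>F t in F. \<rho> t \<in> space PP_spin" and L: "L \<in> space PP_spin"
  shows "limitin PP_top \<rho> L F \<longleftrightarrow> (\<forall>n. ((\<lambda>t. pexp (\<rho> t) (\<lambda>x. x ^ n)) \<longlongrightarrow> pexp L (\<lambda>x. x ^ n)) F)"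
  unfolding limitin_weak_topology_iff[OF \<rho>]
proof safe
  fix n :: nat
  assume r: "\<forall>f. continuous_map P_top euclideanreal f \<and> bounded (f ` topspace P_top) \<longrightarrow> ((\<lambda>t. \<integral>x. f x \<partial>\<rho> t) \<longlongrightarrow> (\<integral>x. f x \<partial>L)) F"
  have "continuous_map P_top euclideanreal (\<lambda>\<mu>. p1 \<mu> ^ n)"
    by (intro continuous_map_real_pow continuous_map_p1)
  moreover have "bounded ((\<lambda>\<mu>. p1 \<mu> ^ n) ` topspace P_top)"
    unfolding topspace_weak_topology bounded_iff using p1_bounds by (auto intro!: exI[of _ 1] power_le_one)
  ultimately have "((\<lambda>t. \<integral>\<mu>. p1 \<mu> ^ n \<partial>\<rho> t) \<longlongrightarrow> (\<integral>\<mu>. p1 \<mu> ^ n \<partial>L)) F" using r by blast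
  then show "((\<lambda>t. pexp (\<rho> t) (\<lambda>x. x ^ n)) \<longlongrightarrow> pexp L (\<lambda>x. x ^ n)) F" unfolding pexp_def .
next
  fix f :: "bool measure \<Rightarrow> real"
  assume m: "\<forall>n. ((\<lambda>t. pexp (\<rho> t) (\<lambda>x. x ^ n)) \<longlongrightarrow> pexp L (\<lambda>x. x ^ n)) F" and f: "continuous_map P_top euclideanreal f"
  have "continuous_map euclideanreal euclideanreal (f \<circ> bern)"
    by (rule continuous_map_compose[OF continuous_map_bern f])
  then have c: "continuous_on UNIV (\<lambda>x. f (bern x))" by (simp add: o_def)
  have "((\<lambda>t. pexp (\<rho> t) (\<lambda>x. f (bern x))) \<longlongrightarrow> pexp L (\<lambda>x. f (bern x))) F"
    by (rule tendsto_pexp_of_moments[OF \<rho> L _ c]) (use m in blast)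
  moreover have "\<forall>\<^sub>F t in F. pexp (\<rho> t) (\<lambda>x. f (bern x)) = (\<integral>x. f x \<partial>\<rho> t)"
    using \<rho> by eventually_elim (simp add: integral_eq_pexp)
  ultimately show "((\<lambda>t. \<integral>x. f x \<partial>\<rho> t) \<longlongrightarrow> (\<integral>x. f x \<partial>L)) F"
    using integral_eq_pexp[OF L, of f] by (simp add: tendsto_cong)
qed (rule L)

text \<open>Determinacy of the moment problem on a compact interval: moments determine the
  expectations of sines and cosines, hence the characteristic function of the law of
  \<open>p1\<close>. Levy's theorem identifies that law, and \<open>bern\<close> recovers the
  original measure from it.\<close>

lemma PP_spin_eqI:
  assumes \<rho>: "\<rho> \<in> space PP_spin" and \<sigma>: "\<sigma> \<in> space PP_spin" and m: "\<And>n. pexp \<rho> (\<lambda>x. x ^ n) = pexp \<sigma> (\<lambda>x. x ^ n)"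
  shows "\<rho> = \<sigma>"
proof -
  have eq: "pexp \<rho> h = pexp \<sigma> h" if "continuous_on UNIV h" for h
  proof -
    \<comment> \<open>The convergence lemma is applied to a constant sequence.\<close>
    have "((\<lambda>_::nat. pexp \<rho> h) \<longlongrightarrow> pexp \<sigma> h) sequentially"
      by (rule tendsto_pexp_of_moments[OF _ \<sigma> _ that]) (use \<rho> m in auto)
    then show ?thesis by (simp add: LIMSEQ_const_iff)
  qed
  let ?D = "\<lambda>\<rho>. distr \<rho> borel p1"
  have mp1: "p1 \<in> \<tau> \<rightarrow>\<^sub>M borel" if "\<tau> \<in> space PP_spin" for \<tau>
    using measurable_p1 PP_spinD(2)[OF that] measurable_cong_sets by blast
  have rd: "real_distribution (?D \<tau>)" if "\<tau> \<in> space PP_spin" for \<tau>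
    using prob_space.real_distribution_distr[OF PP_spinD(1)[OF that]] mp1[OF that] by simp
  have ch: "char (?D \<tau>) t = Complex (pexp \<tau> (\<lambda>x. cos (t * x))) (pexp \<tau> (\<lambda>x. sin (t * x)))" if \<tau>: "\<tau> \<in> space PP_spin" for \<tau> t
  proof -
    interpret real_distribution "?D \<tau>" by (rule rd[OF \<tau>])
    have i: "integrable (?D \<tau>) (\<lambda>x. iexp (t * x))" by (rule integrable_iexp) auto
    have "Re (char (?D \<tau>) t) = (\<integral>x. cos (t * x) \<partial>?D \<tau>)" "Im (char (?D \<tau>) t) = (\<integral>x. sin (t * x) \<partial>?D \<tau>)"
      unfolding char_def using integral_Re[OF i] integral_Im[OF i] by (simp_all add: Re_exp Im_exp)
    moreover have "(\<integral>x. cos (t * x) \<partial>?D \<tau>) = pexp \<tau> (\<lambda>x. cos (t * x))" "(\<integral>x. sin (t * x) \<partial>?D \<tau>) = pexp \<tau> (\<lambda>x. sin (t * x))"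
      unfolding pexp_def by (subst integral_distr[OF mp1[OF \<tau>]]; simp)+
    ultimately show ?thesis by (simp add: complex_eq_iff)
  qed
  have "char (?D \<rho>) = char (?D \<sigma>)"
    by (rule ext) (simp add: ch[OF \<rho>] ch[OF \<sigma>] eq continuous_intros)
  then have D: "?D \<rho> = ?D \<sigma>" by (rule Levy_uniqueness[OF rd[OF \<rho>] rd[OF \<sigma>]])
  have rec: "distr (?D \<tau>) P_spin bern = \<tau>" if \<tau>: "\<tau> \<in> space PP_spin" for \<tau>
  proof -
    have "distr (?D \<tau>) P_spin bern = distr \<tau> P_spin (bern \<circ> p1)"
      by (rule distr_distr[OF measurable_bern mp1[OF \<tau>]])
    also have "\<dots> = distr \<tau> \<tau> (\<lambda>x. x)"
      by (rule distr_cong) (use PP_spinD[OF \<tau>] in auto)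
    finally show ?thesis by simp
  qed
  have "\<rho> = distr (?D \<rho>) P_spin bern" by (rule rec[OF \<rho>, symmetric])
  also have "\<dots> = \<sigma>" unfolding D by (rule rec[OF \<sigma>])
  finally show ?thesis .
qed

lemma limitin_PP_top_unique:
  fixes \<rho> :: "real \<Rightarrow> bool measure measure"
  assumes "limitin PP_top \<rho> L at_top" "limitin PP_top \<rho> L' at_top" "\<And>t. t \<ge> 0 \<Longrightarrow> \<rho> t \<in> space PP_spin"
  shows "L = L'"
proof -
  have e: "\<forall>\<^sub>F t in at_top. \<rho> t \<in> space PP_spin"
    using eventually_ge_at_top[of 0] by eventually_elim (rule assms(3))
  have L: "L \<in> space PP_spin" "L' \<in> space PP_spin"
    using assms(1,2) topspace_weak_topology by (metis limitin_topspace)+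
  show ?thesis
  proof (rule PP_spin_eqI[OF L])
    fix n :: nat
    have "((\<lambda>t. pexp (\<rho> t) (\<lambda>x. x ^ n)) \<longlongrightarrow> pexp L (\<lambda>x. x ^ n)) at_top"
      using assms(1) limitin_PP_top_moments[OF e L(1)] by blast
    moreover have "((\<lambda>t. pexp (\<rho> t) (\<lambda>x. x ^ n)) \<longlongrightarrow> pexp L' (\<lambda>x. x ^ n)) at_top"
      using assms(2) limitin_PP_top_moments[OF e L(2)] by blast
    ultimately show "pexp L (\<lambda>x. x ^ n) = pexp L' (\<lambda>x. x ^ n)"
      by (rule tendsto_unique[OF trivial_limit_at_top_linorder])
  qed
qed

section \<open>The first two moments of a solution\<close>

abbreviation mean1 :: "bool measure measure \<Rightarrow> real" where
  "mean1 \<rho> \<equiv> pexp \<rho> (\<lambda>x. x)"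

abbreviation mean2 :: "bool measure measure \<Rightarrow> real" where
  "mean2 \<rho> \<equiv> pexp \<rho> (\<lambda>x. x\<^sup>2)"

lemma pexp_quadratic:
  assumes "\<rho> \<in> space PP_spin"
  shows "pexp \<rho> (\<lambda>x. a + b * x + c * x\<^sup>2) = a + b * mean1 \<rho> + c * mean2 \<rho>"
proof -
  have "pexp \<rho> (\<lambda>x. a + b * x + c * x\<^sup>2) = pexp \<rho> (\<lambda>x. a + b * x) + pexp \<rho> (\<lambda>x. c * x\<^sup>2)"
    by (intro pexp_add assms bdd_test_add bdd_test_cmult bdd_test_polys)
  also have "pexp \<rho> (\<lambda>x. a + b * x) = pexp \<rho> (\<lambda>x. a) + pexp \<rho> (\<lambda>x. b * x)"
    by (intro pexp_add assms bdd_test_cmult bdd_test_polys)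
  finally show ?thesis by (simp add: assms)
qed

lemma mean1_bounds: "\<rho> \<in> space PP_spin \<Longrightarrow> 0 \<le> mean1 \<rho>" "\<rho> \<in> space PP_spin \<Longrightarrow> mean1 \<rho> \<le> 1"
  using pexp_mono[of \<rho> "\<lambda>x. 0" "\<lambda>x. x"] pexp_mono[of \<rho> "\<lambda>x. x" "\<lambda>x. 1"] by auto

lemma mean2_le_mean1: "\<rho> \<in> space PP_spin \<Longrightarrow> mean2 \<rho> \<le> mean1 \<rho>"
  by (intro pexp_mono bdd_test_polys) (auto simp: power2_eq_square mult_left_le)

lemma mean1_squared_le: 
  assumes "\<rho> \<in> space PP_spin" shows "(mean1 \<rho>)\<^sup>2 \<le> mean2 \<rho>"
proof -
  let ?m = "mean1 \<rho>"
  have "0 \<le> pexp \<rho> (\<lambda>x. (x - ?m)\<^sup>2)"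
  proof -
    have "bdd_test (\<lambda>x. (x - ?m)\<^sup>2)" by (intro bdd_test_continuous_UNIV continuous_intros)
    then show ?thesis using pexp_mono[OF assms, of "\<lambda>_. 0" "\<lambda>x. (x - ?m)\<^sup>2"] assms by simp
  qed
  also have "pexp \<rho> (\<lambda>x. (x - ?m)\<^sup>2) = pexp \<rho> (\<lambda>x. ?m\<^sup>2 + (- 2 * ?m) * x + 1 * x\<^sup>2)"
    by (intro pexp_cong assms) (simp add: power2_eq_square algebra_simps)
  also have "\<dots> = mean2 \<rho> - ?m\<^sup>2" unfolding pexp_quadratic[OF assms] by (simp add: power2_eq_square)
  finally show ?thesis by simp
qed

lemma cobE_mean1:
  assumes "\<rho> \<in> space PP_spin"
  shows "cobE \<rho> \<rho> \<rho> (\<lambda>x. x) = mean1 \<rho> + (1 - mean1 \<rho>) * (mean1 \<rho>)\<^sup>2"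
proof -
  let ?m = "mean1 \<rho>"
  have "pexp \<rho> (\<lambda>z. cob_poly x y z) = x + (1 - x) * y * ?m" for x y
    using pexp_quadratic[OF assms, of x "(1 - x) * y" 0] by simp
  moreover have "pexp \<rho> (\<lambda>y. x + (1 - x) * y * ?m) = x + (1 - x) * ?m * ?m" for x
    using pexp_quadratic[OF assms, of x "(1 - x) * ?m" 0] by (simp add: mult_ac)
  moreover have "pexp \<rho> (\<lambda>x. x + (1 - x) * ?m * ?m) = ?m + (1 - ?m) * ?m\<^sup>2"
    using pexp_quadratic[OF assms, of "?m\<^sup>2" "1 - ?m\<^sup>2" 0] by (simp add: power2_eq_square algebra_simps)
  ultimately show ?thesis unfolding cobE_def by simp
qed

lemma cobE_mean2:
  assumes "\<rho> \<in> space PP_spin"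
  shows "cobE \<rho> \<rho> \<rho> (\<lambda>x. x\<^sup>2) = (mean2 \<rho>)\<^sup>2 + (2 * (mean1 \<rho>)\<^sup>2 - 2 * (mean2 \<rho>)\<^sup>2) * mean1 \<rho>
     + (1 - 2 * (mean1 \<rho>)\<^sup>2 + (mean2 \<rho>)\<^sup>2) * mean2 \<rho>"
proof -
  let ?m = "mean1 \<rho>" and ?s = "mean2 \<rho>"
  have "pexp \<rho> (\<lambda>z. (cob_poly x y z)\<^sup>2) = x\<^sup>2 + (2 * x * (1 - x) * ?m) * y + ((1 - x)\<^sup>2 * ?s) * y\<^sup>2" for x y
  proof -
    have "(\<lambda>z. (cob_poly x y z)\<^sup>2) = (\<lambda>z. x\<^sup>2 + (2 * x * (1 - x) * y) * z + ((1 - x)\<^sup>2 * y\<^sup>2) * z\<^sup>2)"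
      by (auto simp: power2_eq_square algebra_simps)
    then show ?thesis by (simp only: pexp_quadratic[OF assms]) (simp add: mult_ac)
  qed
  moreover have "x\<^sup>2 + (2 * x * (1 - x) * ?m) * ?m + ((1 - x)\<^sup>2 * ?s) * ?s
      = ?s\<^sup>2 + (2 * ?m\<^sup>2 - 2 * ?s\<^sup>2) * x + (1 - 2 * ?m\<^sup>2 + ?s\<^sup>2) * x\<^sup>2" for x
    by (simp add: power2_eq_square algebra_simps)
  ultimately show ?thesis unfolding cobE_def by (simp only: pexp_quadratic[OF assms])
qed

text \<open>For given mean m it lies between 0, attained only by the law of a random Dirac measure,
  and m (1 - m), attained by a point mass.\<close>

definition fluct :: "bool measure measure \<Rightarrow> real" where
  "fluct \<rho> = mean1 \<rho> - mean2 \<rho>"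

lemma fluct_nonneg: "\<rho> \<in> space PP_spin \<Longrightarrow> 0 \<le> fluct \<rho>"
  using mean2_le_mean1 by (simp add: fluct_def)

lemma fluct_le: "\<rho> \<in> space PP_spin \<Longrightarrow> fluct \<rho> \<le> mean1 \<rho> * (1 - mean1 \<rho>)"
  using mean1_squared_le[of \<rho>] by (simp add: fluct_def power2_eq_square algebra_simps)

lemma mean_ode:
  assumes "\<alpha> \<ge> 0" "higher_solution \<alpha> \<rho>"
  shows "ode_on 0 (\<lambda>t. mean1 (\<rho> t)) (\<lambda>t. \<alpha> * (mean1 (\<rho> t))\<^sup>2 * (1 - mean1 (\<rho> t)) - mean1 (\<rho> t))"
proof (rule ode_on_cong)
  show "ode_on 0 (\<lambda>t. mean1 (\<rho> t)) (\<lambda>t. \<alpha> * cobE (\<rho> t) (\<rho> t) (\<rho> t) (\<lambda>x. x) + 0 - (\<alpha> + 1) * mean1 (\<rho> t))"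
    using assms(2) unfolding higher_solution_iff[OF assms(1)] by auto
  show "\<alpha> * cobE (\<rho> t) (\<rho> t) (\<rho> t) (\<lambda>x. x) + 0 - (\<alpha> + 1) * mean1 (\<rho> t) = \<alpha> * (mean1 (\<rho> t))\<^sup>2 * (1 - mean1 (\<rho> t)) - mean1 (\<rho> t)"
    if "0 \<le> t" for t
    using assms(2) that unfolding higher_solution_iff[OF assms(1)] by (simp add: cobE_mean1 algebra_simps)
qed

lemma fluct_ode:
  assumes "\<alpha> \<ge> 0" "higher_solution \<alpha> \<rho>"
  defines "m \<equiv> \<lambda>t. mean1 (\<rho> t)" and "v \<equiv> \<lambda>t. fluct (\<rho> t)"
  shows "ode_on 0 v (\<lambda>t. v t * (\<alpha> * (2 * m t - 3 * (m t)\<^sup>2 - v t * (1 + m t) + (v t)\<^sup>2) - 1))"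
proof (rule ode_on_cong)
  let ?s = "\<lambda>t. mean2 (\<rho> t)"
  let ?D = "\<lambda>t. \<alpha> * cobE (\<rho> t) (\<rho> t) (\<rho> t) (\<lambda>x. x\<^sup>2) + 0\<^sup>2 - (\<alpha> + 1) * ?s t"
  have "ode_on 0 ?s ?D"
    using assms(2) unfolding higher_solution_iff[OF assms(1)] by blast
  from ode_on_diff[OF mean_ode[OF assms(1,2)] this]
  show "ode_on 0 v (\<lambda>t. \<alpha> * (m t)\<^sup>2 * (1 - m t) - m t - ?D t)" unfolding v_def m_def fluct_def .
  show "\<alpha> * (m t)\<^sup>2 * (1 - m t) - m t - ?D t = v t * (\<alpha> * (2 * m t - 3 * (m t)\<^sup>2 - v t * (1 + m t) + (v t)\<^sup>2) - 1)"
    if "0 \<le> t" for t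
  proof -
    have P: "\<rho> t \<in> space PP_spin" using assms(2) that unfolding higher_solution_iff[OF assms(1)] by simp
    have s: "mean2 (\<rho> t) = m t - v t" by (simp add: m_def v_def fluct_def)
    have m: "mean1 (\<rho> t) = m t" by (simp add: m_def)
    show ?thesis unfolding cobE_mean2[OF P] s m by (simp add: power2_eq_square) (simp add: algebra_simps)
  qed
qed

lemma higher_solution_in_space: "higher_solution \<alpha> \<rho> \<Longrightarrow> t \<ge> 0 \<Longrightarrow> \<rho> t \<in> space PP_spin"
  by (simp add: higher_solution_def)

lemma eventually_in_space: "higher_solution \<alpha> \<rho> \<Longrightarrow> \<forall>\<^sub>F t in at_top. \<rho> t \<in> space PP_spin"
  using eventually_ge_at_top[of "0::real"] by eventually_elim (simp add: higher_solution_in_space)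

section \<open>Vanishing fluctuation and laws of random Dirac measures\<close>

lemma nu_over_in_PP_spin: "nu_over (bern z) \<in> space PP_spin"
proof -
  have "return spin \<in> bern z \<rightarrow>\<^sub>M P_spin" by (simp add: space_prob_algebra prob_space_return)
  then show ?thesis unfolding nu_over_def in_PP_spin
    by (simp add: prob_space.prob_space_distr prob_space_measure_pmf)
qed

lemma pexp_nu_over:
  assumes z: "0 \<le> z" "z \<le> 1" and h: "bdd_test h"
  shows "pexp (nu_over (bern z)) h = z * h 1 + (1 - z) * h 0"
proof -
  have m: "return spin \<in> bern z \<rightarrow>\<^sub>M P_spin" by (simp add: space_prob_algebra prob_space_return)
  have [measurable]: "h \<in> borel_measurable borel" using h by (simp add: bdd_test_def)
  have "pexp (nu_over (bern z)) h = (\<integral>b. h (p1 (return spin b)) \<partial>bern z)"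
    unfolding pexp_def nu_over_def by (rule integral_distr[OF m]) measurable
  also have "\<dots> = z * h 1 + (1 - z) * h 0"
    using z by (simp add: measure_return mult.commute)
  finally show ?thesis .
qed

lemma fluct_nu_over: "0 \<le> z \<Longrightarrow> z \<le> 1 \<Longrightarrow> fluct (nu_over (bern z)) = 0"
  and mean1_nu_over: "0 \<le> z \<Longrightarrow> z \<le> 1 \<Longrightarrow> mean1 (nu_over (bern z)) = z"
  by (simp_all add: fluct_def pexp_nu_over)

text \<open>Bernoulli's inequality bounds x - x^(n + 1) by n x (1 - x). So all moments of positive
  order collapse to the mean when the fluctuation vanishes.\<close>

lemma moment_near_mean:
  assumes "\<rho> \<in> space PP_spin"
  shows "\<bar>pexp \<rho> (\<lambda>x. x ^ Suc n) - mean1 \<rho>\<bar> \<le> real n * fluct \<rho>"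
proof -
  have pw: "0 \<le> x - x ^ Suc n \<and> x - x ^ Suc n \<le> real n * x + (- real n) * x\<^sup>2" if "x \<in> {0..1}" for x :: real
  proof -
    have "1 + real n * (x - 1) \<le> (1 + (x - 1)) ^ n" by (rule Bernoulli_inequality) (use that in auto)
    then have "x * (1 - x ^ n) \<le> x * (real n * (1 - x))" using that by (intro mult_left_mono) (auto simp: algebra_simps)
    moreover have "0 \<le> x * (1 - x ^ n)" using that by (auto simp: power_le_one)
    ultimately show ?thesis by (simp add: power2_eq_square algebra_simps)
  qed
  have t: "bdd_test (\<lambda>x. x - x ^ Suc n)" "bdd_test (\<lambda>x. real n * x + (- real n) * x\<^sup>2)"
    by (auto intro!: bdd_test_continuous_UNIV continuous_intros)
  have d: "pexp \<rho> (\<lambda>x. x - x ^ Suc n) = mean1 \<rho> - pexp \<rho> (\<lambda>x. x ^ Suc n)"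
    by (intro pexp_diff assms bdd_test_polys)
  have "0 \<le> pexp \<rho> (\<lambda>x. x - x ^ Suc n)"
    using pexp_mono[OF assms _ t(1), of "\<lambda>_. 0"] pw assms by auto
  moreover have "pexp \<rho> (\<lambda>x. x - x ^ Suc n) \<le> pexp \<rho> (\<lambda>x. real n * x + (- real n) * x\<^sup>2)"
    using pw by (intro pexp_mono assms t) auto
  moreover have "pexp \<rho> (\<lambda>x. real n * x + (- real n) * x\<^sup>2) = real n * fluct \<rho>"
    using pexp_quadratic[OF assms, of 0 "real n" "- real n"] by (simp add: fluct_def algebra_simps)
  ultimately show ?thesis using d by simp
qed

text \<open>All moments of positive order of the limit equal \<open>z\<close>, so
  \<open>moment_near_mean\<close> applies; order 0 is treated separately.\<close>

lemma limitin_nu_over: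
  assumes sol: "higher_solution \<alpha> \<rho>" and z: "0 \<le> z" "z \<le> 1"
    and m: "((\<lambda>t. mean1 (\<rho> t)) \<longlongrightarrow> z) at_top" and v: "((\<lambda>t. fluct (\<rho> t)) \<longlongrightarrow> 0) at_top"
  shows "limitin PP_top \<rho> (nu_over (bern z)) at_top"
  unfolding limitin_PP_top_moments[OF eventually_in_space[OF sol] nu_over_in_PP_spin]
proof
  fix n
  show "((\<lambda>t. pexp (\<rho> t) (\<lambda>x. x ^ n)) \<longlongrightarrow> pexp (nu_over (bern z)) (\<lambda>x. x ^ n)) at_top"
  proof (cases n)
    case 0
    have "\<forall>\<^sub>F t in at_top. pexp (\<rho> t) (\<lambda>x. x ^ n) = 1"
      using eventually_in_space[OF sol] by eventually_elim (simp add: 0)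
    then show ?thesis using z by (simp add: pexp_nu_over 0 tendsto_eventually)
  next
    case (Suc k)
    have "((\<lambda>t. pexp (\<rho> t) (\<lambda>x. x ^ n) - mean1 (\<rho> t)) \<longlongrightarrow> 0) at_top"
    proof (rule Lim_null_comparison)
      show "\<forall>\<^sub>F t in at_top. norm (pexp (\<rho> t) (\<lambda>x. x ^ n) - mean1 (\<rho> t)) \<le> real k * fluct (\<rho> t)"
        using eventually_in_space[OF sol] by eventually_elim (use moment_near_mean[of _ k] Suc in simp)
      show "((\<lambda>t. real k * fluct (\<rho> t)) \<longlongrightarrow> 0) at_top" using tendsto_mult_left[OF v, of "real k"] by simp
    qed
    from tendsto_add[OF this m] show ?thesis using pexp_nu_over[OF z bdd_test_polys(3)[of n]] Suc by simp
  qed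
qed

lemma limitin_nu_low:
  assumes sol: "higher_solution \<alpha> \<rho>" and m: "((\<lambda>t. mean1 (\<rho> t)) \<longlongrightarrow> 0) at_top"
  shows "limitin PP_top \<rho> (nu_over nu_low) at_top"
  unfolding nu_low_def z_low_def
proof (rule limitin_nu_over[OF sol])
  show "((\<lambda>t. fluct (\<rho> t)) \<longlongrightarrow> 0) at_top"
  proof (rule Lim_null_comparison[OF _ m])
    show "\<forall>\<^sub>F t in at_top. norm (fluct (\<rho> t)) \<le> mean1 (\<rho> t)"
      using eventually_in_space[OF sol]
    proof eventually_elim
      case (elim t)
      have "mean1 (\<rho> t) * (1 - mean1 (\<rho> t)) \<le> mean1 (\<rho> t)"
        using mean1_bounds[OF elim] by (simp add: mult_left_le)
      then show ?case using fluct_le[OF elim] fluct_nonneg[OF elim] by simp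
    qed
  qed
qed (use m in auto)

text \<open>The hypothesis on \<open>z\<close> says that v = 0 is not linearly unstable when the
  mean m sits at its limit. Since v is at most m, the cubic term is absorbed and a damping of at
  least \<alpha> v^2 remains, which also covers the marginal case of equality.\<close>

lemma fluct_tendsto_0:
  assumes \<alpha>: "\<alpha> > 0" and sol: "higher_solution \<alpha> \<rho>"
    and m: "((\<lambda>t. mean1 (\<rho> t)) \<longlongrightarrow> z) at_top" and z: "\<alpha> * (2 * z - 3 * z\<^sup>2) \<le> 1"
  shows "((\<lambda>t. fluct (\<rho> t)) \<longlongrightarrow> 0) at_top"
proof (rule tendsto_zero_of_riccati[OF fluct_ode[OF less_imp_le[OF \<alpha>] sol]])
  show "0 \<le> fluct (\<rho> t)" if "0 \<le> t" for t using fluct_nonneg higher_solution_in_space[OF sol that] .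
  let ?m = "\<lambda>t. mean1 (\<rho> t)" and ?v = "\<lambda>t. fluct (\<rho> t)"
  show "?v t * (\<alpha> * (2 * ?m t - 3 * (?m t)\<^sup>2 - ?v t * (1 + ?m t) + (?v t)\<^sup>2) - 1)
     \<le> ?v t * ((\<alpha> * (2 * ?m t - 3 * (?m t)\<^sup>2) - 1) - \<alpha> * ?v t)" if "0 \<le> t" for t
  proof (rule mult_left_mono)
    have P: "\<rho> t \<in> space PP_spin" by (rule higher_solution_in_space[OF sol that])
    show v: "0 \<le> ?v t" by (rule fluct_nonneg[OF P])
    have "?m t * (1 - ?m t) \<le> ?m t" using mean1_bounds[OF P] by (simp add: mult_left_le)
    then have "?v t \<le> ?m t" using fluct_le[OF P] by linarith
    then have "\<alpha> * ?v t * 1 \<le> \<alpha> * ?v t * (1 + ?m t - ?v t)" using \<alpha> v by (intro mult_left_mono) auto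
    then show "\<alpha> * (2 * ?m t - 3 * (?m t)\<^sup>2 - ?v t * (1 + ?m t) + (?v t)\<^sup>2) - 1 \<le> \<alpha> * (2 * ?m t - 3 * (?m t)\<^sup>2) - 1 - \<alpha> * ?v t"
      by (simp add: power2_eq_square algebra_simps)
  qed
  fix e :: real assume "e > 0"
  have "((\<lambda>t. \<alpha> * (2 * ?m t - 3 * (?m t)\<^sup>2) - 1) \<longlongrightarrow> \<alpha> * (2 * z - 3 * z\<^sup>2) - 1) at_top"
    by (intro tendsto_intros m)
  then show "\<forall>\<^sub>F t in at_top. \<alpha> * (2 * ?m t - 3 * (?m t)\<^sup>2) - 1 < e"
    by (rule order_tendstoD) (use z \<open>e > 0\<close> in simp)
qed (rule \<alpha>)

text \<open>As m (1 - m) is at most 1/4, the mean m decays at relative rate at least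
  \<open>1 - \<alpha> / 4\<close>. With m at most 1 this is weakened to the Riccati form.\<close>

lemma mean_tendsto_0_subcritical:
  assumes \<alpha>: "0 \<le> \<alpha>" "\<alpha> < 4" and sol: "higher_solution \<alpha> \<rho>"
  shows "((\<lambda>t. mean1 (\<rho> t)) \<longlongrightarrow> 0) at_top"
proof (rule tendsto_zero_of_riccati[OF mean_ode[OF \<alpha>(1) sol]])
  show "0 < 1 - \<alpha> / 4" using \<alpha> by simp
  fix t :: real assume "0 \<le> t"
  from mean1_bounds[OF higher_solution_in_space[OF sol this]] 
  have m: "0 \<le> mean1 (\<rho> t)" "mean1 (\<rho> t) \<le> 1" .
  show "0 \<le> mean1 (\<rho> t)" by fact
  let ?m = "mean1 (\<rho> t)"
  have "0 \<le> (?m - 1 / 2)\<^sup>2" by simp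
  then have "?m * (1 - ?m) \<le> 1 / 4" by (simp add: power2_eq_square algebra_simps)
  then have "\<alpha> * (?m * (1 - ?m)) \<le> \<alpha> * (1 / 4)" using \<alpha> by (intro mult_left_mono)
  then have "?m * (\<alpha> * (?m * (1 - ?m)) - 1) \<le> ?m * - (1 - \<alpha> / 4)" using m by (intro mult_left_mono) auto
  also have "\<dots> \<le> ?m * (0 - (1 - \<alpha> / 4) * ?m)"
  proof (rule mult_left_mono[OF _ m(1)])
    have "(1 - \<alpha> / 4) * ?m \<le> 1 - \<alpha> / 4" using m \<alpha> by (intro mult_left_le) auto
    then show "- (1 - \<alpha> / 4) \<le> 0 - (1 - \<alpha> / 4) * ?m" by linarith
  qed
  finally show "\<alpha> * ?m\<^sup>2 * (1 - ?m) - ?m \<le> ?m * (0 - (1 - \<alpha> / 4) * ?m)"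
    by (simp add: power2_eq_square algebra_simps)
qed auto

section \<open>The mean for \<open>\<alpha> \<ge> 4\<close>: basins of its equilibria\<close>

lemma z_facts:
  assumes "\<alpha> \<ge> 4"
  shows "z_mid \<alpha> + z_upp \<alpha> = 1" "\<alpha> * (z_mid \<alpha> * z_upp \<alpha>) = 1" "0 < z_mid \<alpha>" "z_mid \<alpha> \<le> 1 / 2" "1 / 2 \<le> z_upp \<alpha>" "z_upp \<alpha> < 1"
    and "\<alpha> > 4 \<Longrightarrow> z_mid \<alpha> < z_upp \<alpha>"
proof -
  have nn: "0 \<le> 1 / 4 - 1 / \<alpha>" using assms by (simp add: field_simps)
  have lt: "sqrt (1 / 4 - 1 / \<alpha>) < 1 / 2"
    by (rule real_less_lsqrt) (use assms in \<open>auto simp: power2_eq_square\<close>)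
  show 1: "z_mid \<alpha> + z_upp \<alpha> = 1" by (simp add: z_mid_def z_upp_def)
  have "z_mid \<alpha> * z_upp \<alpha> = 1 / 4 - sqrt (1 / 4 - 1 / \<alpha>) * sqrt (1 / 4 - 1 / \<alpha>)"
    by (simp add: z_mid_def z_upp_def algebra_simps)
  also have "\<dots> = 1 / \<alpha>" using nn by (simp add: real_sqrt_mult_self)
  finally show "\<alpha> * (z_mid \<alpha> * z_upp \<alpha>) = 1" using assms by simp
  show "0 < z_mid \<alpha>" "z_mid \<alpha> \<le> 1 / 2" "1 / 2 \<le> z_upp \<alpha>" "z_upp \<alpha> < 1"
    using lt nn by (auto simp: z_mid_def z_upp_def)
  show "\<alpha> > 4 \<Longrightarrow> z_mid \<alpha> < z_upp \<alpha>"
    unfolding z_mid_def z_upp_def by (simp add: field_simps)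
qed

text \<open>By Vieta: the two nonzero roots of the drift have sum 1 and product
  \<open>1 / \<alpha>\<close>.\<close>

lemma mean_ode_factored:
  assumes \<alpha>: "\<alpha> \<ge> 4" and sol: "higher_solution \<alpha> \<rho>"
  defines "m \<equiv> \<lambda>t. mean1 (\<rho> t)"
  shows "ode_on 0 m (\<lambda>t. \<alpha> * m t * (m t - z_mid \<alpha>) * (z_upp \<alpha> - m t))"
proof (rule ode_on_cong)
  show "ode_on 0 m (\<lambda>t. \<alpha> * (m t)\<^sup>2 * (1 - m t) - m t)"
    unfolding m_def by (rule mean_ode[OF _ sol]) (use \<alpha> in simp)
  have "\<alpha> * x\<^sup>2 * (1 - x) - x = \<alpha> * x * (x - z_mid \<alpha>) * (z_upp \<alpha> - x)" for x
    using z_facts(1,2)[OF \<alpha>] by algebra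
  then show "\<alpha> * (m t)\<^sup>2 * (1 - m t) - m t = \<alpha> * m t * (m t - z_mid \<alpha>) * (z_upp \<alpha> - m t)" for t .
qed

text \<open>The mean never exceeds its initial value, so the product of its distances to the two
  nonzero equilibria is bounded below by its positive initial value.\<close>

lemma mean_tendsto_0:
  assumes \<alpha>: "\<alpha> \<ge> 4" and sol: "higher_solution \<alpha> \<rho>" and m0: "mean1 (\<rho> 0) < z_mid \<alpha>"
  shows "((\<lambda>t. mean1 (\<rho> t)) \<longlongrightarrow> 0) at_top"
proof -
  let ?m = "\<lambda>t. mean1 (\<rho> t)" and ?a = "z_mid \<alpha>" and ?b = "z_upp \<alpha>"
  note ode = mean_ode_factored[OF \<alpha> sol] and z = z_facts[OF \<alpha>]
  have bd: "0 \<le> ?m t" "?m t \<le> 1" if "0 \<le> t" for t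
    using mean1_bounds[OF higher_solution_in_space[OF sol that]] .
  have ab: "?a \<le> ?b" using z by linarith
  have le: "?m t \<le> ?m 0" if t: "0 \<le> t" for t
  proof (rule barrier_above[OF ode order_refl _ _ t])
    \<comment> \<open>The drift is known to be nonpositive as long as the mean is below
      \<open>z_mid \<alpha>\<close>, so the strip ends there.\<close>
    show "0 < ?a - ?m 0" using m0 by simp
    fix t assume "0 \<le> t" "?m 0 < ?m t" "?m t < ?m 0 + (?a - ?m 0)"
    then show "\<alpha> * ?m t * (?m t - ?a) * (?b - ?m t) \<le> 0"
      using \<alpha> bd[of t] ab by (intro mult_nonpos_nonneg mult_nonneg_nonpos mult_nonneg_nonneg) auto
  qed
  show ?thesis
  proof (rule tendsto_zero_of_riccati[OF ode bd(1)])
    let ?k = "\<alpha> * ((?a - ?m 0) * (?b - ?m 0))"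
    show k: "0 < ?k" using m0 \<alpha> ab by auto
    fix t :: real assume t: "0 \<le> t"
    have "(?a - ?m 0) * (?b - ?m 0) \<le> (?a - ?m t) * (?b - ?m t)"
      using le[OF t] m0 ab by (intro mult_mono) auto
    then have "?k \<le> \<alpha> * ((?a - ?m t) * (?b - ?m t))" using \<alpha> by (intro mult_left_mono) auto
    moreover have "?k * ?m t \<le> ?k" using k bd[OF t] by (simp add: mult_left_le)
    ultimately have "?m t * - (\<alpha> * ((?a - ?m t) * (?b - ?m t))) \<le> ?m t * (0 - ?k * ?m t)"
      using bd[OF t] by (intro mult_left_mono) auto
    then show "\<alpha> * ?m t * (?m t - ?a) * (?b - ?m t) \<le> ?m t * (0 - ?k * ?m t)"
      by (simp add: algebra_simps)
  qed auto
qed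

lemma tendsto_of_eventually_near:
  fixes x :: "real \<Rightarrow> real"
  assumes "\<And>d. d > 0 \<Longrightarrow> \<exists>t1. \<forall>t\<ge>t1. x t \<le> l + d" "\<And>d. d > 0 \<Longrightarrow> \<exists>t1. \<forall>t\<ge>t1. x t \<ge> l - d"
  shows "(x \<longlongrightarrow> l) at_top"
proof (rule tendstoI)
  fix e :: real assume e: "e > 0"
  obtain t1 t2 where *: "\<forall>t\<ge>t1. x t \<le> l + e / 2" "\<forall>t\<ge>t2. x t \<ge> l - e / 2"
    using assms[of "e / 2"] e by auto
  have "dist (x t) l < e" if "t \<ge> max t1 t2" for t
  proof -
    have "x t \<le> l + e / 2" "x t \<ge> l - e / 2" using that * by auto
    then show ?thesis using e unfolding dist_real_def by linarith
  qed
  then show "\<forall>\<^sub>F t in at_top. dist (x t) l < e" unfolding eventually_at_top_linorder by blast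
qed

lemma mean_tendsto_z_upp:
  assumes \<alpha>: "\<alpha> > 4" and sol: "higher_solution \<alpha> \<rho>" and m0: "mean1 (\<rho> 0) > z_mid \<alpha>"
  shows "((\<lambda>t. mean1 (\<rho> t)) \<longlongrightarrow> z_upp \<alpha>) at_top"
proof -
  have \<alpha>': "\<alpha> \<ge> 4" using \<alpha> by simp
  let ?m = "\<lambda>t. mean1 (\<rho> t)" and ?a = "z_mid \<alpha>" and ?b = "z_upp \<alpha>"
  note ode = mean_ode_factored[OF \<alpha>' sol] and z = z_facts[OF \<alpha>']
  have ab: "?a < ?b" using z(7) \<alpha> by simp
  have bd: "0 \<le> ?m t" "?m t \<le> 1" if "0 \<le> t" for t
    using mean1_bounds[OF higher_solution_in_space[OF sol that]] .
  \<comment> \<open>The mean never falls below \<open>c\<close>, which exceeds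
    \<open>z_mid \<alpha>\<close>; this bounds the speed towards \<open>z_upp \<alpha>\<close> from
    below.\<close>
  define c where "c = min (?m 0) ?b"
  have c: "?a < c" "c \<le> ?b" "c \<le> ?m 0" using m0 ab by (auto simp: c_def)
  have ge: "?m t \<ge> c" if t: "0 \<le> t" for t
  proof (rule barrier_below[OF ode c(3) _ _ t])
    show "0 < c - ?a" using c by simp
    fix t assume "0 \<le> t" "?m t < c" "?m t > c - (c - ?a)"
    then show "0 \<le> \<alpha> * ?m t * (?m t - ?a) * (?b - ?m t)"
      using \<alpha> bd[of t] c by (intro mult_nonneg_nonneg) auto
  qed
  show ?thesis
  proof (rule tendsto_of_eventually_near)
    fix d :: real assume d: "d > 0"
    have "\<exists>t1\<ge>0. \<forall>t\<ge>t1. ?m t \<le> ?b + d"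
    proof (rule eventually_le_of_drift[OF ode bd(1)])
      show "0 < \<alpha> * ?b * (?b - ?a) * d" using \<alpha> z ab d by auto
      fix t :: real assume t: "0 \<le> t" "?b + d \<le> ?m t"
      have "\<alpha> * ?b * (?b - ?a) * d \<le> \<alpha> * ?m t * (?m t - ?a) * (?m t - ?b)"
        using t d \<alpha> z ab by (intro mult_mono mult_nonneg_nonneg) auto
      then show "\<alpha> * ?m t * (?m t - ?a) * (?b - ?m t) \<le> - (\<alpha> * ?b * (?b - ?a) * d)"
        by (simp add: algebra_simps)
    qed
    then show "\<exists>t1. \<forall>t\<ge>t1. ?m t \<le> ?b + d" by blast
    have "\<exists>t1\<ge>0. \<forall>t\<ge>t1. ?m t \<ge> ?b - d"
    proof (rule eventually_ge_of_drift[OF ode bd(2)])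
      show "0 < \<alpha> * c * (c - ?a) * d" using \<alpha> z c d by auto
      fix t :: real assume t: "0 \<le> t" "?m t \<le> ?b - d"
      show "\<alpha> * c * (c - ?a) * d \<le> \<alpha> * ?m t * (?m t - ?a) * (?b - ?m t)"
        using t d \<alpha> z c ge[OF t(1)] by (intro mult_mono mult_nonneg_nonneg) auto
    qed
    then show "\<exists>t1. \<forall>t\<ge>t1. ?m t \<ge> ?b - d" by blast
  qed
qed

text \<open>The Lipschitz bound at the equilibrium \<open>z_mid \<alpha>\<close> that
  \<open>ode_on_zero\<close> and \<open>ode_on_nonneg\<close> require: the mean can neither leave
  nor cross this value.\<close>

lemma mean_ode_abs_le:
  assumes \<alpha>: "\<alpha> \<ge> 4" and sol: "higher_solution \<alpha> \<rho>" and t: "0 \<le> t"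
  shows "\<bar>\<alpha> * mean1 (\<rho> t) * (mean1 (\<rho> t) - z_mid \<alpha>) * (z_upp \<alpha> - mean1 (\<rho> t))\<bar> \<le> \<alpha> * \<bar>mean1 (\<rho> t) - z_mid \<alpha>\<bar>"
proof -
  let ?m = "mean1 (\<rho> t)"
  have m: "0 \<le> ?m" "?m \<le> 1" using mean1_bounds[OF higher_solution_in_space[OF sol t]] .
  have "\<bar>?m * (z_upp \<alpha> - ?m)\<bar> \<le> 1 * 1"
    unfolding abs_mult using m z_facts[OF \<alpha>] by (intro mult_mono) (auto simp: abs_le_iff)
  then have "(\<alpha> * \<bar>?m - z_mid \<alpha>\<bar>) * \<bar>?m * (z_upp \<alpha> - ?m)\<bar> \<le> (\<alpha> * \<bar>?m - z_mid \<alpha>\<bar>) * 1"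
    using \<alpha> by (intro mult_left_mono) auto
  then show ?thesis using \<alpha> by (simp add: abs_mult mult_ac)
qed

lemma ode_on_shift: "ode_on t0 x D \<Longrightarrow> ode_on t0 (\<lambda>t. x t - c) D"
  unfolding ode_on_def by (auto intro!: derivative_eq_intros)

lemma mean_eq_z_mid:
  assumes \<alpha>: "\<alpha> \<ge> 4" and sol: "higher_solution \<alpha> \<rho>" and m0: "mean1 (\<rho> 0) = z_mid \<alpha>" and t: "0 \<le> t"
  shows "mean1 (\<rho> t) = z_mid \<alpha>"
  using ode_on_zero[OF ode_on_shift[OF mean_ode_factored[OF \<alpha> sol], of "z_mid \<alpha>"] _ mean_ode_abs_le[OF \<alpha> sol] t] m0 by simp

text \<open>The two nonzero equilibria merge into 1/2, where the drift has a double zero. From above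
  it pushes the mean down quadratically in the distance, and the equilibrium cannot be
  crossed.\<close>

lemma mean_tendsto_half:
  assumes \<alpha>: "\<alpha> = 4" and sol: "higher_solution \<alpha> \<rho>" and m0: "mean1 (\<rho> 0) \<ge> z_mid \<alpha>"
  shows "((\<lambda>t. mean1 (\<rho> t)) \<longlongrightarrow> z_upp \<alpha>) at_top"
proof -
  have \<alpha>': "\<alpha> \<ge> 4" using \<alpha> by simp
  have z: "z_mid \<alpha> = 1 / 2" "z_upp \<alpha> = 1 / 2" by (simp_all add: z_mid_def z_upp_def \<alpha>)
  let ?m = "\<lambda>t. mean1 (\<rho> t)"
  note ode = ode_on_shift[OF mean_ode_factored[OF \<alpha>' sol], of "z_mid \<alpha>"]
  have nn: "0 \<le> ?m t - z_mid \<alpha>" if "0 \<le> t" for t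
    by (rule ode_on_nonneg[OF ode _ mean_ode_abs_le[OF \<alpha>' sol] that]) (use m0 in auto)
  have "((\<lambda>t. ?m t - z_mid \<alpha>) \<longlongrightarrow> 0) at_top"
  proof (rule tendsto_zero_of_riccati[OF ode nn])
    show "(0::real) < 2" by simp
    fix t :: real assume t: "0 \<le> t"
    define y where "y = ?m t - z_mid \<alpha>"
    have "2 * (y * y) \<le> 4 * ?m t * (y * y)" using nn[OF t] z by (intro mult_right_mono) auto
    moreover have "z_upp \<alpha> - ?m t = - y" using z by (simp add: y_def)
    ultimately show "\<alpha> * ?m t * (?m t - z_mid \<alpha>) * (z_upp \<alpha> - ?m t) \<le> (?m t - z_mid \<alpha>) * (0 - 2 * (?m t - z_mid \<alpha>))"
      unfolding y_def[symmetric] by (simp add: \<alpha> mult_ac)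
  qed auto
  from tendsto_add[OF this tendsto_const[of "z_mid \<alpha>"]] show ?thesis by (simp add: z)
qed

lemma bdd_test_diff: "bdd_test h \<Longrightarrow> bdd_test k \<Longrightarrow> bdd_test (\<lambda>x. h x - k x)"
  using bdd_test_add[of h "\<lambda>x. -1 * k x"] bdd_test_cmult[of k "-1"] by simp

section \<open>Contraction for test functions of bounded curvature\<close>

text \<open>For twice differentiable \<open>f\<close> this says \<open>\<bar>f''\<bar> \<le> K\<close> on \<open>{0..1}\<close>. The class is stable under affine
  substitutions, and \<open>cob_poly\<close> is affine in each variable. The associated distance \<open>close_by\<close> is
  Zolotarev's metric of order 2.\<close>

definition curv :: "real \<Rightarrow> (real \<Rightarrow> real) \<Rightarrow> bool" where
  "curv K f \<longleftrightarrow> f \<in> borel_measurable borel \<and> convex_on {0..1} (\<lambda>x. K / 2 * x\<^sup>2 + f x) \<and>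
     convex_on {0..1} (\<lambda>x. K / 2 * x\<^sup>2 - f x)"

lemma curv_uminus: "curv K f \<Longrightarrow> curv K (\<lambda>x. - f x)"
  by (simp add: curv_def)

text \<open>\<open>K / 2 * (a + b * x)\<^sup>2\<close> and
  \<open>K * b\<^sup>2 / 2 * x\<^sup>2\<close> differ by an affine function, which does not affect
  convexity. The factor \<open>b\<^sup>2\<close> is the source of the contraction.\<close>

lemma convex_on_affine_comp:
  assumes c: "convex_on {0..1} (\<lambda>x. K / 2 * x\<^sup>2 + f x)" and ab: "\<And>x. x \<in> {0..1} \<Longrightarrow> a + b * x \<in> {0..1::real}"
  shows "convex_on {0..1} (\<lambda>x. K * b\<^sup>2 / 2 * x\<^sup>2 + f (a + b * x))"
proof (rule convex_onI)
  fix t x y :: real assume t: "0 < t" "t < 1" and xy: "x \<in> {0..1}" "y \<in> {0..1}"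
  let ?g = "\<lambda>x. K / 2 * x\<^sup>2 + f x"
  have A: "?g ((1 - t) *\<^sub>R (a + b * x) + t *\<^sub>R (a + b * y)) \<le> (1 - t) * ?g (a + b * x) + t * ?g (a + b * y)"
    using c t ab[OF xy(1)] ab[OF xy(2)] by (intro convex_onD) auto
  define w where "w = (1 - t) * x + t * y"
  have B: "(1 - t) *\<^sub>R (a + b * x) + t *\<^sub>R (a + b * y) = a + b * w"
    by (simp add: w_def algebra_simps)
  have "K / 2 * (a + b * w)\<^sup>2 + f (a + b * w)
     \<le> (1 - t) * (K / 2 * (a + b * x)\<^sup>2) + t * (K / 2 * (a + b * y)\<^sup>2) + ((1 - t) * f (a + b * x) + t * f (a + b * y))"
    using A unfolding B by (simp only: distrib_left)
  moreover have "K / 2 * (a + b * w)\<^sup>2 - ((1 - t) * (K / 2 * (a + b * x)\<^sup>2) + t * (K / 2 * (a + b * y)\<^sup>2))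
     = K * b\<^sup>2 / 2 * w\<^sup>2 - ((1 - t) * (K * b\<^sup>2 / 2 * x\<^sup>2) + t * (K * b\<^sup>2 / 2 * y\<^sup>2))"
    by (simp add: w_def power2_eq_square field_simps)
  ultimately have "K * b\<^sup>2 / 2 * w\<^sup>2 + f (a + b * w)
     \<le> (1 - t) * (K * b\<^sup>2 / 2 * x\<^sup>2) + t * (K * b\<^sup>2 / 2 * y\<^sup>2) + ((1 - t) * f (a + b * x) + t * f (a + b * y))"
    by linarith
  then show "K * b\<^sup>2 / 2 * ((1 - t) *\<^sub>R x + t *\<^sub>R y)\<^sup>2 + f (a + b * ((1 - t) *\<^sub>R x + t *\<^sub>R y))
     \<le> (1 - t) * (K * b\<^sup>2 / 2 * x\<^sup>2 + f (a + b * x)) + t * (K * b\<^sup>2 / 2 * y\<^sup>2 + f (a + b * y))"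
    unfolding w_def by (simp add: distrib_left)
qed simp

lemma curv_affine:
  assumes "curv K f" "\<And>x. x \<in> {0..1} \<Longrightarrow> a + b * x \<in> {0..1::real}"
  shows "curv (K * b\<^sup>2) (\<lambda>x. f (a + b * x))"
  using assms convex_on_affine_comp[of K f a b] convex_on_affine_comp[of K "\<lambda>x. - f x" a b]
  by (auto simp: curv_def)

text \<open>Both convex functions in \<open>curv\<close> lie below their chords between 0 and
  1.\<close>

lemma curv_chord:
  assumes "curv K f" "x \<in> {0..1}"
  shows "\<bar>f x - ((1 - x) * f 0 + x * f 1)\<bar> \<le> K / 2 * (x * (1 - x))"
proof -
  have "g x \<le> (1 - x) * g 0 + x * g 1" if "convex_on {0..1} g" for g :: "real \<Rightarrow> real"
    using convex_onD[OF that, of x 0 1] assms(2) by auto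
  from this[of "\<lambda>x. K / 2 * x\<^sup>2 + f x"] this[of "\<lambda>x. K / 2 * x\<^sup>2 - f x"] assms(1)
  have "K / 2 * x\<^sup>2 + f x \<le> (1 - x) * f 0 + x * (K / 2 + f 1)"
    "K / 2 * x\<^sup>2 - f x \<le> (1 - x) * (- f 0) + x * (K / 2 - f 1)"
    by (auto simp: curv_def)
  then show ?thesis unfolding abs_le_iff by (simp add: power2_eq_square algebra_simps)
qed

lemma curv_bound:
  assumes "curv K f" "K \<ge> 0" "x \<in> {0..1}"
  shows "\<bar>f x - ((1 - x) * f 0 + x * f 1)\<bar> \<le> K / 8"
proof -
  have "0 \<le> (x - 1 / 2)\<^sup>2" by simp
  then have "x * (1 - x) \<le> 1 / 4" by (simp add: power2_eq_square algebra_simps)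
  then have "K / 2 * (x * (1 - x)) \<le> K / 2 * (1 / 4)" using assms(2) by (intro mult_left_mono) auto
  then show ?thesis using curv_chord[OF assms(1,3)] by simp
qed

lemma curv_bdd_test:
  assumes "curv K f" "K \<ge> 0"
  shows "bdd_test f"
  unfolding bdd_test_def bounded_iff
proof (intro conjI exI[of _ "K / 8 + \<bar>f 0\<bar> + \<bar>f 1\<bar>"] ballI)
  show "f \<in> borel_measurable borel" using assms by (simp add: curv_def)
  fix y assume "y \<in> f ` {0..1}"
  then obtain x where x: "x \<in> {0..1}" "y = f x" by auto
  define A B where "A = (1 - x) * f 0" and "B = x * f 1"
  have "\<bar>A\<bar> \<le> \<bar>f 0\<bar>" "\<bar>B\<bar> \<le> \<bar>f 1\<bar>"
    using x mult_right_mono[of "1 - x" 1 "\<bar>f 0\<bar>"] mult_right_mono[of x 1 "\<bar>f 1\<bar>"] by (auto simp: abs_mult A_def B_def)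
  then show "norm y \<le> K / 8 + \<bar>f 0\<bar> + \<bar>f 1\<bar>" using curv_bound[OF assms x(1)] unfolding A_def[symmetric] B_def[symmetric] x(2) real_norm_def by linarith
qed

text \<open>The second derivative is at most n (n - 1) on the unit interval, and the square is a
  simpler bound. Powers being admissible, \<open>close_by\<close> controls all moments.\<close>

lemma curv_power: "curv ((real n)\<^sup>2) (\<lambda>x. x ^ n)"
proof -
  let ?K = "(real n)\<^sup>2"
  have bd: "\<bar>real n * (real (n - 1) * x ^ (n - 1 - 1))\<bar> \<le> ?K" if "x \<in> {0..1}" for x :: real
  proof -
    have "real n * (real (n - 1) * x ^ (n - 1 - 1)) \<le> real n * (real n * 1)"
      using that by (intro mult_left_mono mult_mono power_le_one) auto
    then show ?thesis using that by (simp add: power2_eq_square)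
  qed
  have c: "convex_on {0..1} (\<lambda>x. ?K / 2 * x\<^sup>2 + s * x ^ n)" if s: "s = 1 \<or> s = -1" for s :: real
  proof (rule f''_ge0_imp_convex)
    fix x :: real assume x: "x \<in> {0..1}"
    show "((\<lambda>x. ?K / 2 * x\<^sup>2 + s * x ^ n) has_real_derivative ?K * x + s * (real n * x ^ (n - 1))) (at x)"
      by (auto intro!: derivative_eq_intros)
    show "((\<lambda>x. ?K * x + s * (real n * x ^ (n - 1))) has_real_derivative
        ?K + s * (real n * (real (n - 1) * x ^ (n - 1 - 1)))) (at x)"
      by (auto intro!: derivative_eq_intros)
    show "0 \<le> ?K + s * (real n * (real (n - 1) * x ^ (n - 1 - 1)))" using bd[OF x] s by (auto simp: abs_le_iff)
  qed simp
  show ?thesis using c[of 1] c[of "-1"] by (simp add: curv_def)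
qed

definition close_by :: "real \<Rightarrow> bool measure measure \<Rightarrow> bool measure measure \<Rightarrow> bool" where
  "close_by D \<rho> \<sigma> \<longleftrightarrow> (\<forall>K\<ge>0. \<forall>f. curv K f \<longrightarrow> \<bar>pexp \<rho> f - pexp \<sigma> f\<bar> \<le> K * D)"

text \<open>The chord of \<open>f\<close> is affine, so equal means give it equal expectations, and
  under either law the expectation of \<open>f\<close> differs from that of the chord by at most K /
  8.\<close>

lemma close_by_equal_means:
  assumes \<rho>: "\<rho> \<in> space PP_spin" and \<sigma>: "\<sigma> \<in> space PP_spin" and m: "mean1 \<rho> = mean1 \<sigma>"
  shows "close_by (1 / 4) \<rho> \<sigma>"
  unfolding close_by_def
proof (intro allI impI)
  fix K f assume K: "(0::real) \<le> K" and f: "curv K f"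
  let ?c = "\<lambda>x. (1 - x) * f 0 + x * f 1"
  have fb: "bdd_test f" by (rule curv_bdd_test[OF f K])
  have cb: "bdd_test ?c" by (intro bdd_test_continuous_UNIV continuous_intros)
  have d: "bdd_test (\<lambda>x. f x - ?c x)" by (rule bdd_test_diff[OF fb cb])
  have "pexp \<tau> ?c = f 0 + (f 1 - f 0) * mean1 \<tau> + 0 * mean2 \<tau>" if "\<tau> \<in> space PP_spin" for \<tau>
  proof -
    have "?c = (\<lambda>x. f 0 + (f 1 - f 0) * x + 0 * x\<^sup>2)" by (auto simp: algebra_simps)
    then show ?thesis by (simp only: pexp_quadratic[OF that])
  qed
  then have e: "pexp \<rho> ?c = pexp \<sigma> ?c" using \<rho> \<sigma> by (simp only: m mult_zero_left)
  have near: "\<bar>pexp \<tau> f - pexp \<tau> ?c\<bar> \<le> K / 8" if "\<tau> \<in> space PP_spin" for \<tau>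
    unfolding pexp_diff[OF that fb cb, symmetric] by (rule abs_pexp_le[OF that d curv_bound[OF f K]])
  show "\<bar>pexp \<rho> f - pexp \<sigma> f\<bar> \<le> K * (1 / 4)" using near[OF \<rho>] near[OF \<sigma>] e by linarith
qed

lemma pexp_diff_le:
  assumes "\<rho> \<in> space PP_spin" "bdd_test h" "bdd_test k" "bdd_test w" "\<And>x. x \<in> {0..1} \<Longrightarrow> \<bar>h x - k x\<bar> \<le> w x"
  shows "\<bar>pexp \<rho> h - pexp \<rho> k\<bar> \<le> pexp \<rho> w"
proof -
  have "pexp \<rho> h \<le> pexp \<rho> (\<lambda>x. k x + w x)"
    using assms(5) by (intro pexp_mono assms bdd_test_add) (auto simp: abs_le_iff algebra_simps)
  moreover have "pexp \<rho> k \<le> pexp \<rho> (\<lambda>x. h x + w x)"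
    using assms(5) by (intro pexp_mono assms bdd_test_add) (auto simp: abs_le_iff algebra_simps)
  ultimately show ?thesis using pexp_add[OF assms(1,3,4)] pexp_add[OF assms(1,2,4)] by linarith
qed

lemma pexp2_diff_le:
  assumes a: "a \<in> space PP_spin" and b: "b \<in> space PP_spin" and "bdd_test2 h" "bdd_test2 k" "bdd_test2 w"
    and "\<And>x y. x \<in> {0..1} \<Longrightarrow> y \<in> {0..1} \<Longrightarrow> \<bar>h x y - k x y\<bar> \<le> w x y"
  shows "\<bar>pexp a (\<lambda>x. pexp b (h x)) - pexp a (\<lambda>x. pexp b (k x))\<bar> \<le> pexp a (\<lambda>x. pexp b (w x))"
  by (intro pexp_diff_le[OF a] bdd_test_pexp[OF b] pexp_diff_le[OF b] bdd_test2_slice assms)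

lemma bdd_test2_continuous:
  assumes "continuous_on UNIV (\<lambda>(x, y). w x y)"
  shows "bdd_test2 w"
proof -
  define W where "W = (\<lambda>p. w (fst p) (snd p))"
  have c: "continuous_on UNIV W" using assms by (simp add: W_def case_prod_beta')
  have "compact (W ` ({0..1} \<times> {0..1}))"
    by (rule compact_continuous_image[OF continuous_on_subset[OF c subset_UNIV] compact_Times[OF compact_Icc compact_Icc]])
  then have "bounded (W ` ({0..1} \<times> {0..1}))" by (rule compact_imp_bounded)
  then obtain B where B: "\<forall>r\<in>W ` ({0..1} \<times> {0..1}). norm r \<le> B" unfolding bounded_iff by (rule exE)
  have "\<bar>w x y\<bar> \<le> B" if "x \<in> {0..1}" "y \<in> {0..1}" for x y
  proof -
    have "(x, y) \<in> {0..1} \<times> {0..1}" using that by (rule SigmaI)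
    from B[rule_format, OF imageI[OF this]] show ?thesis by (simp only: W_def fst_conv snd_conv real_norm_def)
  qed
  then have "\<exists>B. \<forall>x\<in>{0..1}. \<forall>y\<in>{0..1}. \<bar>w x y\<bar> \<le> B" by blast
  moreover have "W \<in> borel_measurable (borel \<Otimes>\<^sub>M borel)"
    unfolding borel_prod using c by (rule borel_measurable_continuous_onI)
  ultimately show ?thesis unfolding bdd_test2_def W_def case_prod_beta' by (rule conjI[rotated])
qed

text \<open>The laws are exchanged one argument at a time. As a function of that argument,
  \<open>f (cob_poly x y z)\<close> is \<open>f\<close> after an affine map of slope
  \<open>1 - y * z\<close>, \<open>(1 - x) * z\<close> or \<open>(1 - x) * y\<close>, which
  multiplies its curvature by the squared slope. The factor in the bound collects the expectations
  of these squares.\<close>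

lemma cobE_close_by:
  assumes \<rho>: "\<rho> \<in> space PP_spin" and \<sigma>: "\<sigma> \<in> space PP_spin" and cl: "close_by D \<rho> \<sigma>" and K: "K \<ge> 0" and f: "curv K f"
  shows "\<bar>cobE \<rho> \<rho> \<rho> f - cobE \<sigma> \<sigma> \<sigma> f\<bar> \<le> K * D *
    (1 - 2 * (mean1 \<rho>)\<^sup>2 + (mean2 \<rho>)\<^sup>2 + (1 - 2 * mean1 \<sigma> + mean2 \<sigma>) * (mean2 \<rho> + mean2 \<sigma>))"
proof -
  have fb: "bdd_test f" by (rule curv_bdd_test[OF f K])
  have aff: "\<bar>pexp \<rho> (\<lambda>x. f (a + b * x)) - pexp \<sigma> (\<lambda>x. f (a + b * x))\<bar> \<le> K * D * b\<^sup>2"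
    if "\<And>x. x \<in> {0..1} \<Longrightarrow> a + b * x \<in> {0..1}" for a b
    using cl[unfolded close_by_def, rule_format, OF _ curv_affine[OF f that]] K by (simp add: mult_ac)
  \<comment> \<open>The argument to be exchanged is moved to the innermost integral.\<close>
  have in1: "cobE r1 r2 r3 f = pexp r2 (\<lambda>y. pexp r3 (\<lambda>z. pexp r1 (\<lambda>x. f (cob_poly x y z))))"
    and in2: "cobE r1 r2 r3 f = pexp r1 (\<lambda>x. pexp r3 (\<lambda>z. pexp r2 (\<lambda>y. f (cob_poly x y z))))"
    if r: "r1 \<in> space PP_spin" "r2 \<in> space PP_spin" "r3 \<in> space PP_spin" for r1 r2 r3
  proof -
    show "cobE r1 r2 r3 f = pexp r2 (\<lambda>y. pexp r3 (\<lambda>z. pexp r1 (\<lambda>x. f (cob_poly x y z))))"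
      unfolding cobE_outer(1)[OF r fb]
      by (rule pexp_cong[OF r(2)], rule pexp_swap[OF r(1,3) bdd_test2_cob_poly(2)[OF fb]])
    show "cobE r1 r2 r3 f = pexp r1 (\<lambda>x. pexp r3 (\<lambda>z. pexp r2 (\<lambda>y. f (cob_poly x y z))))"
      unfolding cobE_def by (rule pexp_cong[OF r(1)], rule pexp_swap[OF r(2,3) bdd_test2_cob_poly(1)[OF fb]])
  qed
  have 1: "\<bar>cobE \<rho> \<rho> \<rho> f - cobE \<sigma> \<rho> \<rho> f\<bar> \<le> K * D * (1 - 2 * (mean1 \<rho>)\<^sup>2 + (mean2 \<rho>)\<^sup>2)"
  proof -
    have "\<bar>cobE \<rho> \<rho> \<rho> f - cobE \<sigma> \<rho> \<rho> f\<bar> \<le> pexp \<rho> (\<lambda>y. pexp \<rho> (\<lambda>z. K * D * (1 - y * z)\<^sup>2))"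
      unfolding in1[OF \<rho> \<rho> \<rho>] in1[OF \<sigma> \<rho> \<rho>]
    proof (rule pexp2_diff_le[OF \<rho> \<rho> bdd_test2_pexp_cob_poly(1)[OF fb \<rho>] bdd_test2_pexp_cob_poly(1)[OF fb \<sigma>]])
      show "bdd_test2 (\<lambda>y z. K * D * (1 - y * z)\<^sup>2)"
        by (rule bdd_test2_continuous) (auto simp: case_prod_beta' intro!: continuous_intros)
      fix y z :: real assume yz: "y \<in> {0..1}" "z \<in> {0..1}"
      have e: "cob_poly x y z = y * z + (1 - y * z) * x" for x by (simp add: algebra_simps)
      show "\<bar>pexp \<rho> (\<lambda>x. f (cob_poly x y z)) - pexp \<sigma> (\<lambda>x. f (cob_poly x y z))\<bar> \<le> K * D * (1 - y * z)\<^sup>2"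
        unfolding e using cob_poly_bounds[OF _ yz] by (intro aff) (simp add: e)
    qed
    also have "\<dots> = K * D * (1 - 2 * (mean1 \<rho>)\<^sup>2 + (mean2 \<rho>)\<^sup>2)"
    proof -
      have "pexp \<rho> (\<lambda>z. (1 - y * z)\<^sup>2) = 1 + (- 2 * mean1 \<rho>) * y + mean2 \<rho> * y\<^sup>2" for y
      proof -
        have "(\<lambda>z. (1 - y * z)\<^sup>2) = (\<lambda>z. 1 + (- 2 * y) * z + y\<^sup>2 * z\<^sup>2)" by (auto simp: power2_eq_square algebra_simps)
        then show ?thesis by (simp only: pexp_quadratic[OF \<rho>]) (simp add: mult_ac)
      qed
      then show ?thesis by (simp only: pexp_cmult pexp_quadratic[OF \<rho>]) (simp add: power2_eq_square)
    qed
    finally show ?thesis .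
  qed
  have sq: "pexp a (\<lambda>x. pexp b (\<lambda>z. K * D * ((1 - x) * z)\<^sup>2)) = K * D * ((1 - 2 * mean1 a + mean2 a) * mean2 b)"
    if "a \<in> space PP_spin" for a b
  proof -
    have "pexp b (\<lambda>z. K * D * ((1 - x) * z)\<^sup>2) = K * D * mean2 b * (1 + (- 2) * x + 1 * x\<^sup>2)" for x
    proof -
      have "(\<lambda>z. K * D * ((1 - x) * z)\<^sup>2) = (\<lambda>z. (K * D * (1 - x)\<^sup>2) * z\<^sup>2)"
        by (simp add: power_mult_distrib mult_ac)
      then show ?thesis by (simp only: pexp_cmult) (simp add: power2_eq_square algebra_simps)
    qed
    then show ?thesis by (simp only: pexp_cmult pexp_quadratic[OF that]) (simp add: mult_ac)
  qed
  have bt: "bdd_test2 (\<lambda>x z. K * D * ((1 - x) * z)\<^sup>2)"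
    by (rule bdd_test2_continuous) (auto simp: case_prod_beta' intro!: continuous_intros)
  have 2: "\<bar>cobE \<sigma> \<rho> \<rho> f - cobE \<sigma> \<sigma> \<rho> f\<bar> \<le> K * D * ((1 - 2 * mean1 \<sigma> + mean2 \<sigma>) * mean2 \<rho>)"
    unfolding in2[OF \<sigma> \<rho> \<rho>] in2[OF \<sigma> \<sigma> \<rho>] sq[OF \<sigma>, symmetric]
  proof (rule pexp2_diff_le[OF \<sigma> \<rho> bdd_test2_pexp_cob_poly(2)[OF fb \<rho>] bdd_test2_pexp_cob_poly(2)[OF fb \<sigma>] bt])
    fix x z :: real assume xz: "x \<in> {0..1}" "z \<in> {0..1}"
    have e: "cob_poly x y z = x + ((1 - x) * z) * y" for y by (simp add: algebra_simps)
    show "\<bar>pexp \<rho> (\<lambda>y. f (cob_poly x y z)) - pexp \<sigma> (\<lambda>y. f (cob_poly x y z))\<bar> \<le> K * D * ((1 - x) * z)\<^sup>2"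
      unfolding e using cob_poly_bounds[OF xz(1) _ xz(2)] by (intro aff) (simp add: e)
  qed
  have 3: "\<bar>cobE \<sigma> \<sigma> \<rho> f - cobE \<sigma> \<sigma> \<sigma> f\<bar> \<le> K * D * ((1 - 2 * mean1 \<sigma> + mean2 \<sigma>) * mean2 \<sigma>)"
    unfolding cobE_def sq[OF \<sigma>, symmetric]
  proof (rule pexp2_diff_le[OF \<sigma> \<sigma> bdd_test2_pexp_cob_poly(3)[OF fb \<rho>] bdd_test2_pexp_cob_poly(3)[OF fb \<sigma>] bt])
    fix x y :: real assume xy: "x \<in> {0..1}" "y \<in> {0..1}"
    show "\<bar>pexp \<rho> (\<lambda>z. f (cob_poly x y z)) - pexp \<sigma> (\<lambda>z. f (cob_poly x y z))\<bar> \<le> K * D * ((1 - x) * y)\<^sup>2"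
      using cob_poly_bounds[OF xy] by (intro aff) simp
  qed
  have "\<bar>cobE \<rho> \<rho> \<rho> f - cobE \<sigma> \<sigma> \<sigma> f\<bar> \<le> K * D * (1 - 2 * (mean1 \<rho>)\<^sup>2 + (mean2 \<rho>)\<^sup>2)
      + K * D * ((1 - 2 * mean1 \<sigma> + mean2 \<sigma>) * mean2 \<rho>) + K * D * ((1 - 2 * mean1 \<sigma> + mean2 \<sigma>) * mean2 \<sigma>)"
    using 1 2 3 by linarith
  then show ?thesis by (simp add: algebra_simps)
qed

text \<open>If \<open>close_by D\<close> holds so far, the difference h of the two expectations of
  \<open>f\<close> satisfies h' \<le> (\<alpha> + 1) (q K D - h). It relaxes to at most q K D, and
  after time \<theta> the transient is at most (1 - q) / 2 times K D, so each step multiplies D by q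
  + (1 - q) / 2 = (1 + q) / 2.\<close>

lemma contraction:
  assumes \<alpha>: "\<alpha> \<ge> 0" and \<rho>: "higher_solution \<alpha> \<rho>" and \<sigma>: "higher_solution \<alpha> \<sigma>"
    and q: "0 \<le> q" "q < 1" and \<theta>: "\<theta> \<ge> 0" "exp (- (\<alpha> + 1) * \<theta>) \<le> (1 - q) / 2" and T: "T \<ge> 0"
    and rate: "\<And>t. t \<ge> T \<Longrightarrow> \<alpha> * (1 - 2 * (mean1 (\<rho> t))\<^sup>2 + (mean2 (\<rho> t))\<^sup>2 +
      (1 - 2 * mean1 (\<sigma> t) + mean2 (\<sigma> t)) * (mean2 (\<rho> t) + mean2 (\<sigma> t))) \<le> q * (\<alpha> + 1)"
    and D: "D \<ge> 0" and cl: "\<And>t. t \<ge> T \<Longrightarrow> close_by D (\<rho> t) (\<sigma> t)"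
    and t: "t \<ge> T + real k * \<theta>"
  shows "close_by (((1 + q) / 2) ^ k * D) (\<rho> t) (\<sigma> t)"
  using t
proof (induction k arbitrary: t)
  case 0 then show ?case using cl by simp
next
  case (Suc k)
  let ?D = "((1 + q) / 2) ^ k * D" and ?T = "T + real k * \<theta>" and ?c = "\<alpha> + 1"
  have D': "?D \<ge> 0" using D q by simp
  have T': "?T \<ge> 0" "?T \<ge> T" using T \<theta> by auto
  have one: "pexp (\<rho> t) f - pexp (\<sigma> t) f \<le> K * (((1 + q) / 2) ^ Suc k * D)" if K: "K \<ge> 0" and f: "curv K f" for K f
  proof -
    have fb: "bdd_test f" by (rule curv_bdd_test[OF f K])
    let ?h = "\<lambda>t. pexp (\<rho> t) f - pexp (\<sigma> t) f"
    let ?E = "\<lambda>t. (\<alpha> * cobE (\<rho> t) (\<rho> t) (\<rho> t) f + f 0 - ?c * pexp (\<rho> t) f)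
      - (\<alpha> * cobE (\<sigma> t) (\<sigma> t) (\<sigma> t) f + f 0 - ?c * pexp (\<sigma> t) f)"
    have "ode_on 0 ?h ?E"
      by (rule ode_on_diff) (use \<rho> \<sigma> fb in \<open>auto simp: higher_solution_iff[OF \<alpha>]\<close>)
    then have ode: "ode_on ?T ?h ?E" by (rule ode_on_mono[OF _ T'(1)])
    have "?h t \<le> q * (K * ?D) + exp (- ?c * (t - ?T)) * (?h ?T - q * (K * ?D))"
    proof (rule ode_on_linear_bound[OF ode])
      show "?c > 0" using \<alpha> by simp
      show "t \<ge> ?T" using Suc.prems \<theta> by (simp add: algebra_simps)
      fix s assume s: "s \<ge> ?T"
      have P: "\<rho> s \<in> space PP_spin" "\<sigma> s \<in> space PP_spin"
        using s T' higher_solution_in_space[OF \<rho>] higher_solution_in_space[OF \<sigma>] by auto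
      let ?\<kappa> = "1 - 2 * (mean1 (\<rho> s))\<^sup>2 + (mean2 (\<rho> s))\<^sup>2 + (1 - 2 * mean1 (\<sigma> s) + mean2 (\<sigma> s)) * (mean2 (\<rho> s) + mean2 (\<sigma> s))"
      have "\<alpha> * (cobE (\<rho> s) (\<rho> s) (\<rho> s) f - cobE (\<sigma> s) (\<sigma> s) (\<sigma> s) f) \<le> \<alpha> * (K * ?D * ?\<kappa>)"
        using cobE_close_by[OF P Suc.IH[OF s] K f] \<alpha> by (intro mult_left_mono) (auto simp: abs_le_iff)
      also have "\<dots> = K * ?D * (\<alpha> * ?\<kappa>)" by (simp add: mult_ac)
      also have "\<dots> \<le> K * ?D * (q * ?c)"
        using rate[of s] s T' by (intro mult_left_mono[OF _ mult_nonneg_nonneg[OF K D']]) linarith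
      finally show "?E s \<le> ?c * (q * (K * ?D) - ?h s)" by (simp add: algebra_simps)
    qed
    also have "\<dots> \<le> q * (K * ?D) + (1 - q) / 2 * (K * ?D)"
    proof -
      have P: "?h ?T \<le> K * ?D" using Suc.IH[of ?T] K f unfolding close_by_def by (auto simp: abs_le_iff)
      have KD: "0 \<le> K * ?D" using K D' by simp
      then have "?h ?T - q * (K * ?D) \<le> K * ?D" using P q by (smt (verit) mult_nonneg_nonneg)
      moreover have e: "exp (- ?c * (t - ?T)) \<le> (1 - q) / 2"
      proof (rule order_trans[OF _ \<theta>(2)])
        have "?c * \<theta> \<le> ?c * (t - ?T)" using Suc.prems \<alpha> by (intro mult_left_mono) (auto simp: algebra_simps)
        then show "exp (- ?c * (t - ?T)) \<le> exp (- ?c * \<theta>)" by (simp only: mult_minus_left exp_le_cancel_iff neg_le_iff_le)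
      qed
      ultimately have "exp (- ?c * (t - ?T)) * (?h ?T - q * (K * ?D)) \<le> exp (- ?c * (t - ?T)) * (K * ?D)"
        by (intro mult_left_mono) auto
      also have "\<dots> \<le> (1 - q) / 2 * (K * ?D)" using e KD by (intro mult_right_mono)
      finally show ?thesis by simp
    qed
    also have "\<dots> = K * (((1 + q) / 2) ^ Suc k * D)" by (simp add: field_simps)
    finally show ?thesis .
  qed
  show ?case
    unfolding close_by_def
  proof (intro allI impI)
    fix K f assume K: "(0::real) \<le> K" and f: "curv K f"
    \<comment> \<open>The one-sided bound is applied to \<open>f\<close> and to its negative, as
      \<open>curv K\<close> is closed under negation.\<close>
    have "pexp \<tau> (\<lambda>x. - f x) = - pexp \<tau> f" for \<tau> using pexp_cmult[of \<tau> "-1" f] by simp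
    from this[of "\<rho> t"] this[of "\<sigma> t"] show "\<bar>pexp (\<rho> t) f - pexp (\<sigma> t) f\<bar> \<le> K * (((1 + q) / 2) ^ Suc k * D)"
      using one[OF K f] one[OF K curv_uminus[OF f]] unfolding abs_le_iff by linarith
  qed
qed

section \<open>The intermediate fixed point\<close>

lemma higher_solution_shift:
  assumes \<alpha>: "\<alpha> \<ge> 0" and sol: "higher_solution \<alpha> \<rho>" and s: "s \<ge> 0"
  shows "higher_solution \<alpha> (\<lambda>t. \<rho> (t + s))"
  unfolding higher_solution_iff[OF \<alpha>]
proof (intro conjI allI impI)
  show "\<rho> (t + s) \<in> space PP_spin" if "t \<ge> 0" for t using higher_solution_in_space[OF sol] that s by simp
  fix h :: "real \<Rightarrow> real" assume "bdd_test h"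
  then have o: "ode_on 0 (\<lambda>t. pexp (\<rho> t) h) (\<lambda>t. \<alpha> * cobE (\<rho> t) (\<rho> t) (\<rho> t) h + h 0 - (\<alpha> + 1) * pexp (\<rho> t) h)"
    using sol unfolding higher_solution_iff[OF \<alpha>] by blast
  show "ode_on 0 (\<lambda>t. pexp (\<rho> (t + s)) h) (\<lambda>t. \<alpha> * cobE (\<rho> (t + s)) (\<rho> (t + s)) (\<rho> (t + s)) h + h 0 - (\<alpha> + 1) * pexp (\<rho> (t + s)) h)"
    unfolding ode_on_def
  proof (intro allI impI)
    fix t :: real assume t: "0 \<le> t"
    let ?D = "\<alpha> * cobE (\<rho> (t + s)) (\<rho> (t + s)) (\<rho> (t + s)) h + h 0 - (\<alpha> + 1) * pexp (\<rho> (t + s)) h"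
    have "((\<lambda>t. pexp (\<rho> t) h) has_real_derivative ?D) (at (t + s) within {0..})"
      using o t s unfolding ode_on_def by simp
    then have "((\<lambda>t. pexp (\<rho> t) h) has_real_derivative ?D) (at (t + s) within (\<lambda>t. t + s) ` {0..})"
      by (rule DERIV_subset) (use s in auto)
    moreover have "((\<lambda>t. t + s) has_real_derivative 1) (at t within {0..})"
      by (auto intro!: derivative_eq_intros)
    ultimately have "((\<lambda>t. pexp (\<rho> t) h) \<circ> (\<lambda>t. t + s) has_real_derivative ?D * 1) (at t within {0..})"
      by (rule DERIV_image_chain)
    then show "((\<lambda>t. pexp (\<rho> (t + s)) h) has_real_derivative ?D) (at t within {0..})"
      by (simp only: o_def mult_1_right)
  qed
qed

text \<open>When the mean is \<open>z = z_mid \<alpha>\<close>, the fluctuation satisfies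
  \<open>v' = \<alpha> v (z (1 - 2 z) - v (1 + z) + v\<^sup>2)\<close>. The threshold lies below the positive equilibrium, so that
  \<open>v\<close> ends up above it, but close enough to it for the contraction rate to be less than one.\<close>

definition fluct_threshold :: "real \<Rightarrow> real" where
  "fluct_threshold \<alpha> = 3 * (z_mid \<alpha> * (1 - 2 * z_mid \<alpha>)) / (4 * (1 + z_mid \<alpha>))"

lemma z_mid_less_half: "\<alpha> > 4 \<Longrightarrow> z_mid \<alpha> < 1 / 2"
  using z_facts(1,7)[of \<alpha>] by simp

lemma alpha_z_mid: "\<alpha> \<ge> 4 \<Longrightarrow> \<alpha> * (z_mid \<alpha> * (1 - z_mid \<alpha>)) = 1"
  using z_facts(1,2)[of \<alpha>] by (metis add_diff_cancel_left')

lemma fluct_threshold_pos: "\<alpha> > 4 \<Longrightarrow> fluct_threshold \<alpha> > 0"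
  using z_facts(3)[of \<alpha>] z_mid_less_half[of \<alpha>] by (simp add: fluct_threshold_def)

lemma fluct_threshold_eq:
  assumes "\<alpha> > 4"
  shows "fluct_threshold \<alpha> * (1 + z_mid \<alpha>) = 3 / 4 * (z_mid \<alpha> * (1 - 2 * z_mid \<alpha>))"
proof -
  have e: "3 * q / (4 * u) * u = 3 / 4 * q" if "u \<noteq> 0" for q u :: real using that by simp
  show ?thesis unfolding fluct_threshold_def by (rule e) (use z_facts(3)[of \<alpha>] assms in simp)
qed

text \<open>Zero is an equilibrium of v as well, so v is first kept above a positive constant
  \<open>c\<close>. Below the threshold the drift is then at least \<alpha> c Q / 4, with Q = z (1 -
  2 z).\<close>

lemma eventually_fluct_ge:
  assumes \<alpha>: "\<alpha> > 4" and sol: "higher_solution \<alpha> \<rho>" and m0: "mean1 (\<rho> 0) = z_mid \<alpha>" and v0: "fluct (\<rho> 0) > 0"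
  shows "\<exists>T\<ge>0. \<forall>t\<ge>T. fluct (\<rho> t) \<ge> fluct_threshold \<alpha>"
proof -
  let ?z = "z_mid \<alpha>" and ?b = "fluct_threshold \<alpha>" and ?v = "\<lambda>t. fluct (\<rho> t)"
  have \<alpha>': "\<alpha> \<ge> 4" "\<alpha> \<ge> 0" using \<alpha> by auto
  note z = z_facts(3)[OF \<alpha>'(1)] z_mid_less_half[OF \<alpha>]
  let ?Q = "?z * (1 - 2 * ?z)"
  have Q: "?Q > 0" using z by simp
  have b: "?b > 0" by (rule fluct_threshold_pos[OF \<alpha>])
  have bQ: "?b * (1 + ?z) = 3 / 4 * ?Q" by (rule fluct_threshold_eq[OF \<alpha>])
  have ode: "ode_on 0 ?v (\<lambda>t. \<alpha> * ?v t * (?Q - ?v t * (1 + ?z) + (?v t)\<^sup>2))"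
  proof (rule ode_on_cong[OF fluct_ode[OF \<alpha>'(2) sol]])
    fix t :: real assume t: "0 \<le> t"
    \<comment> \<open>With this identity the constant -1 in the drift becomes a multiple of
      \<alpha>, which can then be factored out.\<close>
    have one: "\<alpha> * (?z * (1 - ?z)) = 1" by (rule alpha_z_mid[OF \<alpha>'(1)])
    have "x * (\<alpha> * (2 * ?z - 3 * ?z\<^sup>2 - x * (1 + ?z) + x\<^sup>2) - 1) = \<alpha> * x * (?Q - x * (1 + ?z) + x\<^sup>2)" for x
      using one by algebra
    then show "?v t * (\<alpha> * (2 * mean1 (\<rho> t) - 3 * (mean1 (\<rho> t))\<^sup>2 - ?v t * (1 + mean1 (\<rho> t)) + (?v t)\<^sup>2) - 1)
      = \<alpha> * ?v t * (?Q - ?v t * (1 + ?z) + (?v t)\<^sup>2)"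
      unfolding mean_eq_z_mid[OF \<alpha>'(1) sol m0 t] .
  qed
  have drift: "?Q / 4 \<le> ?Q - x * (1 + ?z) + x\<^sup>2" if "x \<le> ?b" for x
  proof -
    have "x * (1 + ?z) \<le> ?b * (1 + ?z)" using that z by (intro mult_right_mono) auto
    then have "x * (1 + ?z) \<le> 3 / 4 * ?Q" by (simp only: bQ)
    then show ?thesis using zero_le_power2[of x] by linarith
  qed
  define c where "c = min (?v 0) ?b"
  have c: "c > 0" "c \<le> ?b" "c \<le> ?v 0" using b v0 by (auto simp: c_def)
  have nn: "0 \<le> ?v t" if "0 \<le> t" for t using fluct_nonneg higher_solution_in_space[OF sol that] .
  have ge: "?v t \<ge> c" if t: "0 \<le> t" for t
  proof (rule barrier_below[OF ode c(3) c(1) _ t])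
    fix t assume "0 \<le> t" "?v t < c"
    then have "0 \<le> ?Q - ?v t * (1 + ?z) + (?v t)\<^sup>2" "0 \<le> \<alpha> * ?v t"
      using \<alpha> nn[of t] drift[of "?v t"] Q c by (linarith, simp)
    then show "0 \<le> \<alpha> * ?v t * (?Q - ?v t * (1 + ?z) + (?v t)\<^sup>2)"
      by (rule mult_nonneg_nonneg[rotated])
  qed
  show ?thesis
  proof (rule eventually_ge_of_drift[OF ode])
    show "?v t \<le> 1" if "0 \<le> t" for t
    proof -
      have P: "\<rho> t \<in> space PP_spin" by (rule higher_solution_in_space[OF sol that])
      have "mean1 (\<rho> t) * (1 - mean1 (\<rho> t)) \<le> 1" using mean1_bounds[OF P] by (intro mult_le_one) auto
      then show ?thesis using fluct_le[OF P] by linarith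
    qed
    show "0 < \<alpha> * c * (?Q / 4)" using \<alpha> c Q by simp
    fix t :: real assume "0 \<le> t" "?v t \<le> ?b"
    then have d: "?Q / 4 \<le> ?Q - ?v t * (1 + ?z) + (?v t)\<^sup>2" and g: "\<alpha> * c \<le> \<alpha> * ?v t" "0 \<le> \<alpha> * ?v t"
      using \<alpha> ge[of t] c drift[of "?v t"] by (blast, simp, simp)
    show "\<alpha> * c * (?Q / 4) \<le> \<alpha> * ?v t * (?Q - ?v t * (1 + ?z) + (?v t)\<^sup>2)"
      by (rule mult_mono[OF g(1) d g(2)]) (use Q in linarith)
  qed
qed

text \<open>The factor of \<open>cobE_close_by\<close> at mean \<open>z_mid \<alpha>\<close>, with
  both second moments at the largest value that the threshold permits, multiplied by \<alpha> and
  taken relative to the rate \<open>\<alpha> + 1\<close>.\<close>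

definition mid_rate :: "real \<Rightarrow> real" where
  "mid_rate \<alpha> = \<alpha> * (1 - 2 * (z_mid \<alpha>)\<^sup>2 + (z_mid \<alpha> - fluct_threshold \<alpha>)\<^sup>2 +
     (1 - z_mid \<alpha> - fluct_threshold \<alpha>) * (2 * z_mid \<alpha> - 2 * fluct_threshold \<alpha>)) / (\<alpha> + 1)"

lemma fluct_threshold_less: "\<alpha> > 4 \<Longrightarrow> fluct_threshold \<alpha> \<le> z_mid \<alpha>"
proof -
  assume \<alpha>: "\<alpha> > 4"
  let ?z = "z_mid \<alpha>"
  have z: "0 < ?z" "?z < 1 / 2" using z_facts(3)[of \<alpha>] z_mid_less_half[OF \<alpha>] \<alpha> by auto
  have "3 * (?z * (1 - 2 * ?z)) \<le> ?z * (4 * (1 + ?z))" using z by (simp add: algebra_simps)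
  then show ?thesis unfolding fluct_threshold_def using z by (simp add: pos_divide_le_eq)
qed

text \<open>Up to a positive factor, \<open>mid_rate \<alpha> - 1\<close> is Q - 2 (1 + z) b + 3
  b^2, the derivative at the threshold b of the drift v (Q - (1 + z) v + v^2). The choice (1 + z) b
  = 3 Q / 4 lies halfway between Q / 2, beyond which this derivative without its quadratic term is
  negative, and Q, up to which the drift is surely nonnegative.\<close>

lemma mid_rate_bounds:
  assumes \<alpha>: "\<alpha> > 4"
  shows "0 \<le> mid_rate \<alpha>" "mid_rate \<alpha> < 1"
proof -
  let ?z = "z_mid \<alpha>" and ?b = "fluct_threshold \<alpha>"
  have z: "0 < ?z" "?z < 1 / 2" using z_facts(3)[of \<alpha>] z_mid_less_half[OF \<alpha>] \<alpha> by auto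
  have b: "0 < ?b" "?b \<le> ?z" by (rule fluct_threshold_pos[OF \<alpha>], rule fluct_threshold_less[OF \<alpha>])
  let ?Q = "?z * (1 - 2 * ?z)"
  have bQ: "?b * (1 + ?z) = 3 / 4 * ?Q" by (rule fluct_threshold_eq[OF \<alpha>])
  have "?z * ?z \<le> 1 / 2 * (1 / 2)" using z by (intro mult_mono) auto
  then show "0 \<le> mid_rate \<alpha>"
    unfolding mid_rate_def using \<alpha> z b by (auto simp: power2_eq_square intro!: divide_nonneg_pos mult_nonneg_nonneg add_nonneg_nonneg)
  \<comment> \<open>Q is largest at z = 1/4, hence b is at most 3/32, and 3 b^2 is too small to
    offset the deficit Q / 2.\<close>
  have "0 \<le> (?z - 1 / 4)\<^sup>2" by simp
  then have "?Q \<le> 1 / 8" by (simp add: power2_eq_square algebra_simps)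
  moreover have "?b * 1 \<le> ?b * (1 + ?z)" using b z by (intro mult_left_mono) auto
  ultimately have "?b \<le> 3 / 32" using bQ by linarith
  then have "?b * ?b \<le> 3 / 32 * ?b" using b by (intro mult_right_mono) auto
  moreover have "?b \<le> 3 / 4 * ?Q" using \<open>?b * 1 \<le> _\<close> bQ by linarith
  moreover have "?Q > 0" using z by simp
  ultimately have neg: "?Q - 2 * (?b * (1 + ?z)) + 3 * (?b * ?b) < 0" using bQ by linarith
  have one: "\<alpha> * (?z * (1 - ?z)) = 1" by (rule alpha_z_mid) (use \<alpha> in simp)
  have "\<alpha> * (1 - 2 * ?z\<^sup>2 + (?z - ?b)\<^sup>2 + (1 - ?z - ?b) * (2 * ?z - 2 * ?b)) - (\<alpha> + 1)
     = \<alpha> * (?Q - 2 * (?b * (1 + ?z)) + 3 * (?b * ?b))"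
    using one by algebra
  also have "\<dots> < 0" using neg \<alpha> by (simp add: mult_pos_neg)
  finally show "mid_rate \<alpha> < 1" unfolding mid_rate_def using \<alpha> by simp
qed

text \<open>A larger fluctuation means a smaller second moment and thus smaller expected squared
  slopes, so from time \<open>T\<close> on \<open>mid_rate \<alpha>\<close> bounds the contraction
  rate. The initial distance 1/4 comes from the equal means.\<close>

lemma moments_contract:
  assumes \<alpha>: "\<alpha> > 4" and \<rho>: "higher_solution \<alpha> \<rho>" and \<sigma>: "higher_solution \<alpha> \<sigma>"
    and m: "mean1 (\<rho> 0) = z_mid \<alpha>" "mean1 (\<sigma> 0) = z_mid \<alpha>"
    and T: "T \<ge> 0" "\<And>t. t \<ge> T \<Longrightarrow> fluct (\<rho> t) \<ge> fluct_threshold \<alpha>" "\<And>t. t \<ge> T \<Longrightarrow> fluct (\<sigma> t) \<ge> fluct_threshold \<alpha>"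
    and \<theta>: "\<theta> \<ge> 0" "exp (- (\<alpha> + 1) * \<theta>) \<le> (1 - mid_rate \<alpha>) / 2" and t: "t \<ge> T + real k * \<theta>"
  shows "\<bar>pexp (\<rho> t) (\<lambda>x. x ^ n) - pexp (\<sigma> t) (\<lambda>x. x ^ n)\<bar> \<le> (real n)\<^sup>2 * (((1 + mid_rate \<alpha>) / 2) ^ k * (1 / 4))"
proof -
  let ?z = "z_mid \<alpha>" and ?b = "fluct_threshold \<alpha>"
  have \<alpha>': "\<alpha> \<ge> 4" "\<alpha> \<ge> 0" using \<alpha> by auto
  have z: "0 < ?z" "?z < 1 / 2" using z_facts(3)[of \<alpha>] z_mid_less_half[OF \<alpha>] \<alpha> by auto
  have P: "\<rho> t \<in> space PP_spin" "\<sigma> t \<in> space PP_spin" "mean1 (\<rho> t) = ?z" "mean1 (\<sigma> t) = ?z" if "t \<ge> 0" for t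
    using that higher_solution_in_space[OF \<rho>] higher_solution_in_space[OF \<sigma>]
      mean_eq_z_mid[OF \<alpha>'(1) \<rho> m(1)] mean_eq_z_mid[OF \<alpha>'(1) \<sigma> m(2)] by auto
  have "close_by (((1 + mid_rate \<alpha>) / 2) ^ k * (1 / 4)) (\<rho> t) (\<sigma> t)"
  proof (rule contraction[OF \<alpha>'(2) \<rho> \<sigma> mid_rate_bounds[OF \<alpha>] \<theta> T(1) _ _ _ t])
    fix t assume t: "t \<ge> T"
    then have t0: "t \<ge> 0" using T by simp
    show "close_by (1 / 4) (\<rho> t) (\<sigma> t)" using P[OF t0] by (intro close_by_equal_means) auto
    define v w where "v = fluct (\<rho> t)" and "w = fluct (\<sigma> t)"
    have b: "?b \<le> v" "?b \<le> w" using T t by (auto simp: v_def w_def)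
    \<comment> \<open>These bounds make the factors below nonnegative, as the monotonicity arguments
      require.\<close>
    have zz: "?z * (1 - ?z) \<le> ?z" "?z * (1 - ?z) \<le> 1 - ?z"
      using z mult_right_mono[of ?z 1 "1 - ?z"] by (auto simp: mult_left_le)
    have le: "v \<le> ?z" "w \<le> ?z" "w \<le> 1 - ?z"
      using fluct_le[OF P(1)[OF t0]] fluct_le[OF P(2)[OF t0]] zz P(3,4)[OF t0] by (auto simp: v_def w_def)
    have "(?z - v)\<^sup>2 \<le> (?z - ?b)\<^sup>2" using b le by (intro power_mono) auto
    moreover have "(1 - ?z - w) * (2 * ?z - v - w) \<le> (1 - ?z - ?b) * (2 * ?z - 2 * ?b)"
      using b le by (intro mult_mono) auto
    ultimately have "\<alpha> * (1 - 2 * ?z\<^sup>2 + (?z - v)\<^sup>2 + (1 - ?z - w) * (2 * ?z - v - w))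
      \<le> \<alpha> * (1 - 2 * ?z\<^sup>2 + (?z - ?b)\<^sup>2 + (1 - ?z - ?b) * (2 * ?z - 2 * ?b))"
      using \<alpha> by (intro mult_left_mono) auto
    also have "\<dots> = mid_rate \<alpha> * (\<alpha> + 1)" using \<alpha> by (simp add: mid_rate_def)
    finally have "\<alpha> * (1 - 2 * ?z\<^sup>2 + (?z - v)\<^sup>2 + (1 - 2 * ?z + (?z - w)) * ((?z - v) + (?z - w))) \<le> mid_rate \<alpha> * (\<alpha> + 1)"
      by (simp add: algebra_simps)
    moreover have "mean2 (\<rho> t) = ?z - v" "mean2 (\<sigma> t) = ?z - w" using P(3,4)[OF t0] by (auto simp: v_def w_def fluct_def)
    ultimately show "\<alpha> * (1 - 2 * (mean1 (\<rho> t))\<^sup>2 + (mean2 (\<rho> t))\<^sup>2 +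
      (1 - 2 * mean1 (\<sigma> t) + mean2 (\<sigma> t)) * (mean2 (\<rho> t) + mean2 (\<sigma> t))) \<le> mid_rate \<alpha> * (\<alpha> + 1)"
      using P(3,4)[OF t0] by simp
  qed simp
  then show ?thesis using curv_power[of n] unfolding close_by_def by simp
qed

lemma exists_time_step:
  assumes "\<alpha> > 4"
  obtains \<theta> where "\<theta> > 0" "exp (- (\<alpha> + 1) * \<theta>) \<le> (1 - mid_rate \<alpha>) / 2"
proof -
  let ?q = "(1 - mid_rate \<alpha>) / 2"
  have q: "0 < ?q" "?q < 1" using mid_rate_bounds[OF assms] by auto
  define \<theta> where "\<theta> = - ln ?q / (\<alpha> + 1)"
  have "ln ?q < 0" using q by (simp add: ln_less_zero)
  then have "\<theta> > 0" unfolding \<theta>_def by (intro divide_pos_pos) (use assms in auto)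
  moreover have "(\<alpha> + 1) * \<theta> = - ln ?q" using assms by (simp add: \<theta>_def)
  then have "- (\<alpha> + 1) * \<theta> = ln ?q" by (metis minus_minus mult_minus_left)
  then have "exp (- (\<alpha> + 1) * \<theta>) = ?q" using q by (simp only: exp_ln)
  ultimately show ?thesis using that by simp
qed

lemma mid_rate_power_tendsto:
  assumes "\<alpha> > 4"
  shows "(\<lambda>k. (real n)\<^sup>2 * (((1 + mid_rate \<alpha>) / 2) ^ k * (1 / 4))) \<longlonglongrightarrow> 0"
proof -
  have "(\<lambda>k. ((1 + mid_rate \<alpha>) / 2) ^ k) \<longlonglongrightarrow> 0"
    by (rule LIMSEQ_power_zero) (use mid_rate_bounds[OF assms] in auto)
  from tendsto_mult_left[OF tendsto_mult_right[OF this, of "1/4"], of "(real n)\<^sup>2"] show ?thesis by simp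
qed

text \<open>The laws of \<open>p1\<close> all live on [0, 1], so they are tight and have a weakly
  convergent subsequence; \<open>bern\<close> carries its limit back to
  \<open>P_spin\<close>.\<close>

lemma moment_limit_point:
  assumes \<rho>: "\<And>N. \<rho> N \<in> space PP_spin"
  obtains r L where "strict_mono (r :: nat \<Rightarrow> nat)" "L \<in> space PP_spin"
    "\<And>n. (\<lambda>N. pexp (\<rho> (r N)) (\<lambda>x. x ^ n)) \<longlonglongrightarrow> pexp L (\<lambda>x. x ^ n)"
proof -
  let ?\<mu> = "\<lambda>N. distr (\<rho> N) borel p1"
  have mp1: "p1 \<in> \<rho> N \<rightarrow>\<^sub>M borel" for N
    using measurable_p1 PP_spinD(2)[OF \<rho>] measurable_cong_sets by blast
  have rd: "real_distribution (?\<mu> N)" for N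
    using prob_space.real_distribution_distr[OF PP_spinD(1)[OF \<rho>]] mp1 by simp
  have "tight ?\<mu>" unfolding tight_def
  proof (intro conjI allI impI rd)
    fix \<epsilon> :: real assume \<epsilon>: "0 < \<epsilon>"
    \<comment> \<open>Tightness is expressed with intervals open on the left, hence the end point
      -1, which lets 0 be included.\<close>
    have "measure (?\<mu> N) {-1<..1} = 1" for N
    proof -
      have "p1 -` {-1<..1} \<inter> space (\<rho> N) = space (\<rho> N)"
      proof -
        have "p1 \<mu> \<in> {-1<..1}" if "\<mu> \<in> space (\<rho> N)" for \<mu>
        proof -
          have "p1 \<mu> \<le> 1" using p1_bounds[of \<mu>] that PP_spinD(3)[OF \<rho>] by auto
          moreover have "0 \<le> p1 \<mu>" by simp
          moreover from this have "-1 < p1 \<mu>" by linarith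
          ultimately show ?thesis by simp
        qed
        then show ?thesis by blast
      qed
      then show ?thesis
        using measure_distr[OF mp1, of "{-1<..1}" N] prob_space.prob_space[OF PP_spinD(1)[OF \<rho>]] by simp
    qed
    then show "\<exists>a b. a < b \<and> (\<forall>N. 1 - \<epsilon> < measure (?\<mu> N) {a<..b})"
      using \<epsilon> by (intro exI[of _ "-1"] exI[of _ 1]) simp
  qed
  from tight_imp_convergent_subsubsequence[OF this strict_mono_id]
  obtain r M where r: "strict_mono (r :: nat \<Rightarrow> nat)" and M: "real_distribution M" and w: "weak_conv_m (?\<mu> \<circ> id \<circ> r) M"
    by blast
  interpret M: real_distribution M by (rule M)
  define L where "L = distr M P_spin bern"
  have mb: "bern \<in> M \<rightarrow>\<^sub>M P_spin" using measurable_bern by simp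
  have L: "L \<in> space PP_spin" unfolding L_def in_PP_spin using M.prob_space_distr[OF mb] by simp
  have "(\<lambda>N. pexp (\<rho> (r N)) (\<lambda>x. x ^ n)) \<longlonglongrightarrow> pexp L (\<lambda>x. x ^ n)" for n
  proof -
    \<comment> \<open>Clipping makes the power bounded and continuous on the real line without
      changing it on [0, 1].\<close>
    let ?f = "\<lambda>x::real. (max 0 (min 1 x)) ^ n"
    have "(\<lambda>N. integral\<^sup>L ((?\<mu> \<circ> id \<circ> r) N) ?f) \<longlonglongrightarrow> integral\<^sup>L M ?f"
    proof (rule weak_conv_imp_integral_bdd_continuous_conv[OF _ M w])
      show "real_distribution ((?\<mu> \<circ> id \<circ> r) N)" for N using rd by simp
      show "isCont ?f x" for x by (intro continuous_intros)
      show "norm (?f x) \<le> 1" for x by (simp add: power_le_one)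
    qed
    also have "(\<lambda>N. integral\<^sup>L ((?\<mu> \<circ> id \<circ> r) N) ?f) = (\<lambda>N. pexp (\<rho> (r N)) (\<lambda>x. x ^ n))"
    proof
      fix N
      have "integral\<^sup>L ((?\<mu> \<circ> id \<circ> r) N) ?f = pexp (\<rho> (r N)) ?f"
        unfolding pexp_def o_def id_def by (rule integral_distr[OF mp1]) simp
      also have "\<dots> = pexp (\<rho> (r N)) (\<lambda>x. x ^ n)" by (rule pexp_cong[OF \<rho>]) auto
      finally show "integral\<^sup>L ((?\<mu> \<circ> id \<circ> r) N) ?f = pexp (\<rho> (r N)) (\<lambda>x. x ^ n)" .
    qed
    also have "integral\<^sup>L M ?f = pexp L (\<lambda>x. x ^ n)"
      unfolding pexp_def L_def by (subst integral_distr[OF mb]) (auto simp: p1_bern)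
    finally show ?thesis .
  qed
  then show ?thesis using that r L by blast
qed

text \<open>A reference solution is started in the point mass at
  \<open>bern (z_mid \<alpha>)\<close>, and \<open>L\<close> is a limit point of it along integer
  times. Contraction against its own time shifts upgrades this to convergence; contraction against
  any other admissible solution transfers the limit.\<close>

lemma exists_mid_limit:
  assumes \<alpha>: "\<alpha> > 4"
  obtains L where "L \<in> space PP_spin"
    "\<And>\<sigma>. higher_solution \<alpha> \<sigma> \<Longrightarrow> mean1 (\<sigma> 0) = z_mid \<alpha> \<Longrightarrow> fluct (\<sigma> 0) > 0 \<Longrightarrow> limitin PP_top \<sigma> L at_top"
    "fluct L > 0"
proof -
  let ?z = "z_mid \<alpha>"
  have \<alpha>': "\<alpha> \<ge> 4" "\<alpha> \<ge> 0" using \<alpha> by auto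
  have z: "0 < ?z" "?z < 1 / 2" using z_facts(3)[of \<alpha>] z_mid_less_half[OF \<alpha>] \<alpha> by auto
  define \<rho>0 where "\<rho>0 = return P_spin (bern ?z)"
  have \<rho>0: "\<rho>0 \<in> space PP_spin" by (simp add: \<rho>0_def)
  define \<rho> where "\<rho> = wild_sum \<alpha> \<rho>0"
  have \<rho>: "higher_solution \<alpha> \<rho>" and \<rho>0': "\<rho> 0 = \<rho>0" unfolding \<rho>_def using wild_sum_solution[OF \<alpha>'(2) \<rho>0] by auto
  have E: "pexp \<rho>0 (\<lambda>x. x ^ n) = ?z ^ n" for n using z by (simp add: \<rho>0_def pexp_return p1_bern)
  have m0: "mean1 (\<rho> 0) = ?z" using E[of 1] by (simp add: \<rho>0')
  have v0: "fluct (\<rho> 0) > 0" using E[of 1] E[of 2] z by (simp add: fluct_def \<rho>0' power2_eq_square)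
  obtain T where T: "T \<ge> 0" "\<And>t. t \<ge> T \<Longrightarrow> fluct (\<rho> t) \<ge> fluct_threshold \<alpha>"
    using eventually_fluct_ge[OF \<alpha> \<rho> m0 v0] by blast
  obtain \<theta> where \<theta>: "\<theta> > 0" "exp (- (\<alpha> + 1) * \<theta>) \<le> (1 - mid_rate \<alpha>) / 2" by (rule exists_time_step[OF \<alpha>])
  have sp: "\<rho> (real N) \<in> space PP_spin" for N by (rule higher_solution_in_space[OF \<rho>]) simp
  obtain r L where r: "strict_mono (r :: nat \<Rightarrow> nat)" and L: "L \<in> space PP_spin"
    and lim: "\<And>n. (\<lambda>N. pexp (\<rho> (real (r N))) (\<lambda>x. x ^ n)) \<longlonglongrightarrow> pexp L (\<lambda>x. x ^ n)"
    by (rule moment_limit_point[of "\<lambda>N. \<rho> (real N)", OF sp]) blast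
  let ?e = "\<lambda>n k. (real n)\<^sup>2 * (((1 + mid_rate \<alpha>) / 2) ^ k * (1 / 4))"
  \<comment> \<open>One error stems from passing from \<open>\<sigma>\<close> to the reference
    solution, the other from passing from there to \<open>L\<close>.\<close>
  have near: "\<bar>pexp (\<sigma> t) (\<lambda>x. x ^ n) - pexp L (\<lambda>x. x ^ n)\<bar> \<le> 2 * ?e n k"
    if \<sigma>: "higher_solution \<alpha> \<sigma>" "mean1 (\<sigma> 0) = ?z"
      and T': "T' \<ge> T" "\<And>t. t \<ge> T' \<Longrightarrow> fluct (\<sigma> t) \<ge> fluct_threshold \<alpha>" and t: "t \<ge> T' + real k * \<theta>" for \<sigma> T' t n k
  proof -
    have t0: "t \<ge> T'" "t \<ge> 0" "t \<ge> T + real k * \<theta>" using t T' T(1) \<theta>(1) by (auto intro: order_trans[rotated])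
    have 1: "\<bar>pexp (\<sigma> t) (\<lambda>x. x ^ n) - pexp (\<rho> t) (\<lambda>x. x ^ n)\<bar> \<le> ?e n k"
      by (rule moments_contract[OF \<alpha> \<sigma>(1) \<rho> \<sigma>(2) m0 _ T'(2) _ _ \<theta>(2) t]) (use T T' \<theta> in auto)
    have "\<forall>\<^sub>F N in sequentially. \<bar>pexp (\<rho> t) (\<lambda>x. x ^ n) - pexp (\<rho> (real (r N))) (\<lambda>x. x ^ n)\<bar> \<le> ?e n k"
      using eventually_ge_at_top[of "nat \<lceil>t\<rceil>"]
    proof eventually_elim
      case (elim N)
      have "t \<le> real (nat \<lceil>t\<rceil>)" by (rule real_nat_ceiling_ge)
      also have "\<dots> \<le> real N" using elim by simp
      also have "\<dots> \<le> real (r N)" using strict_mono_imp_increasing[OF r, of N] by simp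
      finally have s: "real (r N) - t \<ge> 0" by simp
      \<comment> \<open>A comparison of one solution at two times becomes a comparison of two
        solutions at time \<open>t\<close>.\<close>
      let ?s = "real (r N) - t"
      have sh: "higher_solution \<alpha> (\<lambda>u. \<rho> (u + ?s))" by (rule higher_solution_shift[OF \<alpha>'(2) \<rho> s])
      have "\<bar>pexp (\<rho> t) (\<lambda>x. x ^ n) - pexp (\<rho> (t + ?s)) (\<lambda>x. x ^ n)\<bar> \<le> ?e n k"
        by (rule moments_contract[OF \<alpha> \<rho> sh m0 _ T(1,2) _ _ \<theta>(2) t0(3)])
          (use T \<theta> s mean_eq_z_mid[OF \<alpha>'(1) \<rho> m0 s] in auto)
      then show ?case by simp
    qed
    then have 2: "\<bar>pexp (\<rho> t) (\<lambda>x. x ^ n) - pexp L (\<lambda>x. x ^ n)\<bar> \<le> ?e n k"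
      by (intro tendsto_upperbound[OF tendsto_rabs[OF tendsto_diff[OF tendsto_const lim]]]) auto
    show ?thesis using 1 2 by linarith
  qed
  have conv: "limitin PP_top \<sigma> L at_top"
    if \<sigma>: "higher_solution \<alpha> \<sigma>" "mean1 (\<sigma> 0) = ?z" and v: "fluct (\<sigma> 0) > 0" for \<sigma>
    unfolding limitin_PP_top_moments[OF eventually_in_space[OF \<sigma>(1)] L]
  proof (intro allI tendstoI)
    fix n :: nat and e :: real assume e: "e > 0"
    obtain T'' where T'': "\<And>t. t \<ge> T'' \<Longrightarrow> fluct (\<sigma> t) \<ge> fluct_threshold \<alpha>"
      using eventually_fluct_ge[OF \<alpha> \<sigma> v] by blast
    define T' where "T' = max T T''"
    obtain k where k: "?e n k < e / 2"
      using order_tendstoD(2)[OF mid_rate_power_tendsto[OF \<alpha>, of n], of "e / 2"] e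
      by (auto simp: eventually_sequentially)
    have "\<forall>\<^sub>F t in at_top. t \<ge> T' + real k * \<theta>" by (rule eventually_ge_at_top)
    then show "\<forall>\<^sub>F t in at_top. dist (pexp (\<sigma> t) (\<lambda>x. x ^ n)) (pexp L (\<lambda>x. x ^ n)) < e"
    proof eventually_elim
      case (elim t)
      have "\<bar>pexp (\<sigma> t) (\<lambda>x. x ^ n) - pexp L (\<lambda>x. x ^ n)\<bar> \<le> 2 * ?e n k"
        by (rule near[OF \<sigma> _ _ elim]) (use T'' in \<open>auto simp: T'_def\<close>)
      then show ?case using k unfolding dist_real_def by linarith
    qed
  qed
  have m: "((\<lambda>t. pexp (\<rho> t) (\<lambda>x. x ^ n)) \<longlongrightarrow> pexp L (\<lambda>x. x ^ n)) at_top" for n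
    using conv[OF \<rho> m0 v0] unfolding limitin_PP_top_moments[OF eventually_in_space[OF \<rho>] L] by blast
  have "((\<lambda>t. fluct (\<rho> t)) \<longlongrightarrow> fluct L) at_top"
    unfolding fluct_def using tendsto_diff[OF m[of 1] m[of 2]] by simp
  moreover have "\<forall>\<^sub>F t in at_top. fluct_threshold \<alpha> \<le> fluct (\<rho> t)"
    using eventually_ge_at_top[of T] by eventually_elim (rule T(2))
  \<comment> \<open>The threshold survives in the limit and separates \<open>L\<close> from
    \<open>nu_over (nu_mid \<alpha>)\<close>.\<close>
  ultimately have "fluct_threshold \<alpha> \<le> fluct L" by (intro tendsto_lowerbound) auto
  then have "fluct L > 0" using fluct_threshold_pos[OF \<alpha>] by simp
  with conv L show ?thesis using that by blast
qed

section \<open>Limits of solutions are fixed points\<close>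

text \<open>The binomial expansion of (x + (1 - x) y z)^n separates the variables. The cubic term
  thus becomes a polynomial in expectations of continuous functions and passes to weak
  limits.\<close>

lemma cobE_power_sum:
  assumes \<rho>: "\<rho> \<in> space PP_spin"
  shows "cobE \<rho> \<rho> \<rho> (\<lambda>x. x ^ n) = (\<Sum>k\<le>n. real (n choose k) * pexp \<rho> (\<lambda>x. x ^ k * (1 - x) ^ (n - k)) * (pexp \<rho> (\<lambda>x. x ^ (n - k)))\<^sup>2)"
proof -
  have b: "bdd_test (\<lambda>x. c * (x ^ k * (1 - x) ^ j))" for c k j
    by (intro bdd_test_continuous_UNIV continuous_intros)
  have e: "(\<lambda>z. (cob_poly x y z) ^ n) = (\<lambda>z. \<Sum>k\<le>n. (real (n choose k) * x ^ k * (1 - x) ^ (n - k) * y ^ (n - k)) * z ^ (n - k))" for x y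
    by (auto simp: binomial_ring power_mult_distrib mult.assoc fun_eq_iff intro!: sum.cong)
  have 1: "pexp \<rho> (\<lambda>z. (cob_poly x y z) ^ n)
     = (\<Sum>k\<le>n. (real (n choose k) * x ^ k * (1 - x) ^ (n - k) * pexp \<rho> (\<lambda>z. z ^ (n - k))) * y ^ (n - k))" for x y
    unfolding e
  proof (subst pexp_sum[OF \<rho>])
    show "(\<Sum>k\<le>n. pexp \<rho> (\<lambda>z. (real (n choose k) * x ^ k * (1 - x) ^ (n - k) * y ^ (n - k)) * z ^ (n - k)))
      = (\<Sum>k\<le>n. (real (n choose k) * x ^ k * (1 - x) ^ (n - k) * pexp \<rho> (\<lambda>z. z ^ (n - k))) * y ^ (n - k))"
      unfolding pexp_cmult by (simp only: mult_ac)
  qed (intro bdd_test_cmult bdd_test_polys)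
  have 2: "pexp \<rho> (\<lambda>y. pexp \<rho> (\<lambda>z. (cob_poly x y z) ^ n))
     = (\<Sum>k\<le>n. (real (n choose k) * (pexp \<rho> (\<lambda>z. z ^ (n - k)))\<^sup>2) * (x ^ k * (1 - x) ^ (n - k)))" for x
    unfolding 1
  proof (subst pexp_sum[OF \<rho>])
    show "(\<Sum>k\<le>n. pexp \<rho> (\<lambda>y. (real (n choose k) * x ^ k * (1 - x) ^ (n - k) * pexp \<rho> (\<lambda>z. z ^ (n - k))) * y ^ (n - k)))
      = (\<Sum>k\<le>n. (real (n choose k) * (pexp \<rho> (\<lambda>z. z ^ (n - k)))\<^sup>2) * (x ^ k * (1 - x) ^ (n - k)))"
      unfolding pexp_cmult by (simp only: mult_ac power2_eq_square)
  qed (intro bdd_test_cmult bdd_test_polys)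
  show ?thesis
    unfolding cobE_def 2
  proof (subst pexp_sum[OF \<rho>])
    show "(\<Sum>k\<le>n. pexp \<rho> (\<lambda>x. (real (n choose k) * (pexp \<rho> (\<lambda>z. z ^ (n - k)))\<^sup>2) * (x ^ k * (1 - x) ^ (n - k))))
      = (\<Sum>k\<le>n. real (n choose k) * pexp \<rho> (\<lambda>x. x ^ k * (1 - x) ^ (n - k)) * (pexp \<rho> (\<lambda>x. x ^ (n - k)))\<^sup>2)"
      unfolding pexp_cmult by (simp only: mult_ac)
  qed (rule b)
qed

text \<open>Each moment converges and so does its derivative, by \<open>cobE_power_sum\<close>. The
  limit of the derivative must vanish, which is the fixed point equation for that moment.\<close>

lemma limit_is_fixed_point:
  assumes \<alpha>: "\<alpha> \<ge> 0" and sol: "higher_solution \<alpha> \<rho>" and lim: "limitin PP_top \<rho> L at_top"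
  shows "L \<in> space PP_spin" "T_check \<alpha> L = L"
proof -
  show L: "L \<in> space PP_spin" using lim topspace_weak_topology by (metis limitin_topspace)
  have m: "((\<lambda>t. pexp (\<rho> t) (\<lambda>x. x ^ n)) \<longlongrightarrow> pexp L (\<lambda>x. x ^ n)) at_top" for n
    using lim unfolding limitin_PP_top_moments[OF eventually_in_space[OF sol] L] by blast
  have c: "((\<lambda>t. pexp (\<rho> t) h) \<longlongrightarrow> pexp L h) at_top" if "continuous_on UNIV h" for h
    by (rule tendsto_pexp_of_moments[OF eventually_in_space[OF sol] L m that])
  show "T_check \<alpha> L = L"
  proof (rule PP_spin_eqI[OF T_check_in_PP_spin[OF L \<alpha>] L])
    fix n :: nat
    let ?h = "\<lambda>x::real. x ^ n"
    have o: "ode_on 0 (\<lambda>t. pexp (\<rho> t) ?h) (\<lambda>t. \<alpha> * cobE (\<rho> t) (\<rho> t) (\<rho> t) ?h + ?h 0 - (\<alpha> + 1) * pexp (\<rho> t) ?h)"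
      using sol unfolding higher_solution_iff[OF \<alpha>] by blast
    have "((\<lambda>t. \<Sum>k\<le>n. real (n choose k) * pexp (\<rho> t) (\<lambda>x. x ^ k * (1 - x) ^ (n - k)) * (pexp (\<rho> t) (\<lambda>x. x ^ (n - k)))\<^sup>2)
      \<longlongrightarrow> cobE L L L ?h) at_top"
      unfolding cobE_power_sum[OF L] by (intro tendsto_intros m c continuous_intros)
    then have "((\<lambda>t. cobE (\<rho> t) (\<rho> t) (\<rho> t) ?h) \<longlongrightarrow> cobE L L L ?h) at_top"
      by (rule Lim_transform_eventually)
        (use eventually_in_space[OF sol] in \<open>eventually_elim, simp add: cobE_power_sum\<close>)
    then have "((\<lambda>t. \<alpha> * cobE (\<rho> t) (\<rho> t) (\<rho> t) ?h + ?h 0 - (\<alpha> + 1) * pexp (\<rho> t) ?h)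
       \<longlongrightarrow> \<alpha> * cobE L L L ?h + ?h 0 - (\<alpha> + 1) * pexp L ?h) at_top"
      by (intro tendsto_intros m)
    from ode_on_limit_derivative[OF o m this]
    have "\<alpha> * cobE L L L ?h + ?h 0 = (\<alpha> + 1) * pexp L ?h" by simp
    then show "pexp (T_check \<alpha> L) ?h = pexp L ?h" using \<alpha> by (simp add: pexp_T_check[OF L bdd_test_polys(3) \<alpha>])
  qed
qed

lemma fixed_point_is_solution:
  assumes "\<rho> \<in> space PP_spin" "T_check \<alpha> \<rho> = \<rho>"
  shows "higher_solution \<alpha> (\<lambda>_. \<rho>)"
  using assms by (simp add: higher_solution_def)

section \<open>Domains of attraction\<close>

lemma measure_mean_measure:
  assumes "\<rho> \<in> space PP_spin"
  shows "measure (mean_measure \<rho>) {True} = mean1 \<rho>"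
proof -
  interpret prob_space \<rho> using PP_spinD[OF assms] by simp
  have "(\<lambda>\<mu>. \<mu>) \<in> \<rho> \<rightarrow>\<^sub>M prob_algebra spin"
    using PP_spinD(2)[OF assms] measurable_ident_sets by blast
  then have "(\<lambda>\<mu>. \<mu>) \<in> \<rho> \<rightarrow>\<^sub>M subprob_algebra spin" by (rule measurable_prob_algebraD)
  from measure_bind[OF this, of "{True}"] show ?thesis by (simp add: mean_measure_def pexp_def)
qed

text \<open>The Wild sum supplies the existence half of \<open>attracted_to\<close>.\<close>

lemma attracted_toI:
  assumes "\<alpha> \<ge> 0" "\<rho>0 \<in> space PP_spin"
    and "\<And>\<rho>. higher_solution \<alpha> \<rho> \<Longrightarrow> \<rho> 0 = \<rho>0 \<Longrightarrow> limitin PP_top \<rho> L at_top"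
  shows "attracted_to \<alpha> \<rho>0 L"
  unfolding attracted_to_def
proof (intro conjI exI[of _ "wild_sum \<alpha> \<rho>0"] allI impI)
  show "higher_solution \<alpha> (wild_sum \<alpha> \<rho>0)" "wild_sum \<alpha> \<rho>0 0 = \<rho>0"
    by (rule wild_sum_solution[OF assms(1,2)])+
  show "limitin PP_top \<rho> L at_top" if "higher_solution \<alpha> \<rho> \<and> \<rho> 0 = \<rho>0" for \<rho>
    using that assms(3) by blast
qed

lemma attracted_toE:
  assumes "attracted_to \<alpha> \<rho>0 L"
  obtains \<rho> where "higher_solution \<alpha> \<rho>" "\<rho> 0 = \<rho>0" "limitin PP_top \<rho> L at_top"
  using assms unfolding attracted_to_def by blast

lemma attracted_toD:
  assumes "attracted_to \<alpha> \<rho>0 L" "higher_solution \<alpha> \<rho>" "\<rho> 0 = \<rho>0"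
  shows "limitin PP_top \<rho> L at_top"
  using assms unfolding attracted_to_def by blast

lemma attracted_to_unique:
  assumes "attracted_to \<alpha> \<rho>0 L" "attracted_to \<alpha> \<rho>0 L'"
  shows "L = L'"
proof -
  obtain \<rho> where \<rho>: "higher_solution \<alpha> \<rho>" "\<rho> 0 = \<rho>0" "limitin PP_top \<rho> L at_top"
    by (rule attracted_toE[OF assms(1)])
  show ?thesis
    by (rule limitin_PP_top_unique[OF \<rho>(3) attracted_toD[OF assms(2) \<rho>(1,2)] higher_solution_in_space[OF \<rho>(1)]])
qed

lemma nu_under_eqI:
  assumes "attracted_to \<alpha> (return P_spin \<nu>) L"
  shows "nu_under \<alpha> \<nu> = L"
  unfolding nu_under_def
proof (rule the_equality)
  show "attracted_to \<alpha> (return P_spin \<nu>) L" by (rule assms)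
  show "L' = L" if "attracted_to \<alpha> (return P_spin \<nu>) L'" for L'
    by (rule attracted_to_unique[OF that assms])
qed

lemma attracted_to_imp_fixed:
  assumes "\<alpha> \<ge> 0" "attracted_to \<alpha> \<rho>0 L"
  shows "L \<in> higher_fixed_points \<alpha>"
proof -
  obtain \<rho> where "higher_solution \<alpha> \<rho>" "limitin PP_top \<rho> L at_top"
    by (rule attracted_toE[OF assms(2)])
  from limit_is_fixed_point[OF assms(1) this] show ?thesis by (simp add: higher_fixed_points_def)
qed

text \<open>A fixed point is a constant solution, which converges to itself, and limits are
  unique.\<close>

lemma fixed_point_limit:
  assumes "\<rho> \<in> higher_fixed_points \<alpha>" "attracted_to \<alpha> \<rho> L"
  shows "\<rho> = L"
proof -
  have \<rho>: "\<rho> \<in> space PP_spin" "T_check \<alpha> \<rho> = \<rho>" using assms(1) by (auto simp: higher_fixed_points_def)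
  have self: "limitin PP_top (\<lambda>_. \<rho>) \<rho> at_top"
    using \<rho>(1) by (simp add: limitin_const_iff topspace_weak_topology)
  show ?thesis
    by (rule limitin_PP_top_unique[OF self attracted_toD[OF assms(2) fixed_point_is_solution[OF \<rho>] refl] \<rho>(1)])
qed

text \<open>Here \<open>f\<close> sends an initial law to its limit: fixed points are their own
  limits, and limits are fixed points.\<close>

lemma higher_fixed_points_eq:
  assumes \<alpha>: "\<alpha> \<ge> 0" and f: "\<And>\<rho>. \<rho> \<in> space PP_spin \<Longrightarrow> attracted_to \<alpha> \<rho> (f \<rho>)"
  shows "higher_fixed_points \<alpha> = f ` space PP_spin"
proof
  show "higher_fixed_points \<alpha> \<subseteq> f ` space PP_spin"
  proof
    fix \<rho> assume fp: "\<rho> \<in> higher_fixed_points \<alpha>"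
    then have P: "\<rho> \<in> space PP_spin" by (simp add: higher_fixed_points_def)
    show "\<rho> \<in> f ` space PP_spin" using fixed_point_limit[OF fp f[OF P]] P by blast
  qed
  show "f ` space PP_spin \<subseteq> higher_fixed_points \<alpha>"
    using attracted_to_imp_fixed[OF \<alpha> f] by blast
qed

text \<open>By uniqueness of limits the domains of attraction are the fibres of
  \<open>f\<close>.\<close>

lemma attraction_domain_eq:
  assumes f: "\<And>\<rho>. \<rho> \<in> space PP_spin \<Longrightarrow> attracted_to \<alpha> \<rho> (f \<rho>)"
  shows "attraction_domain \<alpha> L = {\<rho> \<in> space PP_spin. f \<rho> = L}"
proof -
  have "attracted_to \<alpha> \<rho> L \<longleftrightarrow> f \<rho> = L" if P: "\<rho> \<in> space PP_spin" for \<rho>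
  proof
    show "f \<rho> = L" if "attracted_to \<alpha> \<rho> L" by (rule attracted_to_unique[OF f[OF P] that])
    show "attracted_to \<alpha> \<rho> L" if "f \<rho> = L" using f[OF P] unfolding that .
  qed
  then have "\<rho> \<in> attraction_domain \<alpha> L \<longleftrightarrow> \<rho> \<in> {\<rho> \<in> space PP_spin. f \<rho> = L}" for \<rho>
    unfolding attraction_domain_def mem_Collect_eq by (rule conj_cong[OF refl])
  then show ?thesis by (rule set_eqI)
qed

section \<open>Limits for each kind of initial law\<close>

lemma converges_to_low:
  assumes "\<alpha> \<ge> 4" "higher_solution \<alpha> \<rho>" "mean1 (\<rho> 0) < z_mid \<alpha>"
  shows "limitin PP_top \<rho> (nu_over nu_low) at_top"
  by (rule limitin_nu_low[OF assms(2) mean_tendsto_0[OF assms]])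

text \<open>At w = \<open>z_upp \<alpha>\<close> the linear rate of the fluctuation is \<alpha> (2 w
  - 3 w^2) - 1 = \<alpha> w (1 - 2 w), which is nonpositive because w is at least 1/2.\<close>

lemma converges_to_upp:
  assumes \<alpha>: "\<alpha> \<ge> 4" and sol: "higher_solution \<alpha> \<rho>" and m: "((\<lambda>t. mean1 (\<rho> t)) \<longlongrightarrow> z_upp \<alpha>) at_top"
  shows "limitin PP_top \<rho> (nu_over (nu_upp \<alpha>)) at_top"
  unfolding nu_upp_def
proof (rule limitin_nu_over[OF sol _ _ m])
  show "0 \<le> z_upp \<alpha>" "z_upp \<alpha> \<le> 1" using z_facts(5,6)[OF \<alpha>] by auto
  show "((\<lambda>t. fluct (\<rho> t)) \<longlongrightarrow> 0) at_top"
  proof (rule fluct_tendsto_0[OF _ sol m])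
    have "\<alpha> * (2 * z_upp \<alpha> - 3 * (z_upp \<alpha>)\<^sup>2) = 1 + \<alpha> * (z_upp \<alpha> * (1 - 2 * z_upp \<alpha>))"
      using z_facts(1,2)[OF \<alpha>] by algebra
    moreover have "\<alpha> * (z_upp \<alpha> * (1 - 2 * z_upp \<alpha>)) \<le> 0"
      using \<alpha> z_facts(5)[OF \<alpha>] by (intro mult_nonneg_nonpos) auto
    ultimately show "\<alpha> * (2 * z_upp \<alpha> - 3 * (z_upp \<alpha>)\<^sup>2) \<le> 1" by simp
  qed (use \<alpha> in simp)
qed

text \<open>The drift is the fluctuation times a bounded factor, so \<open>ode_on_zero\<close>
  applies.\<close>

lemma fluct_stays_0:
  assumes \<alpha>: "\<alpha> \<ge> 0" and sol: "higher_solution \<alpha> \<rho>" and v0: "fluct (\<rho> 0) = 0" and t: "t \<ge> 0"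
  shows "fluct (\<rho> t) = 0"
proof (rule ode_on_zero[OF fluct_ode[OF \<alpha> sol] v0 _ t])
  fix t :: real assume t: "0 \<le> t"
  let ?m = "mean1 (\<rho> t)" and ?v = "fluct (\<rho> t)"
  have P: "\<rho> t \<in> space PP_spin" by (rule higher_solution_in_space[OF sol t])
  have m: "0 \<le> ?m" "?m \<le> 1" using mean1_bounds[OF P] .
  have "?m * (1 - ?m) \<le> 1" using m by (intro mult_le_one) auto
  then have v: "0 \<le> ?v" "?v \<le> 1" using fluct_nonneg[OF P] fluct_le[OF P] by auto
  have "0 \<le> ?m\<^sup>2" "?m\<^sup>2 \<le> 1" "0 \<le> ?v\<^sup>2" "?v\<^sup>2 \<le> 1" using m v by (auto simp: power_le_one)
  moreover have "?v * (1 + ?m) \<le> 1 * 2" by (rule mult_mono) (use m v in auto)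
  moreover have "0 \<le> ?v * (1 + ?m)" using m v by simp
  moreover define X where "X = 2 * ?m - 3 * ?m\<^sup>2 - ?v * (1 + ?m) + ?v\<^sup>2"
  \<comment> \<open>The four terms of \<open>X\<close> are at most 2, 3, 2 and 1 in absolute
    value.\<close>
  ultimately have "\<bar>X\<bar> \<le> 8" using m unfolding abs_le_iff by linarith
  then have "\<bar>\<alpha> * X\<bar> \<le> \<alpha> * 8" using \<alpha> by (simp add: abs_mult mult_left_mono)
  then have "\<bar>\<alpha> * X - 1\<bar> \<le> \<alpha> * 8 + 1" by linarith
  then have "\<bar>?v\<bar> * \<bar>\<alpha> * X - 1\<bar> \<le> \<bar>?v\<bar> * (\<alpha> * 8 + 1)"
    by (rule mult_left_mono) simp
  then show "\<bar>?v * (\<alpha> * (2 * ?m - 3 * ?m\<^sup>2 - ?v * (1 + ?m) + ?v\<^sup>2) - 1)\<bar> \<le> (\<alpha> * 8 + 1) * \<bar>?v\<bar>"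
    unfolding X_def[symmetric] by (simp only: abs_mult mult.commute)
qed

text \<open>Without fluctuation, \<open>moment_near_mean\<close> makes all moments of positive order
  equal to the mean.\<close>

lemma nu_over_eqI:
  assumes "\<rho> \<in> space PP_spin" "fluct \<rho> = 0"
  shows "\<rho> = nu_over (bern (mean1 \<rho>))"
proof (rule PP_spin_eqI[OF assms(1) nu_over_in_PP_spin])
  fix n :: nat
  have z: "0 \<le> mean1 \<rho>" "mean1 \<rho> \<le> 1" using mean1_bounds[OF assms(1)] .
  show "pexp \<rho> (\<lambda>x. x ^ n) = pexp (nu_over (bern (mean1 \<rho>))) (\<lambda>x. x ^ n)"
    unfolding pexp_nu_over[OF z bdd_test_polys(3)]
    using moment_near_mean[OF assms(1), of "n - 1"] assms by (cases n) auto
qed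

lemma converges_to_mid:
  assumes \<alpha>: "\<alpha> \<ge> 4" and sol: "higher_solution \<alpha> \<rho>" and \<rho>0: "\<rho> 0 = nu_over (nu_mid \<alpha>)"
  shows "limitin PP_top \<rho> (nu_over (nu_mid \<alpha>)) at_top"
  unfolding nu_mid_def
proof (rule limitin_nu_over[OF sol])
  show z: "0 \<le> z_mid \<alpha>" "z_mid \<alpha> \<le> 1" using z_facts(3,4)[OF \<alpha>] by auto
  have 0: "mean1 (\<rho> 0) = z_mid \<alpha>" "fluct (\<rho> 0) = 0"
    unfolding \<rho>0 nu_mid_def by (rule mean1_nu_over[OF z], rule fluct_nu_over[OF z])
  have "\<forall>\<^sub>F t in at_top. mean1 (\<rho> t) = z_mid \<alpha>" "\<forall>\<^sub>F t in at_top. fluct (\<rho> t) = 0"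
    using eventually_ge_at_top[of "0::real"]
    by (eventually_elim, use mean_eq_z_mid[OF \<alpha> sol 0(1)] fluct_stays_0[OF _ sol 0(2)] \<alpha> in simp)+
  then show "((\<lambda>t. mean1 (\<rho> t)) \<longlongrightarrow> z_mid \<alpha>) at_top" "((\<lambda>t. fluct (\<rho> t)) \<longlongrightarrow> 0) at_top"
    by (auto intro: tendsto_eventually)
qed

lemma mean1_return: "0 \<le> z \<Longrightarrow> z \<le> 1 \<Longrightarrow> mean1 (return P_spin (bern z)) = z"
  and fluct_return: "0 \<le> z \<Longrightarrow> z \<le> 1 \<Longrightarrow> fluct (return P_spin (bern z)) = z * (1 - z)"
  by (simp_all add: pexp_return fluct_def p1_bern) (simp add: power2_eq_square algebra_simps)

lemma supercritical:
  assumes \<alpha>: "\<alpha> > 4"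
  shows "nu_under \<alpha> nu_low = nu_over nu_low \<and>
        nu_under \<alpha> (nu_upp \<alpha>) = nu_over (nu_upp \<alpha>) \<and>
        nu_under \<alpha> (nu_mid \<alpha>) \<noteq> nu_over (nu_mid \<alpha>) \<and>
        higher_fixed_points \<alpha> =
          {nu_over nu_low, nu_under \<alpha> (nu_mid \<alpha>), nu_over (nu_mid \<alpha>), nu_over (nu_upp \<alpha>)} \<and>
        card (higher_fixed_points \<alpha>) = 4 \<and>
        (\<forall>\<rho>. higher_solution \<alpha> \<rho> \<longrightarrow>
           (\<exists>L \<in> {nu_over nu_low, nu_under \<alpha> (nu_mid \<alpha>), nu_over (nu_mid \<alpha>), nu_over (nu_upp \<alpha>)}.
              limitin PP_top \<rho> L at_top)) \<and>
        attraction_domain \<alpha> (nu_over nu_low) =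
          {\<rho>0 \<in> space PP_spin. measure (mean_measure \<rho>0) {True} < z_mid \<alpha>} \<and>
        attraction_domain \<alpha> (nu_under \<alpha> (nu_mid \<alpha>)) =
          {\<rho>0 \<in> space PP_spin. measure (mean_measure \<rho>0) {True} = z_mid \<alpha> \<and>
             \<rho>0 \<noteq> nu_over (nu_mid \<alpha>)} \<and>
        attraction_domain \<alpha> (nu_over (nu_mid \<alpha>)) = {nu_over (nu_mid \<alpha>)} \<and>
        attraction_domain \<alpha> (nu_over (nu_upp \<alpha>)) =
          {\<rho>0 \<in> space PP_spin. measure (mean_measure \<rho>0) {True} > z_mid \<alpha>}"
proof -
  have \<alpha>': "\<alpha> \<ge> 4" "\<alpha> \<ge> 0" using \<alpha> by auto
  let ?z = "z_mid \<alpha>" and ?w = "z_upp \<alpha>"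
  note zs = z_facts[OF \<alpha>'(1)]
  have z: "0 < ?z" "?z < 1" "0 \<le> ?z" "?z \<le> 1" "0 \<le> ?w" "?w \<le> 1" "?z < ?w" using zs \<alpha> by auto
  obtain U where U: "U \<in> space PP_spin" "fluct U > 0"
    and to_U: "\<And>\<sigma>. higher_solution \<alpha> \<sigma> \<Longrightarrow> mean1 (\<sigma> 0) = ?z \<Longrightarrow> fluct (\<sigma> 0) > 0 \<Longrightarrow> limitin PP_top \<sigma> U at_top"
    by (rule exists_mid_limit[OF \<alpha>]) blast
  define A M Z where "A = nu_over nu_low" and "M = nu_over (nu_mid \<alpha>)" and "Z = nu_over (nu_upp \<alpha>)"
  have PP: "A \<in> space PP_spin" "M \<in> space PP_spin" "Z \<in> space PP_spin"
    unfolding A_def M_def Z_def nu_low_def nu_mid_def nu_upp_def by (rule nu_over_in_PP_spin)+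
  have means: "mean1 A = 0" "mean1 M = ?z" "fluct M = 0" "mean1 Z = ?w"
    unfolding A_def M_def Z_def nu_low_def nu_mid_def nu_upp_def z_low_def
    using z by (auto simp: mean1_nu_over fluct_nu_over)
  \<comment> \<open>The limit as a function of the initial law; its range and its fibres yield the
    fixed points and the domains.\<close>
  define f where "f \<rho> = (if mean1 \<rho> < ?z then A else if mean1 \<rho> > ?z then Z else if \<rho> = M then M else U)" for \<rho>
  have conv: "limitin PP_top \<rho> (f (\<rho> 0)) at_top" if sol: "higher_solution \<alpha> \<rho>" for \<rho>
  proof -
    have P: "\<rho> 0 \<in> space PP_spin" by (rule higher_solution_in_space[OF sol]) simp
    consider "mean1 (\<rho> 0) < ?z" | "mean1 (\<rho> 0) > ?z" | "mean1 (\<rho> 0) = ?z" "\<rho> 0 = M" | "mean1 (\<rho> 0) = ?z" "\<rho> 0 \<noteq> M" by linarith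
    then show ?thesis
    proof cases
      case 1 then show ?thesis using converges_to_low[OF \<alpha>'(1) sol] by (simp add: f_def A_def)
    next
      case 2
      then show ?thesis using converges_to_upp[OF \<alpha>'(1) sol mean_tendsto_z_upp[OF \<alpha> sol]] by (simp add: f_def Z_def)
    next
      case 3 then show ?thesis using converges_to_mid[OF \<alpha>'(1) sol] means by (simp add: f_def M_def)
    next
      case 4
      \<comment> \<open>Among the laws with this mean, \<open>M\<close> is the only one without
        fluctuation.\<close>
      have "fluct (\<rho> 0) \<noteq> 0" using nu_over_eqI[OF P] 4 by (auto simp: M_def nu_mid_def)
      then have "fluct (\<rho> 0) > 0" using fluct_nonneg[OF P] by simp
      then show ?thesis using to_U[OF sol] 4 by (simp add: f_def)
    qed
  qed
  have att: "attracted_to \<alpha> \<rho> (f \<rho>)" if "\<rho> \<in> space PP_spin" for \<rho>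
    using conv by (intro attracted_toI[OF \<alpha>'(2) that]) auto
  have ret: "return P_spin (bern x) \<in> space PP_spin" for x by simp
  have M_ret: "return P_spin (bern ?z) \<noteq> M" using fluct_return[OF z(3,4)] means(3) z by auto
  have U_att: "attracted_to \<alpha> (return P_spin (bern ?z)) U"
    using att[OF ret[of ?z]] M_ret mean1_return[OF z(3,4)] by (simp add: f_def)
  \<comment> \<open>\<open>U\<close> is known only as a limit, so its mean is read off from a
    solution along which the mean is constant.\<close>
  have meanU: "mean1 U = ?z"
  proof -
    obtain \<rho> where \<rho>: "higher_solution \<alpha> \<rho>" "\<rho> 0 = return P_spin (bern ?z)" "limitin PP_top \<rho> U at_top"
      by (rule attracted_toE[OF U_att])
    have "((\<lambda>t. pexp (\<rho> t) (\<lambda>x. x ^ 1)) \<longlongrightarrow> pexp U (\<lambda>x. x ^ 1)) at_top"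
      using \<rho>(3) unfolding limitin_PP_top_moments[OF eventually_in_space[OF \<rho>(1)] U(1)] by blast
    then have l: "((\<lambda>t. mean1 (\<rho> t)) \<longlongrightarrow> mean1 U) at_top" by simp
    have "\<forall>\<^sub>F t in at_top. mean1 (\<rho> t) = ?z"
      using eventually_ge_at_top[of "0::real"]
      by eventually_elim (use mean_eq_z_mid[OF \<alpha>'(1) \<rho>(1)] \<rho>(2) mean1_return[OF z(3,4)] in simp)
    then have "((\<lambda>t. mean1 (\<rho> t)) \<longlongrightarrow> ?z) at_top" by (rule tendsto_eventually)
    with l show ?thesis by (rule tendsto_unique[OF trivial_limit_at_top_linorder])
  qed
  \<comment> \<open>The means separate all pairs except \<open>U\<close> and \<open>M\<close>, which
    differ in fluctuation.\<close>
  have dist: "A \<noteq> U" "A \<noteq> M" "A \<noteq> Z" "U \<noteq> M" "U \<noteq> Z" "M \<noteq> Z"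
    using means meanU U z by auto
  have fvals: "f A = A" "f U = U" "f M = M" "f Z = Z"
    using means meanU z dist by (auto simp: f_def)
  have low: "nu_under \<alpha> nu_low = A"
  proof (rule nu_under_eqI)
    have "f (return P_spin (bern 0)) = A" using mean1_return[of 0] z by (simp add: f_def)
    then show "attracted_to \<alpha> (return P_spin nu_low) A" using att[OF ret[of 0]] by (simp add: nu_low_def z_low_def)
  qed
  have upp: "nu_under \<alpha> (nu_upp \<alpha>) = Z"
  proof (rule nu_under_eqI)
    have "f (return P_spin (bern ?w)) = Z" using mean1_return[OF z(5,6)] z by (simp add: f_def)
    then show "attracted_to \<alpha> (return P_spin (nu_upp \<alpha>)) Z" using att[OF ret[of ?w]] by (simp add: nu_upp_def)
  qed
  have mid: "nu_under \<alpha> (nu_mid \<alpha>) = U"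
    by (rule nu_under_eqI) (use U_att in \<open>simp add: nu_mid_def\<close>)
  have fp: "higher_fixed_points \<alpha> = {A, U, M, Z}"
  proof -
    have "f ` space PP_spin = {A, U, M, Z}"
    proof
      show "f ` space PP_spin \<subseteq> {A, U, M, Z}" by (auto simp: f_def)
      show "{A, U, M, Z} \<subseteq> f ` space PP_spin" using fvals PP U(1) by (metis empty_subsetI image_eqI insert_subset)
    qed
    then show ?thesis using higher_fixed_points_eq[OF \<alpha>'(2) att] by simp
  qed
  have dom: "attraction_domain \<alpha> L = {\<rho> \<in> space PP_spin. f \<rho> = L}" for L
    by (rule attraction_domain_eq[OF att])
  have "f \<rho> = A \<longleftrightarrow> mean1 \<rho> < ?z" "f \<rho> = Z \<longleftrightarrow> mean1 \<rho> > ?z" "f \<rho> = M \<longleftrightarrow> \<rho> = M"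
    "f \<rho> = U \<longleftrightarrow> mean1 \<rho> = ?z \<and> \<rho> \<noteq> M" for \<rho>
    using dist means by (auto simp: f_def)
  then have doms: "attraction_domain \<alpha> A = {\<rho> \<in> space PP_spin. mean1 \<rho> < ?z}"
    "attraction_domain \<alpha> U = {\<rho> \<in> space PP_spin. mean1 \<rho> = ?z \<and> \<rho> \<noteq> M}"
    "attraction_domain \<alpha> M = {M}"
    "attraction_domain \<alpha> Z = {\<rho> \<in> space PP_spin. mean1 \<rho> > ?z}"
    using PP(2) unfolding dom by auto
  have "\<exists>L\<in>{A, U, M, Z}. limitin PP_top \<rho> L at_top" if "higher_solution \<alpha> \<rho>" for \<rho>
    using conv[OF that] unfolding f_def by (auto split: if_splits)
  moreover have "card {A, U, M, Z} = 4" using dist by simp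
  moreover have mm: "{\<rho> \<in> space PP_spin. Q (measure (mean_measure \<rho>) {True}) \<rho>} = {\<rho> \<in> space PP_spin. Q (mean1 \<rho>) \<rho>}" for Q
    using measure_mean_measure by auto
  ultimately show ?thesis
    unfolding low upp mid A_def[symmetric] M_def[symmetric] Z_def[symmetric] fp
    using dist doms mm[of "\<lambda>x _. x < ?z"] mm[of "\<lambda>x \<rho>. x = ?z \<and> \<rho> \<noteq> M"] mm[of "\<lambda>x _. x > ?z"] by simp
qed

text \<open>Here \<open>z_mid \<alpha>\<close> and \<open>z_upp \<alpha>\<close> are both 1/2, so
  the intermediate value of the mean joins the domain of the upper fixed point.\<close>

lemma critical:
  assumes \<alpha>: "\<alpha> = 4"
  shows "higher_fixed_points \<alpha> = {nu_over nu_low, nu_over (nu_upp \<alpha>)} \<and>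
        card (higher_fixed_points \<alpha>) = 2 \<and>
        attraction_domain \<alpha> (nu_over nu_low) =
          {\<rho>0 \<in> space PP_spin. measure (mean_measure \<rho>0) {True} < z_mid \<alpha>} \<and>
        attraction_domain \<alpha> (nu_over (nu_upp \<alpha>)) =
          {\<rho>0 \<in> space PP_spin. measure (mean_measure \<rho>0) {True} \<ge> z_mid \<alpha>}"
proof -
  have \<alpha>': "\<alpha> \<ge> 4" "\<alpha> \<ge> 0" using \<alpha> by auto
  let ?z = "z_mid \<alpha>" and ?w = "z_upp \<alpha>"
  have z: "0 < ?z" "0 \<le> ?w" "?w \<le> 1" "?z \<le> ?w" using z_facts[OF \<alpha>'(1)] by auto
  define A Z where "A = nu_over nu_low" and "Z = nu_over (nu_upp \<alpha>)"
  have PP: "A \<in> space PP_spin" "Z \<in> space PP_spin"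
    unfolding A_def Z_def nu_low_def nu_upp_def by (rule nu_over_in_PP_spin)+
  have means: "mean1 A = 0" "mean1 Z = ?w"
    unfolding A_def Z_def nu_low_def nu_upp_def z_low_def using z by (auto simp: mean1_nu_over)
  define f where "f \<rho> = (if mean1 \<rho> < ?z then A else Z)" for \<rho>
  have att: "attracted_to \<alpha> \<rho>0 (f \<rho>0)" if "\<rho>0 \<in> space PP_spin" for \<rho>0
  proof (rule attracted_toI[OF \<alpha>'(2) that])
    fix \<rho> assume sol: "higher_solution \<alpha> \<rho>" and 0: "\<rho> 0 = \<rho>0"
    show "limitin PP_top \<rho> (f \<rho>0) at_top"
    proof (cases "mean1 \<rho>0 < ?z")
      case True then show ?thesis using converges_to_low[OF \<alpha>'(1) sol] 0 by (simp add: f_def A_def)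
    next
      case False
      then show ?thesis using converges_to_upp[OF \<alpha>'(1) sol mean_tendsto_half[OF \<alpha> sol]] 0 by (simp add: f_def Z_def)
    qed
  qed
  have ne: "A \<noteq> Z" using means z by auto
  have fvals: "f A = A" "f Z = Z" using means z by (auto simp: f_def)
  have fp: "higher_fixed_points \<alpha> = {A, Z}"
  proof -
    have "f ` space PP_spin = {A, Z}"
    proof
      show "f ` space PP_spin \<subseteq> {A, Z}" by (auto simp: f_def)
      show "{A, Z} \<subseteq> f ` space PP_spin" using fvals PP by (metis empty_subsetI image_eqI insert_subset)
    qed
    then show ?thesis using higher_fixed_points_eq[OF \<alpha>'(2) att] by simp
  qed
  have dom: "attraction_domain \<alpha> L = {\<rho> \<in> space PP_spin. f \<rho> = L}" for L
    by (rule attraction_domain_eq[OF att])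
  have "f \<rho> = A \<longleftrightarrow> mean1 \<rho> < ?z" "f \<rho> = Z \<longleftrightarrow> mean1 \<rho> \<ge> ?z" for \<rho>
    using ne by (auto simp: f_def)
  then have doms: "attraction_domain \<alpha> A = {\<rho> \<in> space PP_spin. mean1 \<rho> < ?z}"
    "attraction_domain \<alpha> Z = {\<rho> \<in> space PP_spin. mean1 \<rho> \<ge> ?z}"
    unfolding dom by auto
  have mm: "{\<rho> \<in> space PP_spin. Q (measure (mean_measure \<rho>) {True})} = {\<rho> \<in> space PP_spin. Q (mean1 \<rho>)}" for Q
    using measure_mean_measure by auto
  show ?thesis
    unfolding A_def[symmetric] Z_def[symmetric] fp
    using ne doms mm[of "\<lambda>x. x < ?z"] mm[of "\<lambda>x. x \<ge> ?z"] by simp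
qed

theorem theorem17:
  fixes \<alpha> :: real
  assumes "\<alpha> \<ge> 0"
  shows
    "(\<alpha> > 4 \<longrightarrow>
        nu_under \<alpha> nu_low = nu_over nu_low \<and>
        nu_under \<alpha> (nu_upp \<alpha>) = nu_over (nu_upp \<alpha>) \<and>
        nu_under \<alpha> (nu_mid \<alpha>) \<noteq> nu_over (nu_mid \<alpha>) \<and>
        higher_fixed_points \<alpha> =
          {nu_over nu_low, nu_under \<alpha> (nu_mid \<alpha>), nu_over (nu_mid \<alpha>), nu_over (nu_upp \<alpha>)} \<and>
        card (higher_fixed_points \<alpha>) = 4 \<and>
        (\<forall>\<rho>. higher_solution \<alpha> \<rho> \<longrightarrow>
           (\<exists>L \<in> {nu_over nu_low, nu_under \<alpha> (nu_mid \<alpha>), nu_over (nu_mid \<alpha>), nu_over (nu_upp \<alpha>)}.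
              limitin PP_top \<rho> L at_top)) \<and>
        attraction_domain \<alpha> (nu_over nu_low) =
          {\<rho>0 \<in> space PP_spin. measure (mean_measure \<rho>0) {True} < z_mid \<alpha>} \<and>
        attraction_domain \<alpha> (nu_under \<alpha> (nu_mid \<alpha>)) =
          {\<rho>0 \<in> space PP_spin. measure (mean_measure \<rho>0) {True} = z_mid \<alpha> \<and>
             \<rho>0 \<noteq> nu_over (nu_mid \<alpha>)} \<and>
        attraction_domain \<alpha> (nu_over (nu_mid \<alpha>)) = {nu_over (nu_mid \<alpha>)} \<and>
        attraction_domain \<alpha> (nu_over (nu_upp \<alpha>)) =
          {\<rho>0 \<in> space PP_spin. measure (mean_measure \<rho>0) {True} > z_mid \<alpha>}) \<and>
     (\<alpha> = 4 \<longrightarrow>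
        higher_fixed_points \<alpha> = {nu_over nu_low, nu_over (nu_upp \<alpha>)} \<and>
        card (higher_fixed_points \<alpha>) = 2 \<and>
        attraction_domain \<alpha> (nu_over nu_low) =
          {\<rho>0 \<in> space PP_spin. measure (mean_measure \<rho>0) {True} < z_mid \<alpha>} \<and>
        attraction_domain \<alpha> (nu_over (nu_upp \<alpha>)) =
          {\<rho>0 \<in> space PP_spin. measure (mean_measure \<rho>0) {True} \<ge> z_mid \<alpha>}) \<and>
     (\<alpha> < 4 \<longrightarrow>
        (\<forall>\<rho>. higher_solution \<alpha> \<rho> \<longrightarrow> limitin PP_top \<rho> (nu_over nu_low) at_top))"
proof (rule conjI[OF impI[OF supercritical] conjI[OF impI[OF critical] impI]])
  assume "\<alpha> < 4"
  then show "\<forall>\<rho>. higher_solution \<alpha> \<rho> \<longrightarrow> limitin PP_top \<rho> (nu_over nu_low) at_top"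
    using limitin_nu_low mean_tendsto_0_subcritical[OF assms] by blast
qed

end
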